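(* Let $L=K_1\cup K_2$ and $L'=K_1'\cup K_2'$ be oriented $2$-component virtual links with $\lambda=\lambda(L)=\lambda(L')\geq 2$. Then $L$ and $L'$ are related by a finite sequence of shell moves (that is, they are S-equivalent) if and only if (i) $J_n(K_1;L)=J_n(K_1';L')$ for any $n\ne 0,1,-\lambda,-\lambda+1$, (ii) $J_n(K_2;L)=J_n(K_2';L')$ for any $n\ne 0,1,\lambda,\lambda+1$, (iii) $F(L)=F(L')$, and (iv) $J_1(K_1;L)+J_{-\lambda+1}(K_1;L)+J_1(K_2;L)+J_{\lambda+1}(K_2;L)=J_1(K_1';L')+J_{-\lambda+1}(K_1';L')+J_1(K_2';L')+J_{\lambda+1}(K_2';L')$.
   Context: Gauss diagrams. A Gauss diagram is a disjoint union of oriented circles $C_1,\dots,C_\mu$ together with finitely many chords. Each chord joins two points of the circles (its endpoints; all endpoints of all chords are distinct), is oriented from its initial to its terminal endpoint, and carries a sign $\varepsilon\in\{+1,-1\}$. For a chord of sign $\varepsilon$, the initial endpoint is given the sign $-\varepsilon$ and the terminal endpoint the sign $\varepsilon$. Only the cyclic order of the endpoints on each circle matters. A chord is a self-chord if both endpoints lie on the same circle, otherwise a nonself-chord; a nonself-chord is of type $(i,j)$ if it is oriented from $C_i$ to $C_j$. Endpoints are adjacent (consecutive) if they bound an arc of a circle containing no other endpoint in its interior. Reidemeister moves. R1: insert or delete a self-chord (of any sign and orientation) whose two endpoints are adjacent. R2: insert or delete two chords of opposite signs whose initial endpoints are adjacent and whose terminal endpoints are adjacent (in any order). R3: let $a,b,c$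 be three chords of the same sign such that, along the orientation of the circles, the initial endpoint of $a$ is immediately followed by the initial endpoint of $b$, the terminal endpoint of $a$ is immediately followed by the initial endpoint of $c$, and the terminal endpoint of $b$ is immediately followed by the terminal endpoint of $c$; exchange the two endpoints in each of these three adjacent pairs (or the inverse). An oriented $\mu$-component virtual link is an equivalence class of Gauss diagrams with $\mu$ (ordered) circles under R1, R2, R3; $L=K_1\cup K_2$ means that $K_i$ corresponds to $C_i$. Shells. Shells for a chord $\gamma$ at an endpoint $p$ of $\gamma$ are self-chords surrounding $p$ in parallel: for shells $s_1,\dots,s_k$ the consecutive endpoints on the circle are: one endpoint of $s_k$, ..., one endpoint of $s_1$, then $p$, then the other endpoint of $s_1$, ..., the other endpoint of $s_k$. If $p$ has positive sign, each shell is oriented as the circle (its initial endpoint precedes $p$ and its terminal endpoint follows $p$); if $p$ has negative sign, each shell is oriented oppositely. The sign of a shell is arbitrary. Shell moves. S1: delete a shell immediately surrounding one endpoint of a chord $\gamma$, and insert a shell of the same sign immediately surrounding the other endpoint of $\gamma$. S2: let $p,q$ be endpoints of two distinct chords with $p$ immediately followed by $q$ along the circle, with signs $\varepsilon_p,\varepsilon_q$; exchange their positions, and add a shell of sign $\varepsilon_p\varepsilon_q$ immediately surrounding $p$ and a shell of sign $-\varepsilon_p\varepsilon_q$ immediately surrounding $q$. Inverses are also allowed. Two virtual links are S-equivalent (related by a finite sequence of shell moves) if their Gauss diagrams are related by a finite sequence of R1, R2, R3, S1, S2. Invariants. Let $G$ be a Gauss diagram of $L=K_1\cup K_2$. ${\rm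 Lk}(K_i,K_j)$ is the sum of signs of all nonself-chords of type $(i,j)$, and $\lambda=\lambda(L)={\rm Lk}(K_1,K_2)-{\rm Lk}(K_2,K_1)$. For a self-chord $\gamma$ on $C_i$, ${\rm Ind}'(\gamma)$ is the sum of the signs of endpoints of all (self- and nonself-) chords on the open arc of $C_i$ running along the orientation from the initial endpoint of $\gamma$ to its terminal endpoint. $J_n(K_1;L)$ for $n\ne 0,-\lambda$ (resp. $J_n(K_2;L)$ for $n\neq 0,\lambda$) is the sum of signs of the self-chords $\gamma$ on $C_1$ (resp. $C_2$) with ${\rm Ind}'(\gamma)=n$; these do not depend on the choice of $G$. Linking class. Take $G$ with at least one nonself-chord and fix a nonself-chord $\gamma_0$. For a nonself-chord $\gamma$ of type $(i,j)$, ${\rm Ind}'(\gamma;\gamma_0)$ is the sum of the signs of endpoints of all chords on $\alpha\cup\beta$, where $\alpha$ is the arc of $C_i$ running along the orientation from the initial endpoint of $\gamma$ to the endpoint of $\gamma_0$ on $C_i$, and $\beta$ is the arc of $C_j$ running along the orientation from the endpoint of $\gamma_0$ on $C_j$ to the terminal endpoint of $\gamma$ (endpoints of $\gamma$ and $\gamma_0$ themselves not counted; ${\rm Ind}'(\gamma_0;\gamma_0)=0$). Let $J_n^{ij}(G;\gamma_0)$ be the sum of signs of nonself-chords $\gamma$ of type $(i,j)$ with ${\rm Ind}'(\gamma;\gamma_0)=n$ and $F_{ij}(t;\gamma_0)=\sum_{n\in\mathbb{Z}}J_n^{ij}(G;\gamma_0)t^n$. For $s\ge 0$ let $\Lambda_s=\mathbb{Z}[t,t^{-1}]/(t^s-1)$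 (so $\Lambda_0=\mathbb{Z}[t,t^{-1}]$, $\Lambda_1=\mathbb{Z}$), and let $\Gamma(s)$ be the quotient of $\Lambda_s\times\Lambda_s$ by $(f,g)\sim(t^kf,t^{-k}g)$, $k\in\mathbb{Z}$; classes are written $[f,g]$. The linking class $F(L)=[F_{12}(t;\gamma_0),F_{21}(t;\gamma_0)]\in\Gamma(\lambda)$ (for $\lambda\ge0$) does not depend on $\gamma_0$ or $G$. *)

theory Defs
  imports
    "HOL-Library.Poly_Mapping"
    "HOL-Combinatorics.Transposition"
begin

section \<open>Gauss diagrams\<close>

text \<open>
  The sign is part of the name of a chord, so that a Gauss diagram is determined by the words
  read off its circles. A word lists the endpoints on a circle along the orientation, starting
  anywhere; the choice of the starting points and of the names of the chords is factored out by
  \<open>same_diagram\<close> below.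
\<close>

datatype chord = Chord (label: nat) (positive: bool)

datatype 'c endpoint = Initial (chord_of: 'c) | Terminal (chord_of: 'c)

type_synonym gauss = "chord endpoint list list"

definition chord_sign :: "chord \<Rightarrow> int" where
  "chord_sign c = (if positive c then 1 else -1)"

fun endpoint_sign :: "chord endpoint \<Rightarrow> int" where
  "endpoint_sign (Initial c) = - chord_sign c"
| "endpoint_sign (Terminal c) = chord_sign c"

definition gauss_diagram :: "nat \<Rightarrow> gauss \<Rightarrow> bool" where
  "gauss_diagram \<mu> D \<longleftrightarrow> length D = \<mu> \<and> distinct (concat D) \<and>
     (\<forall>c. Initial c \<in> set (concat D) \<longleftrightarrow> Terminal c \<in> set (concat D))"

definition chords :: "gauss \<Rightarrow> chord set" where
  "chords D = chord_of ` set (concat D)"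

text \<open>The circles are numbered from 1.\<close>

definition circle :: "gauss \<Rightarrow> nat \<Rightarrow> chord endpoint list" where
  "circle D i = D ! (i - 1)"

text \<open>
  The chords oriented from the \<open>i\<close>-th to the \<open>j\<close>-th circle; these are the nonself-chords of type
  \<open>(i, j)\<close> if \<open>i \<noteq> j\<close>, and the self-chords on the \<open>i\<close>-th circle if \<open>i = j\<close>.
\<close>

definition chords_of_type :: "gauss \<Rightarrow> nat \<Rightarrow> nat \<Rightarrow> chord set" where
  "chords_of_type D i j = {c. Initial c \<in> set (circle D i) \<and> Terminal c \<in> set (circle D j)}"

definition same_diagram :: "gauss \<Rightarrow> gauss \<Rightarrow> bool" where
  "same_diagram D D' \<longleftrightarrow>
     (\<exists>f. inj_on f (chords D) \<and> (\<forall>c\<in>chords D. positive (f c) = positive c) \<and>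
          list_all2 (\<lambda>w w'. \<exists>k. w' = rotate k (map (map_endpoint f) w)) D D')"

text \<open>\<open>followed_by D p q\<close>: along the orientation, \<open>p\<close> is immediately followed by \<open>q\<close>.\<close>

definition followed_by :: "gauss \<Rightarrow> chord endpoint \<Rightarrow> chord endpoint \<Rightarrow> bool" where
  "followed_by D p q \<longleftrightarrow> (\<exists>w\<in>set D. \<exists>k u. rotate k w = p # q # u)"

definition adjacent :: "gauss \<Rightarrow> chord endpoint \<Rightarrow> chord endpoint \<Rightarrow> bool" where
  "adjacent D p q \<longleftrightarrow> followed_by D p q \<or> followed_by D q p"

definition delete_chord :: "chord \<Rightarrow> gauss \<Rightarrow> gauss" where
  "delete_chord c D = map (filter (\<lambda>e. chord_of e \<noteq> c)) D"


section \<open>Moves\<close>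

text \<open>
  Each move is described in one direction only; the inverse moves are added by \<open>equivclp\<close>.
  Inserting a chord is described as the inverse of deleting it.
\<close>

definition R1 :: "gauss \<Rightarrow> gauss \<Rightarrow> bool" where
  "R1 D D' \<longleftrightarrow> (\<exists>c. adjacent D (Initial c) (Terminal c) \<and> D' = delete_chord c D)"

definition R2 :: "gauss \<Rightarrow> gauss \<Rightarrow> bool" where
  "R2 D D' \<longleftrightarrow> (\<exists>c d. chord_sign d = - chord_sign c \<and>
     adjacent D (Initial c) (Initial d) \<and> adjacent D (Terminal c) (Terminal d) \<and>
     D' = delete_chord c (delete_chord d D))"

definition R3 :: "gauss \<Rightarrow> gauss \<Rightarrow> bool" where
  "R3 D D' \<longleftrightarrow> (\<exists>a b c. distinct [a, b, c] \<and>
     chord_sign a = chord_sign b \<and> chord_sign b = chord_sign c \<and>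
     followed_by D (Initial a) (Initial b) \<and>
     followed_by D (Terminal a) (Initial c) \<and>
     followed_by D (Terminal b) (Terminal c) \<and>
     D' = map (map (transpose (Initial a) (Initial b) \<circ> transpose (Terminal a) (Initial c) \<circ>
                    transpose (Terminal b) (Terminal c))) D)"

text \<open>The chord \<open>s\<close> is a shell immediately surrounding the endpoint \<open>p\<close> of another chord.\<close>

definition shell :: "gauss \<Rightarrow> chord \<Rightarrow> chord endpoint \<Rightarrow> bool" where
  "shell D s p \<longleftrightarrow> chord_of p \<noteq> s \<and>
     (if endpoint_sign p = 1
      then followed_by D (Initial s) p \<and> followed_by D p (Terminal s)
      else followed_by D (Terminal s) p \<and> followed_by D p (Initial s))"

text \<open>The name of a chord contains its sign, so reusing \<open>s\<close> keeps the sign of the shell.\<close>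

definition S1 :: "gauss \<Rightarrow> gauss \<Rightarrow> bool" where
  "S1 D D' \<longleftrightarrow> (\<exists>s \<gamma> p q. {p, q} = {Initial \<gamma>, Terminal \<gamma>} \<and>
     shell D s p \<and> shell D' s q \<and> delete_chord s D = delete_chord s D')"

definition S2 :: "gauss \<Rightarrow> gauss \<Rightarrow> bool" where
  "S2 D D' \<longleftrightarrow> (\<exists>p q s t. chord_of p \<noteq> chord_of q \<and> followed_by D p q \<and>
     chord_sign s = endpoint_sign p * endpoint_sign q \<and>
     chord_sign t = - (endpoint_sign p * endpoint_sign q) \<and>
     s \<notin> chords D \<and> t \<notin> chords D \<and> shell D' s p \<and> shell D' t q \<and>
     delete_chord s (delete_chord t D') = map (map (transpose p q)) D)"

definition R_step :: "nat \<Rightarrow> gauss \<Rightarrow> gauss \<Rightarrow> bool" where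
  "R_step \<mu> D D' \<longleftrightarrow> gauss_diagram \<mu> D \<and> gauss_diagram \<mu> D' \<and>
     (same_diagram D D' \<or> R1 D D' \<or> R2 D D' \<or> R3 D D')"

definition RS_step :: "nat \<Rightarrow> gauss \<Rightarrow> gauss \<Rightarrow> bool" where
  "RS_step \<mu> D D' \<longleftrightarrow> gauss_diagram \<mu> D \<and> gauss_diagram \<mu> D' \<and>
     (same_diagram D D' \<or> R1 D D' \<or> R2 D D' \<or> R3 D D' \<or> S1 D D' \<or> S2 D D')"


section \<open>Virtual links\<close>

definition R_equiv :: "nat \<Rightarrow> (gauss \<times> gauss) set" where
  "R_equiv \<mu> = {(D, D'). gauss_diagram \<mu> D \<and> gauss_diagram \<mu> D' \<and> equivclp (R_step \<mu>) D D'}"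

lemma equiv_R_equiv: "equiv {D. gauss_diagram \<mu> D} (R_equiv \<mu>)"
  by (rule equivI)
    (auto simp: R_equiv_def refl_on_def sym_def trans_def intro: equivclp_sym equivclp_trans)

definition virtual_links :: "nat \<Rightarrow> gauss set set" where
  "virtual_links \<mu> = {D. gauss_diagram \<mu> D} // R_equiv \<mu>"

definition S_equivalent :: "nat \<Rightarrow> gauss set \<Rightarrow> gauss set \<Rightarrow> bool" where
  "S_equivalent \<mu> L L' \<longleftrightarrow> (\<exists>D\<in>L. \<exists>D'\<in>L'. equivclp (RS_step \<mu>) D D')"


section \<open>Invariants computed from a Gauss diagram\<close>

definition Lk :: "gauss \<Rightarrow> nat \<Rightarrow> nat \<Rightarrow> int" where
  "Lk D i j = (\<Sum>c\<in>chords_of_type D i j. chord_sign c)"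

definition lambda_diagram :: "gauss \<Rightarrow> int" where
  "lambda_diagram D = Lk D 1 2 - Lk D 2 1"

text \<open>
  The endpoints on the open arc running from \<open>p\<close> to \<open>q\<close> along the orientation of a circle with
  word \<open>w\<close> (where \<open>p\<close> and \<open>q\<close> are distinct and occur in \<open>w\<close>): rotate \<open>w\<close> such that it starts with
  \<open>p\<close>, and take the part strictly between \<open>p\<close> and \<open>q\<close>.
\<close>

definition open_arc ::
    "chord endpoint list \<Rightarrow> chord endpoint \<Rightarrow> chord endpoint \<Rightarrow> chord endpoint list" where
  "open_arc w p q =
     takeWhile (\<lambda>e. e \<noteq> q) (tl (dropWhile (\<lambda>e. e \<noteq> p) w @ takeWhile (\<lambda>e. e \<noteq> p) w))"

definition arc_sum :: "chord endpoint list \<Rightarrow> chord endpoint \<Rightarrow> chord endpoint \<Rightarrow> int" where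
  "arc_sum w p q = (\<Sum>e\<leftarrow>open_arc w p q. endpoint_sign e)"

definition Ind_self :: "gauss \<Rightarrow> nat \<Rightarrow> chord \<Rightarrow> int" where
  "Ind_self D i \<gamma> = arc_sum (circle D i) (Initial \<gamma>) (Terminal \<gamma>)"

definition J_diagram :: "gauss \<Rightarrow> nat \<Rightarrow> int \<Rightarrow> int" where
  "J_diagram D i n = (\<Sum>\<gamma> | \<gamma> \<in> chords_of_type D i i \<and> Ind_self D i \<gamma> = n. chord_sign \<gamma>)"

definition nonself_chords :: "gauss \<Rightarrow> chord set" where
  "nonself_chords D = chords_of_type D 1 2 \<union> chords_of_type D 2 1"

definition endpoint_on :: "gauss \<Rightarrow> nat \<Rightarrow> chord \<Rightarrow> chord endpoint" where
  "endpoint_on D i c = (if Initial c \<in> set (circle D i) then Initial c else Terminal c)"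

text \<open>
  For \<open>\<gamma>\<close> of type \<open>(i, j)\<close>. With two circles and \<open>\<gamma> \<noteq> \<gamma>0\<close>, no endpoint of \<open>\<gamma>\<close> or \<open>\<gamma>0\<close> lies
  inside the two open arcs.
\<close>

definition Ind_nonself :: "gauss \<Rightarrow> chord \<Rightarrow> nat \<Rightarrow> nat \<Rightarrow> chord \<Rightarrow> int" where
  "Ind_nonself D \<gamma>0 i j \<gamma> =
     (if \<gamma> = \<gamma>0 then 0
      else arc_sum (circle D i) (Initial \<gamma>) (endpoint_on D i \<gamma>0) +
           arc_sum (circle D j) (endpoint_on D j \<gamma>0) (Terminal \<gamma>))"

definition J_nonself :: "gauss \<Rightarrow> chord \<Rightarrow> nat \<Rightarrow> nat \<Rightarrow> int \<Rightarrow> int" where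
  "J_nonself D \<gamma>0 i j n =
     (\<Sum>\<gamma> | \<gamma> \<in> chords_of_type D i j \<and> Ind_nonself D \<gamma>0 i j \<gamma> = n. chord_sign \<gamma>)"

text \<open>
  Poly-mappings from \<^typ>\<open>int\<close> to \<^typ>\<open>int\<close> with their convolution product are the integral Laurent
  polynomials.
\<close>

type_synonym laurent = "int \<Rightarrow>\<^sub>0 int"

definition t_power :: "int \<Rightarrow> laurent" where
  "t_power k = Poly_Mapping.single k 1"

text \<open>Only finitely many coefficients are nonzero, since a Gauss diagram has finitely many chords.\<close>

definition F_poly :: "gauss \<Rightarrow> chord \<Rightarrow> nat \<Rightarrow> nat \<Rightarrow> laurent" where
  "F_poly D \<gamma>0 i j =
     (\<Sum>n | J_nonself D \<gamma>0 i j n \<noteq> 0. of_int (J_nonself D \<gamma>0 i j n) * t_power n)"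

text \<open>
  \<open>Lambda_class s f\<close> is the class of \<open>f\<close> in \<open>\<Lambda>\<^sub>s\<close>, the quotient by the ideal generated
  by \<open>t^s - 1\<close>, and \<open>Gamma_class s f g\<close> is \<open>[f, g] \<in> \<Gamma>(s)\<close>, the orbit of the pair of these classes.
\<close>

definition Lambda_class :: "nat \<Rightarrow> laurent \<Rightarrow> laurent set" where
  "Lambda_class s f = {g. (t_power (int s) - 1) dvd (g - f)}"

definition Gamma_class :: "nat \<Rightarrow> laurent \<Rightarrow> laurent \<Rightarrow> (laurent set \<times> laurent set) set" where
  "Gamma_class s f g =
     {(Lambda_class s (t_power k * f), Lambda_class s (t_power (- k) * g)) | k :: int. True}"

definition F_diagram :: "gauss \<Rightarrow> chord \<Rightarrow> (laurent set \<times> laurent set) set" where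
  "F_diagram D \<gamma>0 =
     Gamma_class (nat (lambda_diagram D)) (F_poly D \<gamma>0 1 2) (F_poly D \<gamma>0 2 1)"


section \<open>Invariants of virtual links\<close>

text \<open>
  Each invariant is the common value over all Gauss diagrams of the link. \<open>J L i n\<close>, standing for
  \<open>J\<^sub>n(K\<^sub>i; L)\<close>, is meaningful only for \<open>n \<noteq> 0, -\<lambda>\<close> if \<open>i = 1\<close> and for \<open>n \<noteq> 0, \<lambda>\<close> if \<open>i = 2\<close>,
  and \<open>linking_class\<close> only for \<open>\<lambda> \<ge> 0\<close>.
\<close>

definition lambda :: "gauss set \<Rightarrow> int" where
  "lambda L = (THE v. \<forall>D\<in>L. v = lambda_diagram D)"

definition J :: "gauss set \<Rightarrow> nat \<Rightarrow> int \<Rightarrow> int" where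
  "J L i n = (THE v. \<forall>D\<in>L. v = J_diagram D i n)"

definition linking_class :: "gauss set \<Rightarrow> (laurent set \<times> laurent set) set" where
  "linking_class L = (THE x. \<forall>D\<in>L. \<forall>\<gamma>0\<in>nonself_chords D. x = F_diagram D \<gamma>0)"

end

theory Submission
  imports Defs "HOL-Library.Nat_Bijection" "HOL-Library.Multiset"
begin

text \<open>
  A shell around an endpoint of a chord is treated as a decoration of the chord. Parallel shells of
  opposite signs cancel by an R2 move, and S1 carries a shell from one endpoint of its chord to the
  other, so up to shell moves only the signed number of shells at each chord matters. Diagrams are
  therefore replaced by pairs of a diagram \<open>D\<close> and a weight \<open>m c\<close> for every chord \<open>c\<close>, the number of
  shells at \<open>c\<close>. The move S2 then says that adjacent endpoints \<open>p\<close> and \<open>q\<close> of different chords may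
  be exchanged if \<open>\<epsilon>\<^sub>p \<epsilon>\<^sub>q\<close> is added to the weight of the chord of \<open>p\<close> and subtracted from the weight
  of the chord of \<open>q\<close>. A shell of sign \<open>\<delta>\<close> at a chord of sign \<open>\<epsilon>\<close> lowers the index of the chord by
  \<open>\<epsilon> \<delta>\<close>, and the change of weights in an exchange compensates exactly for the change of the arcs.
  So the index of \<open>c\<close> corrected by \<open>- \<epsilon> (m c)\<close> survives every exchange.

  Invariance. Each move of diagrams is a short sequence of elementary operations on weighted
  diagrams: rotating a word, exchanging two adjacent endpoints, deleting an isolated chord or a
  parallel pair, and absorbing a shell into the weight of the chord that it surrounds. R3 consists
  of three exchanges whose changes of weight add up to zero, S1 absorbs the same shell at either end
  of a chord, and S2 is an exchange followed by two absorptions (\<open>R_agree_R_step\<close>,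
  \<open>S_agree_RS_step\<close>). Only an absorption changes the sum of the signs of all self-chords of some
  nontrivial index: it removes a self-chord whose index is \<open>1\<close>, or \<open>1\<close> plus the sum of all signs on its circle, and it adds
  the sign of this chord to the total weight. This is where the excluded indices and the sum of
  the four remaining writhes come from.

  Completeness (\<open>S_agree_imp_RS_equiv\<close>). Exchanges rearrange a word arbitrarily, except that they
  never move the two endpoints of one chord past each other. Hence a weighted diagram is determined,
  up to moves, by its chords together with their types, signs and corrected indices
  (\<open>zequiv_permute\<close>). Self-chords of one of the excluded indices can be removed (\<open>std_drop\<close>,
  \<open>std_drop_wrapped\<close>), and two chords of the same type and index but of opposite signs cancel
  (\<open>std_cancel\<close>). Pushing an endpoint of a nonself-chord once around its circle changes the index
  of this chord by \<open>\<plusminus>\<lambda>\<close> and shifts the indices of the nonself-chords of types \<open>(1, 2)\<close> and \<open>(2, 1)\<close>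
  by opposite amounts (\<open>std_shift\<close>); this is the equivalence relation behind \<open>\<Gamma>(\<lambda>)\<close>.

  Given two diagrams with equal invariants, all chords of the second one and their mirror images with
  opposite signs are inserted into the first one. The chords of the first diagram then cancel
  against the mirror images; the multiples of \<open>\<lambda>\<close> by which the indices of nonself-chords differ are
  pushed onto one fixed nonself-chord \<open>y\<close>, which exists because \<open>\<lambda> \<noteq> 0\<close>. What remains is the second
  diagram, but with the index of \<open>y\<close> changed by some \<open>b \<lambda>\<close>. The last invariant counts all shells,
  and it forces \<open>b = 0\<close> (\<open>S_agree_imp_zequiv\<close>).
\<close>

section \<open>Words of endpoints\<close>

definition sign_sum :: "chord endpoint list \<Rightarrow> int" where
  "sign_sum w = (\<Sum>e\<leftarrow>w. endpoint_sign e)"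

lemma sign_sum_simps [simp]:
  "sign_sum [] = 0" "sign_sum (x # w) = endpoint_sign x + sign_sum w" "sign_sum (a @ b) = sign_sum a + sign_sum b"
  by (simp_all add: sign_sum_def)

text \<open>
  Up to constants, the sum of signs over an arc is a difference of heights; this turns statements
  about arcs into statements about prefixes of a word.
\<close>

definition height :: "chord endpoint list \<Rightarrow> chord endpoint \<Rightarrow> int" where
  "height w e = sign_sum (takeWhile (\<lambda>x. x \<noteq> e) w)"

lemma height_Nil [simp]: "height [] e = 0"
  by (simp add: height_def)

lemma height_Cons [simp]: "height (x # w) e = (if x = e then 0 else endpoint_sign x + height w e)"
  by (simp add: height_def)

lemma height_append: "height (a @ b) e = (if e \<in> set a then height a e else sign_sum a + height b e)"
  by (induction a) auto

definition precedes :: "'a list \<Rightarrow> 'a \<Rightarrow> 'a \<Rightarrow> bool" where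
  "precedes w x y \<longleftrightarrow> x \<in> set (takeWhile (\<lambda>e. e \<noteq> y) w)"

lemma precedes_Nil [simp]: "\<not> precedes [] x y"
  by (simp add: precedes_def)

lemma precedes_Cons [simp]: "precedes (z # w) x y \<longleftrightarrow> z \<noteq> y \<and> (x = z \<or> precedes w x y)"
  by (auto simp: precedes_def)

lemma precedes_append:
  "precedes (a @ b) x y \<longleftrightarrow> (if y \<in> set a then precedes a x y else x \<in> set a \<or> precedes b x y)"
  by (induction a) auto

lemma precedes_in_set: "precedes w x y \<Longrightarrow> x \<in> set w"
  by (induction w) (auto split: if_splits)

lemma precedes_filter: "P x \<Longrightarrow> P y \<Longrightarrow> precedes (filter P w) x y \<longleftrightarrow> precedes w x y"
  by (induction w) auto

fun next_to :: "'a list \<Rightarrow> 'a \<Rightarrow> 'a \<Rightarrow> bool" where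
  "next_to [] p q = False"
| "next_to (x # w) p q = ((x = p \<and> w \<noteq> [] \<and> hd w = q) \<or> next_to w p q)"

lemma next_to_append:
  "next_to (a @ b) p q \<longleftrightarrow>
     next_to a p q \<or> next_to b p q \<or> (a \<noteq> [] \<and> b \<noteq> [] \<and> last a = p \<and> hd b = q)"
  by (induction a) auto

lemma next_to_iff: "next_to w p q \<longleftrightarrow> (\<exists>a b. w = a @ p # q # b)"
proof
  show "next_to w p q \<Longrightarrow> \<exists>a b. w = a @ p # q # b"
  proof (induction w)
    case (Cons x w)
    show ?case
    proof (cases "next_to w p q")
      case True
      then obtain a b where "w = a @ p # q # b" using Cons.IH by blast
      then have "x # w = (x # a) @ p # q # b" by simp
      then show ?thesis by blast
    next
      case False
      then have "x # w = [] @ p # q # tl w" using Cons.prems by (cases w) auto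
      then show ?thesis by blast
    qed
  qed simp
  show "\<exists>a b. w = a @ p # q # b \<Longrightarrow> next_to w p q"
    by (auto simp: next_to_append)
qed

lemma next_to_filter:
  assumes "next_to w p q" "P p" "P q"
  shows "next_to (filter P w) p q"
proof -
  obtain a b where "w = a @ p # q # b" using assms(1) by (auto simp: next_to_iff)
  then have "filter P w = filter P a @ p # q # filter P b" using assms(2,3) by simp
  then show ?thesis by (auto simp: next_to_iff)
qed

lemma next_to_in_set: "next_to w p q \<Longrightarrow> p \<in> set w \<and> q \<in> set w"
  by (auto simp: next_to_iff)

lemma next_to_rotate:
  assumes "next_to (rotate k w) p q"
  shows "next_to w p q \<or> (w \<noteq> [] \<and> last w = p \<and> hd w = q)"
proof -
  define a where "a = take (k mod length w) w"
  define b where "b = drop (k mod length w) w"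
  have w: "w = a @ b" and r: "rotate k w = b @ a"
    by (simp_all add: a_def b_def rotate_drop_take)
  show ?thesis using assms unfolding r unfolding w by (auto simp: next_to_append)
qed

text \<open>
  An arc that runs across the starting point of the word is the complement of one that does not,
  which accounts for the additional sum of all signs.
\<close>

lemma arc_sum_eq:
  assumes d: "distinct w" and p: "p \<in> set w" and q: "q \<in> set w" and pq: "p \<noteq> q"
  shows "arc_sum w p q =
    height w q - height w p - endpoint_sign p + (if precedes w q p then sign_sum w else 0)"
proof -
  obtain a b where w: "w = a @ p # b" using p by (auto simp: in_set_conv_decomp)
  have pab: "p \<notin> set a" "p \<notin> set b" using d w by auto
  have 1: "dropWhile (\<lambda>e. e \<noteq> p) w = p # b" "takeWhile (\<lambda>e. e \<noteq> p) w = a"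
    unfolding w using pab by (auto simp: dropWhile_append takeWhile_append)
  have oa: "open_arc w p q = takeWhile (\<lambda>e. e \<noteq> q) (b @ a)"
    unfolding open_arc_def 1 by simp
  have arc: "arc_sum w p q = height (b @ a) q"
    by (simp add: arc_sum_def oa height_def sign_sum_def)
  show ?thesis
  proof (cases "q \<in> set a")
    case True
    then have "q \<notin> set b" using d w by auto
    then show ?thesis unfolding arc using True pab pq
      by (simp add: w height_append precedes_append)
  next
    case False
    then have "q \<in> set b" using q pq w by auto
    then show ?thesis unfolding arc using False pab pq
      by (simp add: w height_append precedes_append)
  qed
qed

text \<open>
  The word read off from \<open>p\<close> onwards, on which the open arc depends, is the same for all starting
  points.
\<close>

lemma open_arc_rotate1:
  assumes "distinct w" "p \<in> set w"
  shows "open_arc (rotate1 w) p q = open_arc w p q"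
proof (cases w)
  case (Cons x u)
  show ?thesis
  proof (cases "p = x")
    case True
    then have "x \<notin> set u" using assms Cons by auto
    then have "dropWhile (\<lambda>e. e \<noteq> x) (u @ [x]) = [x]" "takeWhile (\<lambda>e. e \<noteq> x) (u @ [x]) = u"
      by (auto simp: dropWhile_append takeWhile_append)
    then show ?thesis by (simp add: Cons True open_arc_def)
  next
    case False
    then have "p \<in> set u" using assms Cons by auto
    then have dw: "dropWhile (\<lambda>e. e \<noteq> p) u \<noteq> []" by (auto simp: dropWhile_eq_Nil_conv)
    have "dropWhile (\<lambda>e. e \<noteq> p) (u @ [x]) @ takeWhile (\<lambda>e. e \<noteq> p) (u @ [x]) =
        dropWhile (\<lambda>e. e \<noteq> p) (x # u) @ takeWhile (\<lambda>e. e \<noteq> p) (x # u)"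
      using False \<open>p \<in> set u\<close> by (simp add: dropWhile_append1 takeWhile_append1)
    then show ?thesis using Cons by (simp only: open_arc_def rotate1.simps)
  qed
qed (use assms in simp)

lemma arc_sum_rotate:
  assumes "distinct w" "p \<in> set w"
  shows "arc_sum (rotate k w) p q = arc_sum w p q"
  by (induction k) (use assms in \<open>simp_all add: arc_sum_def open_arc_rotate1\<close>)

lemma filter_rotate: "\<exists>k'. filter P (rotate k w) = rotate k' (filter P w)"
proof -
  define a where "a = take (k mod length w) w"
  define b where "b = drop (k mod length w) w"
  have w: "w = a @ b" and r: "rotate k w = b @ a"
    by (simp_all add: a_def b_def rotate_drop_take)
  have "filter P (rotate k w) = rotate (length (filter P a)) (filter P w)"
    unfolding r unfolding w by (simp add: rotate_append)
  then show ?thesis by blast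
qed

lemma filter_pair_id: "x \<notin> set w \<Longrightarrow> y \<notin> set w \<Longrightarrow> filter (\<lambda>e. e \<notin> {x, y}) w = w"
  by (auto simp: filter_id_conv)

lemma filter_adjacent_pair:
  "distinct (a @ x # y # b) \<Longrightarrow> filter (\<lambda>e. e \<notin> {x, y}) (a @ x # y # b) = a @ b"
  using filter_pair_id[of x a y] filter_pair_id[of x b y] by simp

text \<open>
  The two deleted endpoints lie in a common prefix or both outside, and their signs cancel.
\<close>

lemma height_delete_pair:
  assumes d: "distinct w" and n: "next_to w x y" and s: "endpoint_sign x + endpoint_sign y = 0"
    and e: "e \<noteq> x" "e \<noteq> y"
  shows "height (filter (\<lambda>e. e \<notin> {x, y}) w) e = height w e"
proof -
  obtain a b where w: "w = a @ x # y # b" using n by (auto simp: next_to_iff)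
  show ?thesis
    using d s e unfolding w by (simp only: filter_adjacent_pair) (auto simp: height_append)
qed

lemma sign_sum_delete_pair:
  assumes d: "distinct w" and n: "next_to w x y \<or> x \<notin> set w \<and> y \<notin> set w"
    and s: "endpoint_sign x + endpoint_sign y = 0"
  shows "sign_sum (filter (\<lambda>e. e \<notin> {x, y}) w) = sign_sum w"
  using n
proof
  assume "next_to w x y"
  then obtain a b where w: "w = a @ x # y # b" by (auto simp: next_to_iff)
  show ?thesis using d s unfolding w by (simp only: filter_adjacent_pair) simp
next
  assume "x \<notin> set w \<and> y \<notin> set w"
  then have "filter (\<lambda>e. e \<notin> {x, y}) w = w" by (elim conjE) (rule filter_pair_id)
  then show ?thesis by (simp only:)
qed

section \<open>Weighted diagrams and their invariants\<close>

abbreviation sg :: "chord \<Rightarrow> int" where "sg \<equiv> chord_sign"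

lemma sg_cases: "sg c = 1 \<or> sg c = -1"
  by (simp add: chord_sign_def)

lemma sg_square [simp]: "sg c * sg c = 1"
  using sg_cases[of c] by auto

lemma sg_square_left [simp]: "sg c * (sg c * x) = x"
  by (simp flip: mult.assoc)

lemma sg_nonzero [simp]: "sg c \<noteq> 0"
  using sg_cases[of c] by auto

lemma endpoint_sign_cases: "endpoint_sign e = 1 \<or> endpoint_sign e = -1"
  by (cases e) (auto simp: chord_sign_def)

lemma gauss2E:
  assumes "gauss_diagram 2 D"
  obtains w1 w2 where "D = [w1, w2]" "distinct w1" "distinct w2" "set w1 \<inter> set w2 = {}"
    "\<And>c. Initial c \<in> set w1 \<union> set w2 \<longleftrightarrow> Terminal c \<in> set w1 \<union> set w2"
proof -
  have "length D = 2" using assms by (simp add: gauss_diagram_def)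
  then obtain w1 w2 where "D = [w1, w2]" by (auto simp: length_Suc_conv numeral_2_eq_2)
  then show thesis using assms that[of w1 w2] by (auto simp: gauss_diagram_def)
qed

lemma circle_simps [simp]: "circle [w1, w2] (Suc 0) = w1" "circle [w1, w2] 2 = w2"
  by (simp_all add: circle_def)

lemma finite_chords [simp]: "finite (chords D)"
  by (simp add: chords_def)

lemma chords_iff:
  assumes "gauss_diagram n D"
  shows "c \<in> chords D \<longleftrightarrow> Initial c \<in> set (concat D)"
    "c \<in> chords D \<longleftrightarrow> Terminal c \<in> set (concat D)"
proof -
  have "c \<in> chords D \<longleftrightarrow> Initial c \<in> set (concat D) \<or> Terminal c \<in> set (concat D)"
    unfolding chords_def image_iff by (metis endpoint.exhaust endpoint.sel)
  then show "c \<in> chords D \<longleftrightarrow> Initial c \<in> set (concat D)"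
    "c \<in> chords D \<longleftrightarrow> Terminal c \<in> set (concat D)"
    using assms unfolding gauss_diagram_def by blast+
qed

lemma chord_of_in_chords: "e \<in> set (concat D) \<Longrightarrow> chord_of e \<in> chords D"
  by (simp add: chords_def)

lemma in_concat_iff_chord:
  assumes "gauss_diagram n D"
  shows "e \<in> set (concat D) \<longleftrightarrow> chord_of e \<in> chords D"
  using chords_iff[OF assms] by (cases e) auto

lemma types_subset_chords:
  assumes "gauss_diagram 2 D" "i \<in> {1, 2}"
  shows "chords_of_type D i j \<subseteq> chords D"
proof -
  obtain w1 w2 where D: "D = [w1, w2]" using assms(1) by (rule gauss2E)
  show ?thesis
  proof
    fix c assume "c \<in> chords_of_type D i j"
    then have "Initial c \<in> set (concat D)" using assms(2) by (auto simp: chords_of_type_def D)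
    then show "c \<in> chords D" by (rule chords_iff(1)[OF assms(1), THEN iffD2])
  qed
qed

lemma finite_types [simp]: "gauss_diagram 2 D \<Longrightarrow> i \<in> {1, 2} \<Longrightarrow> finite (chords_of_type D i j)"
  by (rule finite_subset[OF types_subset_chords]) auto

text \<open>
  Each chord contributes its sign at its terminal endpoint and the opposite sign at its initial
  one, so that self-chords cancel.
\<close>

lemma sign_sum_conv_types:
  assumes v: "gauss_diagram 2 D" and i: "i \<in> {1, 2}"
  shows "sign_sum (circle D i) = Lk D 1 i + Lk D 2 i - Lk D i 1 - Lk D i 2"
proof -
  obtain w1 w2 where D: "D = [w1, w2]" and d: "distinct w1" "distinct w2"
    and dj: "set w1 \<inter> set w2 = {}"
    and c: "\<And>c. Initial c \<in> set w1 \<union> set w2 \<longleftrightarrow> Terminal c \<in> set w1 \<union> set w2"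
    using v by (rule gauss2E) blast
  define w where "w = circle D i"
  have dw: "distinct w" using i d by (auto simp: w_def D)
  define T where "T = {c. Terminal c \<in> set w}"
  define I where "I = {c. Initial c \<in> set w}"
  have TT: "T = chords_of_type D 1 i \<union> chords_of_type D 2 i"
  proof (rule set_eqI)
    fix x show "x \<in> T \<longleftrightarrow> x \<in> chords_of_type D 1 i \<union> chords_of_type D 2 i"
      using i c[of x] by (auto simp: T_def w_def chords_of_type_def D)
  qed
  have II: "I = chords_of_type D i 1 \<union> chords_of_type D i 2"
  proof (rule set_eqI)
    fix x show "x \<in> I \<longleftrightarrow> x \<in> chords_of_type D i 1 \<union> chords_of_type D i 2"
      using i c[of x] by (auto simp: I_def w_def chords_of_type_def D)
  qed
  have "set w = Terminal ` T \<union> Initial ` I"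
  proof (rule set_eqI)
    fix e show "e \<in> set w \<longleftrightarrow> e \<in> Terminal ` T \<union> Initial ` I"
      by (cases e) (auto simp: T_def I_def)
  qed
  moreover have fin: "finite T" "finite I" using v i by (auto simp: TT II)
  moreover have "sign_sum w = (\<Sum>e\<in>set w. endpoint_sign e)"
    unfolding sign_sum_def by (rule sum_list_distinct_conv_sum_set[OF dw])
  ultimately have "sign_sum w =
      (\<Sum>e\<in>Terminal ` T. endpoint_sign e) + (\<Sum>e\<in>Initial ` I. endpoint_sign e)"
    by (simp only:) (subst sum.union_disjoint, auto)
  also have "(\<Sum>e\<in>Terminal ` T. endpoint_sign e) = (\<Sum>c\<in>T. sg c)"
    by (subst sum.reindex) (auto simp: inj_on_def)
  also have "(\<Sum>e\<in>Initial ` I. endpoint_sign e) = - (\<Sum>c\<in>I. sg c)"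
    by (subst sum.reindex) (auto simp: inj_on_def sum_negf)
  also have "(\<Sum>c\<in>T. sg c) = Lk D 1 i + Lk D 2 i" unfolding TT Lk_def
  proof (rule sum.union_disjoint)
    show "chords_of_type D 1 i \<inter> chords_of_type D 2 i = {}"
      using i dj by (auto simp: chords_of_type_def D)
  qed (use v i in auto)
  also have "(\<Sum>c\<in>I. sg c) = Lk D i 1 + Lk D i 2" unfolding II Lk_def
  proof (rule sum.union_disjoint)
    show "chords_of_type D i 1 \<inter> chords_of_type D i 2 = {}"
      using i dj by (auto simp: chords_of_type_def D)
  qed (use v i in auto)
  finally show ?thesis by (simp add: w_def)
qed

lemma sign_sum_circle:
  assumes "gauss_diagram 2 D"
  shows "sign_sum (circle D 1) = - lambda_diagram D" "sign_sum (circle D 2) = lambda_diagram D"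
  using sign_sum_conv_types[OF assms, of 1] sign_sum_conv_types[OF assms, of 2]
  by (simp_all add: lambda_diagram_def)

text \<open>
  The index of a chord, corrected by its weight. Heights are taken in the concatenation of both
  words, so that one formula covers all types: for self-chords it gives \<open>Ind'\<close> up to the sum of
  signs on the circle, and for nonself-chords it gives the index relative to a fixed chord, up to
  multiples of \<open>\<lambda>\<close> and a shift that is common to all chords of the type.
\<close>

definition lifted_index :: "gauss \<Rightarrow> (chord \<Rightarrow> int) \<Rightarrow> chord \<Rightarrow> int" where
  "lifted_index D m c =
     height (concat D) (Terminal c) - height (concat D) (Initial c) + sg c - sg c * m c"

lemma Ind_self_eq:
  assumes v: "gauss_diagram 2 D" and i: "i \<in> {1, 2}" and c: "c \<in> chords_of_type D i i"
  shows "Ind_self D i c - sg c * m c = lifted_index D m c +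
    (if precedes (concat D) (Terminal c) (Initial c) then sign_sum (circle D i) else 0)"
proof -
  obtain w1 w2 where D: "D = [w1, w2]" and d: "distinct w1" "distinct w2"
    and dj: "set w1 \<inter> set w2 = {}" using v by (rule gauss2E)
  have mem: "Initial c \<in> set (circle D i)" "Terminal c \<in> set (circle D i)"
    using c by (auto simp: chords_of_type_def)
  have dw: "distinct (circle D i)" using i d by (auto simp: D)
  have "precedes (concat D) (Terminal c) (Initial c) \<longleftrightarrow>
      precedes (circle D i) (Terminal c) (Initial c)"
    using i mem dj by (auto simp: D precedes_append)
  moreover have "height (concat D) (Terminal c) - height (concat D) (Initial c) =
      height (circle D i) (Terminal c) - height (circle D i) (Initial c)"
    using i mem dj by (auto simp: D height_append)
  ultimately show ?thesis
    unfolding Ind_self_def lifted_index_def using arc_sum_eq[OF dw mem] by simp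
qed

text \<open>
  The writhes \<open>J\<^sub>n\<close> of the diagram in which the weights are realized by shells, except that the
  shells themselves are not counted.
\<close>

definition self_writhe :: "gauss \<Rightarrow> (chord \<Rightarrow> int) \<Rightarrow> nat \<Rightarrow> int \<Rightarrow> int" where
  "self_writhe D m i n = (\<Sum>c | c \<in> chords_of_type D i i \<and> Ind_self D i c - sg c * m c = n. sg c)"

text \<open>
  These are the coefficients of \<open>F\<^sub>i\<^sub>j\<close> in the quotient \<open>\<Lambda>\<^sub>\<lambda>\<close>, up to a shift.
\<close>

definition residue_writhe :: "gauss \<Rightarrow> (chord \<Rightarrow> int) \<Rightarrow> nat \<Rightarrow> nat \<Rightarrow> int \<Rightarrow> int" where
  "residue_writhe D m i j r =
     (\<Sum>c | c \<in> chords_of_type D i j \<and> lambda_diagram D dvd lifted_index D m c - r. sg c)"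

definition total_weight :: "gauss \<Rightarrow> (chord \<Rightarrow> int) \<Rightarrow> int" where
  "total_weight D m = (\<Sum>c\<in>chords D. m c)"

text \<open>
  The equivalence relation \<open>(f, g) \<sim> (t\<^sup>k f, t\<^sup>-\<^sup>k g)\<close> expressed by coefficients.
\<close>

definition shift_agree :: "gauss \<Rightarrow> (chord \<Rightarrow> int) \<Rightarrow> gauss \<Rightarrow> (chord \<Rightarrow> int) \<Rightarrow> bool" where
  "shift_agree D m D' m' \<longleftrightarrow> (\<exists>k. \<forall>r.
     residue_writhe D' m' 1 2 r = residue_writhe D m 1 2 (r - k) \<and>
     residue_writhe D' m' 2 1 r = residue_writhe D m 2 1 (r + k))"

text \<open>
  The excluded indices are those of an isolated self-chord, which R1 inserts freely. The total
  weight is constant under R-moves of weighted diagrams, but not when shells are absorbed.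
\<close>

definition R_agree :: "gauss \<Rightarrow> (chord \<Rightarrow> int) \<Rightarrow> gauss \<Rightarrow> (chord \<Rightarrow> int) \<Rightarrow> bool" where
  "R_agree D m D' m' \<longleftrightarrow> lambda_diagram D' = lambda_diagram D \<and>
     (2 \<le> lambda_diagram D \<longrightarrow>
       (\<forall>n. n \<notin> {0, - lambda_diagram D} \<longrightarrow> self_writhe D' m' 1 n = self_writhe D m 1 n) \<and>
       (\<forall>n. n \<notin> {0, lambda_diagram D} \<longrightarrow> self_writhe D' m' 2 n = self_writhe D m 2 n) \<and>
       total_weight D' m' = total_weight D m \<and> shift_agree D m D' m')"

text \<open>
  Weights count shells implicitly, while explicit shells are self-chords of one of the four listed
  indices. Their sum does not depend on which shells have been absorbed into weights.
\<close>

definition shell_count :: "gauss \<Rightarrow> (chord \<Rightarrow> int) \<Rightarrow> int" where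
  "shell_count D m = total_weight D m +
     self_writhe D m 1 1 + self_writhe D m 1 (- lambda_diagram D + 1) +
     self_writhe D m 2 1 + self_writhe D m 2 (lambda_diagram D + 1)"

definition S_agree :: "gauss \<Rightarrow> (chord \<Rightarrow> int) \<Rightarrow> gauss \<Rightarrow> (chord \<Rightarrow> int) \<Rightarrow> bool" where
  "S_agree D m D' m' \<longleftrightarrow> lambda_diagram D' = lambda_diagram D \<and>
     (2 \<le> lambda_diagram D \<longrightarrow>
       (\<forall>n. n \<notin> {0, 1, - lambda_diagram D, - lambda_diagram D + 1} \<longrightarrow>
          self_writhe D' m' 1 n = self_writhe D m 1 n) \<and>
       (\<forall>n. n \<notin> {0, 1, lambda_diagram D, lambda_diagram D + 1} \<longrightarrow>
          self_writhe D' m' 2 n = self_writhe D m 2 n) \<and>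
       shell_count D' m' = shell_count D m \<and> shift_agree D m D' m')"

lemma shift_agree_refl: "shift_agree D m D m"
  unfolding shift_agree_def by (rule exI[of _ 0]) simp

lemma shift_agree_sym:
  assumes "shift_agree D m D' m'"
  shows "shift_agree D' m' D m"
proof -
  obtain k where "\<And>r. residue_writhe D' m' 1 2 r = residue_writhe D m 1 2 (r - k) \<and>
     residue_writhe D' m' 2 1 r = residue_writhe D m 2 1 (r + k)"
    using assms unfolding shift_agree_def by blast
  then show ?thesis unfolding shift_agree_def by (intro exI[of _ "- k"]) simp
qed

lemma shift_agree_trans:
  assumes "shift_agree D m D' m'" "shift_agree D' m' D'' m''"
  shows "shift_agree D m D'' m''"
proof -
  obtain k k' where "\<And>r. residue_writhe D' m' 1 2 r = residue_writhe D m 1 2 (r - k) \<and>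
     residue_writhe D' m' 2 1 r = residue_writhe D m 2 1 (r + k)"
    "\<And>r. residue_writhe D'' m'' 1 2 r = residue_writhe D' m' 1 2 (r - k') \<and>
     residue_writhe D'' m'' 2 1 r = residue_writhe D' m' 2 1 (r + k')"
    using assms unfolding shift_agree_def by blast
  then show ?thesis
    unfolding shift_agree_def by (intro exI[of _ "k + k'"]) (simp add: algebra_simps)
qed

lemma R_agree_refl: "R_agree D m D m"
  by (simp add: R_agree_def shift_agree_refl)

lemma R_agree_sym: "R_agree D m D' m' \<Longrightarrow> R_agree D' m' D m"
  by (auto simp: R_agree_def shift_agree_sym)

lemma R_agree_trans [trans]:
  "R_agree D m D' m' \<Longrightarrow> R_agree D' m' D'' m'' \<Longrightarrow> R_agree D m D'' m''"
  by (auto simp: R_agree_def intro: shift_agree_trans)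

lemma S_agree_refl: "S_agree D m D m"
  by (simp add: S_agree_def shift_agree_refl)

lemma S_agree_sym: "S_agree D m D' m' \<Longrightarrow> S_agree D' m' D m"
  by (auto simp: S_agree_def shift_agree_sym)

lemma S_agree_trans [trans]:
  "S_agree D m D' m' \<Longrightarrow> S_agree D' m' D'' m'' \<Longrightarrow> S_agree D m D'' m''"
  by (auto simp: S_agree_def intro: shift_agree_trans)

lemma R_agree_imp_S_agree: "R_agree D m D' m' \<Longrightarrow> S_agree D m D' m'"
  by (auto simp: R_agree_def S_agree_def shell_count_def)

text \<open>
  Rotations, exchanges and renamings transport chords bijectively and preserve their corrected
  indices; for nonself-chords only up to a shift and multiples of \<open>\<lambda>\<close>.
\<close>

lemma R_agree_iso:
  assumes v: "gauss_diagram 2 D" and v': "gauss_diagram 2 D'"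
    and types: "\<And>i j. i \<in> {1, 2} \<Longrightarrow> j \<in> {1, 2} \<Longrightarrow>
      chords_of_type D' i j = f ` chords_of_type D i j"
    and inj: "inj_on f (chords D)" and sgn: "\<And>c. c \<in> chords D \<Longrightarrow> sg (f c) = sg c"
    and self: "\<And>i c. i \<in> {1, 2} \<Longrightarrow> c \<in> chords_of_type D i i \<Longrightarrow>
      Ind_self D' i (f c) - sg c * m' (f c) = Ind_self D i c - sg c * m c"
    and nonself: "\<And>c. c \<in> chords_of_type D 1 2 \<Longrightarrow>
      lambda_diagram D dvd lifted_index D' m' (f c) - lifted_index D m c - k"
      "\<And>c. c \<in> chords_of_type D 2 1 \<Longrightarrow>
      lambda_diagram D dvd lifted_index D' m' (f c) - lifted_index D m c + k"
    and wt: "total_weight D' m' = total_weight D m"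
  shows "R_agree D m D' m'"
proof -
  have sub: "i \<in> {1, 2} \<Longrightarrow> chords_of_type D i j \<subseteq> chords D" for i j
    by (rule types_subset_chords[OF v])
  have re: "(\<Sum>c\<in>f ` A. sg c) = (\<Sum>c\<in>A. sg c)" if "A \<subseteq> chords D" for A
    using inj_on_subset[OF inj that] sgn that by (subst sum.reindex) (auto intro!: sum.cong)
  have Lk: "Lk D' i j = Lk D i j" if "i \<in> {1, 2}" "j \<in> {1, 2}" for i j
    unfolding Lk_def types[OF that] by (rule re[OF sub[OF that(1)]])
  then have lam: "lambda_diagram D' = lambda_diagram D"
    by (simp add: lambda_diagram_def)
  have J: "self_writhe D' m' i n = self_writhe D m i n" if i: "i \<in> {1, 2}" for i n
  proof -
    have "{c \<in> chords_of_type D' i i. Ind_self D' i c - sg c * m' c = n} =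
        f ` {c \<in> chords_of_type D i i. Ind_self D i c - sg c * m c = n}"
      using self[OF i] sub[OF i] sgn unfolding types[OF i i] by (auto simp: image_iff subset_iff) 
    then show ?thesis unfolding self_writhe_def
      using re[of "{c \<in> chords_of_type D i i. Ind_self D i c - sg c * m c = n}"] sub[OF i] by auto
  qed
  have A: "residue_writhe D' m' i j r = residue_writhe D m i j (r - K)"
    if i: "i \<in> {1, 2}" and j: "j \<in> {1, 2}" and h: "\<And>c. c \<in> chords_of_type D i j \<Longrightarrow>
      lambda_diagram D dvd lifted_index D' m' (f c) - lifted_index D m c - K" for i j r K
  proof -
    have "lambda_diagram D dvd lifted_index D' m' (f c) - r \<longleftrightarrow>
        lambda_diagram D dvd lifted_index D m c - (r - K)" if "c \<in> chords_of_type D i j" for c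
    proof -
      have "lifted_index D' m' (f c) - r = (lifted_index D' m' (f c) - lifted_index D m c - K) +
          (lifted_index D m c - (r - K))" by simp
      then show ?thesis using h[OF that] by (metis dvd_add_right_iff)
    qed
    then have "{c \<in> chords_of_type D' i j. lambda_diagram D' dvd lifted_index D' m' c - r} =
        f ` {c \<in> chords_of_type D i j. lambda_diagram D dvd lifted_index D m c - (r - K)}"
      unfolding types[OF i j] lam by auto
    then show ?thesis unfolding residue_writhe_def using sub[OF i]
      re[of "{c \<in> chords_of_type D i j. lambda_diagram D dvd lifted_index D m c - (r - K)}"]
      by auto
  qed
  have "shift_agree D m D' m'"
    unfolding shift_agree_def
    using A[of 1 2 k] A[of 2 1 "-k"] nonself by (intro exI[of _ k]) simp
  then show ?thesis unfolding R_agree_def using lam J wt by simp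
qed

definition delete_chords :: "chord set \<Rightarrow> gauss \<Rightarrow> gauss" where
  "delete_chords X D = map (filter (\<lambda>e. chord_of e \<notin> X)) D"

lemma delete_chord_eq: "delete_chord c D = delete_chords {c} D"
  by (simp add: delete_chord_def delete_chords_def)

lemma delete_chords_delete_chords: "delete_chords X (delete_chords Y D) = delete_chords (X \<union> Y) D"
  by (simp add: delete_chords_def conj_commute)

lemma concat_delete_chords: "concat (delete_chords X D) = filter (\<lambda>e. chord_of e \<notin> X) (concat D)"
  by (simp add: delete_chords_def filter_concat)

lemma gauss_diagram_delete_chords: "gauss_diagram n D \<Longrightarrow> gauss_diagram n (delete_chords X D)"
  unfolding gauss_diagram_def concat_delete_chords by (auto simp: delete_chords_def)

lemma chords_delete_chords: "chords (delete_chords X D) = chords D - X"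
  unfolding chords_def concat_delete_chords by auto

lemma circle_delete_chords:
  assumes "gauss_diagram 2 D" "i \<in> {1, 2}"
  shows "circle (delete_chords X D) i = filter (\<lambda>e. chord_of e \<notin> X) (circle D i)"
proof -
  obtain w1 w2 where D: "D = [w1, w2]" using assms(1) by (rule gauss2E)
  show ?thesis using assms(2) by (auto simp: D delete_chords_def)
qed

lemma types_delete_chords:
  assumes "gauss_diagram 2 D" "i \<in> {1, 2}" "j \<in> {1, 2}"
  shows "chords_of_type (delete_chords X D) i j = chords_of_type D i j - X"
  using assms by (auto simp: chords_of_type_def circle_delete_chords)

text \<open>
  Deleting chords whose endpoints do not influence the heights of the other endpoints leaves all
  other indices unchanged, so each invariant changes by the contribution of the deleted chords.
\<close>

lemma agree_delete_chords:
  assumes v: "gauss_diagram 2 D"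
    and tot: "sign_sum (circle (delete_chords X D) 2) = sign_sum (circle D 2)"
    and ht: "\<forall>e. chord_of e \<notin> X \<longrightarrow> height (concat (delete_chords X D)) e = height (concat D) e"
  shows "lambda_diagram (delete_chords X D) = lambda_diagram D"
    "i \<in> {1, 2} \<Longrightarrow> self_writhe D m i n = self_writhe (delete_chords X D) m i n +
       (\<Sum>c | c \<in> chords_of_type D i i \<and> c \<in> X \<and> Ind_self D i c - sg c * m c = n. sg c)"
    "i \<in> {1, 2} \<Longrightarrow> j \<in> {1, 2} \<Longrightarrow> 
       residue_writhe D m i j n = residue_writhe (delete_chords X D) m i j n +
       (\<Sum>c | c \<in> chords_of_type D i j \<and> c \<in> X \<and> lambda_diagram D dvd lifted_index D m c - n. sg c)"
    "total_weight D m = total_weight (delete_chords X D) m + (\<Sum>c | c \<in> chords D \<and> c \<in> X. m c)"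
proof -
  have v': "gauss_diagram 2 (delete_chords X D)" by (rule gauss_diagram_delete_chords[OF v])
  show lam: "lambda_diagram (delete_chords X D) = lambda_diagram D"
    using tot sign_sum_circle(2)[OF v] sign_sum_circle(2)[OF v'] by simp
  have tot': "sign_sum (circle (delete_chords X D) i) = sign_sum (circle D i)" if "i \<in> {1, 2}" for i
    using that lam sign_sum_circle[OF v] sign_sum_circle[OF v'] by auto
  have li: "lifted_index (delete_chords X D) m c = lifted_index D m c" if "c \<in> chords D" "c \<notin> X" for c
    using spec[OF ht, of "Initial c"] spec[OF ht, of "Terminal c"] that chords_iff[OF v, of c]
    by (simp add: lifted_index_def)
  have ind: "Ind_self (delete_chords X D) i c = Ind_self D i c"
    if "i \<in> {1, 2}" "c \<in> chords_of_type D i i" "c \<notin> X" for i c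
  proof -
    have "c \<in> chords D" using that types_subset_chords[OF v that(1)] by auto
    moreover have "precedes (concat (delete_chords X D)) (Terminal c) (Initial c) \<longleftrightarrow>
        precedes (concat D) (Terminal c) (Initial c)"
      unfolding concat_delete_chords using that by (intro precedes_filter) auto
    moreover have "c \<in> chords_of_type (delete_chords X D) i i" using that types_delete_chords[OF v] by auto
    ultimately have "Ind_self (delete_chords X D) i c - sg c * m c = Ind_self D i c - sg c * m c"
      using that(3) tot'[OF that(1)]
      by (simp add: Ind_self_eq[OF v that(1,2), of m] Ind_self_eq[OF v' that(1), of c m] li)
    then show ?thesis by simp
  qed
  have spl: "(\<Sum>c | c \<in> A \<and> P c. g c) =
      (\<Sum>c | c \<in> A - X \<and> P c. g c) + (\<Sum>c | c \<in> A \<and> c \<in> X \<and> P c. g c)"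
    if "finite A" for A :: "chord set" and P and g :: "chord \<Rightarrow> int"
  proof -
    have "{c. c \<in> A \<and> P c} = {c. c \<in> A - X \<and> P c} \<union> {c. c \<in> A \<and> c \<in> X \<and> P c}" by auto
    then show ?thesis using that by (simp only:) (subst sum.union_disjoint, auto)
  qed
  show "self_writhe D m i n = self_writhe (delete_chords X D) m i n +
       (\<Sum>c | c \<in> chords_of_type D i i \<and> c \<in> X \<and> Ind_self D i c - sg c * m c = n. sg c)"
    if i: "i \<in> {1, 2}"
  proof -
    have "self_writhe (delete_chords X D) m i n =
        (\<Sum>c | c \<in> chords_of_type D i i - X \<and> Ind_self D i c - sg c * m c = n. sg c)"
      unfolding self_writhe_def types_delete_chords[OF v i i] by (rule sum.cong) (auto simp: ind[OF i])
    then show ?thesis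
      unfolding self_writhe_def[of D] by (simp only: spl[OF finite_types[OF v i], symmetric])
  qed
  show "residue_writhe D m i j n = residue_writhe (delete_chords X D) m i j n +
       (\<Sum>c | c \<in> chords_of_type D i j \<and> c \<in> X \<and> lambda_diagram D dvd lifted_index D m c - n. sg c)"
    if i: "i \<in> {1, 2}" and j: "j \<in> {1, 2}"
  proof -
    have li': "lifted_index (delete_chords X D) m c = lifted_index D m c"
      if "c \<in> chords_of_type D i j" "c \<notin> X" for c
      using li[of c] that types_subset_chords[OF v i] by blast
    have "residue_writhe (delete_chords X D) m i j n =
        (\<Sum>c | c \<in> chords_of_type D i j - X \<and> lambda_diagram D dvd lifted_index D m c - n. sg c)"
      unfolding residue_writhe_def types_delete_chords[OF v i j] lam
      by (rule sum.cong) (auto simp: li')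
    then show ?thesis
      unfolding residue_writhe_def[of D] by (simp only: spl[OF finite_types[OF v i], symmetric])
  qed
  show "total_weight D m = total_weight (delete_chords X D) m + (\<Sum>c | c \<in> chords D \<and> c \<in> X. m c)"
    unfolding total_weight_def chords_delete_chords
    using spl[OF finite_chords, where P = "\<lambda>_. True" and g = m] by (simp add: set_diff_eq)
qed

section \<open>Exchanges and rotations\<close>

definition next_in :: "gauss \<Rightarrow> chord endpoint \<Rightarrow> chord endpoint \<Rightarrow> bool" where
  "next_in D p q \<longleftrightarrow> (\<exists>w\<in>set D. next_to w p q)"

lemma next_in_concat: "next_in D p q \<Longrightarrow> next_to (concat D) p q"
  unfolding next_in_def by (induction D) (auto simp: next_to_append)

lemma next_in_in_concat: "next_in D p q \<Longrightarrow> p \<in> set (concat D) \<and> q \<in> set (concat D)"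
  by (rule next_to_in_set[OF next_in_concat])

definition swapped :: "chord endpoint \<Rightarrow> chord endpoint \<Rightarrow> gauss \<Rightarrow> gauss" where
  "swapped p q D = map (map (transpose p q)) D"

lemma concat_swapped: "concat (swapped p q D) = map (transpose p q) (concat D)"
  by (simp add: swapped_def map_concat)

lemma set_map_transpose: "(p \<in> set w \<longleftrightarrow> q \<in> set w) \<Longrightarrow> set (map (transpose p q) w) = set w"
  by (simp add: transpose_image_eq)

lemma map_transpose_id: "p \<notin> set w \<Longrightarrow> q \<notin> set w \<Longrightarrow> map (transpose p q) w = w"
  by (rule map_idI) (metis transpose_apply_other)

lemma map_transpose_adjacent:
  "distinct (a @ p # q # b) \<Longrightarrow> map (transpose p q) (a @ p # q # b) = a @ q # p # b"
  by (simp add: map_transpose_id)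

lemma distinct_concat_gauss: "gauss_diagram n D \<Longrightarrow> distinct (concat D)"
  by (simp add: gauss_diagram_def)

lemma gauss_diagram_swapped:
  assumes "gauss_diagram n D" "p \<in> set (concat D)" "q \<in> set (concat D)"
  shows "gauss_diagram n (swapped p q D)"
proof -
  have "set (concat (swapped p q D)) = set (concat D)"
    unfolding concat_swapped using assms by (intro set_map_transpose) simp
  moreover have "distinct (concat (swapped p q D))"
    using assms(1) unfolding concat_swapped gauss_diagram_def by (simp add: distinct_map)
  ultimately show ?thesis using assms(1) by (simp add: gauss_diagram_def) (simp add: swapped_def)
qed

lemma height_swap:
  assumes "distinct (A @ p # q # B)"
  shows "height (A @ q # p # B) e = height (A @ p # q # B) e +
    (if e = p then endpoint_sign q else if e = q then - endpoint_sign p else 0)"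
  using assms by (auto simp: height_append)

lemma precedes_swap:
  assumes "distinct (A @ p # q # B)" "{x, y} \<noteq> {p, q}"
  shows "precedes (A @ q # p # B) x y \<longleftrightarrow> precedes (A @ p # q # B) x y"
  using assms by (auto simp: precedes_append)

text \<open>
  The shells that S2 creates at the exchanged endpoints, as weights.
\<close>

definition swap_weight :: "chord endpoint \<Rightarrow> chord endpoint \<Rightarrow> (chord \<Rightarrow> int) \<Rightarrow> chord \<Rightarrow> int" where
  "swap_weight p q m = (let s = endpoint_sign p * endpoint_sign q in
     m(chord_of p := m (chord_of p) + s, chord_of q := m (chord_of q) - s))"

lemma types_swapped:
  assumes v: "gauss_diagram 2 D" and l: "next_in D p q" and i: "i \<in> {1, 2}" and j: "j \<in> {1, 2}"
  shows "chords_of_type (swapped p q D) i j = chords_of_type D i j"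
proof -
  obtain w1 w2 where D: "D = [w1, w2]" "set w1 \<inter> set w2 = {}" using v by (rule gauss2E)
  have *: "(p \<in> set w1 \<longleftrightarrow> q \<in> set w1) \<and> (p \<in> set w2 \<longleftrightarrow> q \<in> set w2)"
    using l D by (auto simp: next_in_def dest: next_to_in_set)
  have "set (circle (swapped p q D) i) = set (circle D i)" if "i \<in> {1, 2}" for i
    using that * by (auto simp: D swapped_def transpose_image_eq)
  then show ?thesis using i j by (simp add: chords_of_type_def)
qed

text \<open>
  Exchanging \<open>p\<close> and \<open>q\<close> raises the height of \<open>p\<close> by the sign of \<open>q\<close> and lowers the height of \<open>q\<close>
  by the sign of \<open>p\<close>; the new weights cancel this effect.
\<close>

lemma lifted_index_swapped:
  assumes v: "gauss_diagram 2 D" and l: "next_in D p q" and pq: "chord_of p \<noteq> chord_of q"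
  shows "lifted_index (swapped p q D) (swap_weight p q m) c = lifted_index D m c"
    "precedes (concat (swapped p q D)) (Terminal c) (Initial c) =
     precedes (concat D) (Terminal c) (Initial c)"
proof -
  obtain A B where W: "concat D = A @ p # q # B" using next_in_concat[OF l] by (auto simp: next_to_iff)
  have d: "distinct (A @ p # q # B)" using distinct_concat_gauss[OF v] W by simp
  have W': "concat (swapped p q D) = A @ q # p # B"
    unfolding concat_swapped W by (rule map_transpose_adjacent[OF d])
  show "lifted_index (swapped p q D) (swap_weight p q m) c = lifted_index D m c"
    unfolding lifted_index_def W W' height_swap[OF d] swap_weight_def Let_def using pq
    by (cases p; cases q) (auto simp: algebra_simps)
  show "precedes (concat (swapped p q D)) (Terminal c) (Initial c) =
     precedes (concat D) (Terminal c) (Initial c)"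
    unfolding W W' using pq by (intro precedes_swap[OF d]) (auto simp: doubleton_eq_iff)
qed

lemma R_agree_swapped:
  assumes v: "gauss_diagram 2 D" and l: "next_in D p q" and pq: "chord_of p \<noteq> chord_of q"
  shows "R_agree D m (swapped p q D) (swap_weight p q m)"
proof -
  let ?D = "swapped p q D" and ?m = "swap_weight p q m"
  have mem: "p \<in> set (concat D)" "q \<in> set (concat D)" using next_in_in_concat[OF l] by auto
  have v': "gauss_diagram 2 ?D" using gauss_diagram_swapped[OF v mem] .
  note ty = types_swapped[OF v l]
  note li = lifted_index_swapped[OF v l pq]
  have lam: "lambda_diagram ?D = lambda_diagram D"
    by (simp add: lambda_diagram_def Lk_def ty)
  have tot: "sign_sum (circle ?D i) = sign_sum (circle D i)" if "i \<in> {1, 2}" for i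
    using that lam sign_sum_circle[OF v] sign_sum_circle[OF v'] by auto
  have ch: "chords ?D = chords D"
    using mem unfolding chords_def concat_swapped by (subst set_map_transpose) auto
  have cc: "chord_of p \<in> chords D" "chord_of q \<in> chords D" using mem chord_of_in_chords by blast+
  have wt: "total_weight ?D ?m = total_weight D m"
  proof -
    have "(\<Sum>c\<in>chords D. ?m c) = (\<Sum>c\<in>chords D. m c +
        (if c = chord_of p then endpoint_sign p * endpoint_sign q else 0) -
        (if c = chord_of q then endpoint_sign p * endpoint_sign q else 0))"
      using pq by (intro sum.cong) (auto simp: swap_weight_def Let_def)
    then show ?thesis using cc
      by (simp add: total_weight_def ch sum.distrib sum_subtractf)
  qed
  show ?thesis
  proof (rule R_agree_iso[where f = id and k = 0])
    fix i c assume i: "i \<in> {1, 2}" and c: "c \<in> chords_of_type D i i"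
    have c': "c \<in> chords_of_type ?D i i" using c by (simp only: ty[OF i i])
    show "Ind_self ?D i (id c) - sg c * ?m (id c) = Ind_self D i c - sg c * m c"
      unfolding id_apply Ind_self_eq[OF v i c] Ind_self_eq[OF v' i c'] li tot[OF i] ..
  qed (use v v' ty wt li in auto)
qed

definition rotated :: "gauss \<Rightarrow> gauss \<Rightarrow> bool" where
  "rotated D D' \<longleftrightarrow> list_all2 (\<lambda>w w'. \<exists>k. w' = rotate k w) D D'"

lemma rotated_two: "rotated [w1, w2] D' \<longleftrightarrow> (\<exists>k l. D' = [rotate k w1, rotate l w2])"
  by (auto simp: rotated_def list_all2_Cons1)

lemma rotated_twoI:
  "rotated [w1, w2] [rotate k w1, rotate l w2]" "rotated [w1, w2] [rotate k w1, w2]"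
  "rotated [w1, w2] [w1, rotate l w2]" "rotated [w1, w2] [rotate1 w1, w2]" "rotated [w1, w2] [w1, rotate1 w2]"
proof -
  show *: "rotated [w1, w2] [rotate k w1, rotate l w2]" for k l by (auto simp: rotated_two)
  show "rotated [w1, w2] [rotate k w1, w2]" "rotated [w1, w2] [w1, rotate l w2]"
    "rotated [w1, w2] [rotate1 w1, w2]" "rotated [w1, w2] [w1, rotate1 w2]"
    using *[of k 0] *[of 0 l] *[of 1 0] *[of 0 1] by simp_all
qed

lemma rotate_inverse: "\<exists>l. rotate l (rotate k w) = w"
proof -
  have "rotate (length w * k - k) (rotate k w) = w" if "w \<noteq> []"
  proof -
    have "length w * k - k + k = length w * k" using that by (cases "length w") auto
    then show ?thesis by (simp add: rotate_rotate rotate_conv_mod[of "length w * k"])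
  qed
  then show ?thesis by (cases "w = []") auto
qed

lemma rotated_sym: "rotated D D' \<Longrightarrow> rotated D' D"
  unfolding rotated_def
  by (induction rule: list_all2_induct) (use rotate_inverse in \<open>auto, metis\<close>)

lemma rotated_set: "rotated D D' \<Longrightarrow> set (concat D') = set (concat D)"
  unfolding rotated_def by (induction rule: list_all2_induct) auto

lemma rotated_gauss_diagram:
  assumes "rotated D D'" "gauss_diagram n D"
  shows "gauss_diagram n D'"
proof -
  have "(distinct (concat D') \<longleftrightarrow> distinct (concat D)) \<and> length D' = length D"
    using assms(1) unfolding rotated_def
  proof (induction rule: list_all2_induct)
    case (Cons w ws w' ws')
    have "set (concat ws') = set (concat ws)" using Cons.hyps rotated_set unfolding rotated_def by blast
    then show ?case using Cons by (auto simp del: set_concat)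
  qed simp
  then show ?thesis using assms(2) rotated_set[OF assms(1)] by (simp add: gauss_diagram_def)
qed

lemma rotated_delete_chords: "rotated D D' \<Longrightarrow> rotated (delete_chords X D) (delete_chords X D')"
  unfolding rotated_def delete_chords_def
  by (induction rule: list_all2_induct) (use filter_rotate in auto)

lemma rotated_swapped: "rotated D D' \<Longrightarrow> rotated (swapped p q D) (swapped p q D')"
  unfolding rotated_def swapped_def
  by (induction rule: list_all2_induct) (auto simp: rotate_map)

lemma followed_by_rotated: "rotated D D' \<Longrightarrow> followed_by D p q \<Longrightarrow> followed_by D' p q"
proof -
  assume "rotated D D'" "followed_by D p q"
  then obtain w k u where w: "w \<in> set D" "rotate k w = p # q # u" by (auto simp: followed_by_def)
  have "\<exists>w'\<in>set D'. \<exists>l. w' = rotate l w"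
    using \<open>rotated D D'\<close> w(1) unfolding rotated_def by (induction rule: list_all2_induct) auto
  then obtain w' l where "w' \<in> set D'" "w' = rotate l w" by blast
  moreover obtain l' where "rotate l' (rotate l w) = w" using rotate_inverse by blast
  ultimately have "rotate (k + l') w' = p # q # u" using w(2) by (simp flip: rotate_rotate)
  then show "followed_by D' p q" using \<open>w' \<in> set D'\<close> by (auto simp: followed_by_def)
qed

lemma next_in_followed_by: "next_in D p q \<Longrightarrow> followed_by D p q"
  unfolding next_in_def followed_by_def by (metis next_to_iff append_Cons rotate_append)

lemma followed_by_swapped:
  "followed_by D r s \<Longrightarrow> followed_by (swapped p q D) (transpose p q r) (transpose p q s)"
proof -
  assume "followed_by D r s"
  then obtain w k u where w: "w \<in> set D" "rotate k w = r # s # u" by (auto simp: followed_by_def)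
  then have "rotate k (map (transpose p q) w) =
      transpose p q r # transpose p q s # map (transpose p q) u" by (simp add: rotate_map)
  then show ?thesis using w(1) by (auto simp: followed_by_def swapped_def)
qed

lemma followed_by_in_concat: "followed_by D p q \<Longrightarrow> p \<in> set (concat D) \<and> q \<in> set (concat D)"
proof -
  assume "followed_by D p q"
  then obtain w k u where w: "w \<in> set D" "rotate k w = p # q # u" by (auto simp: followed_by_def)
  then have "{p, q} \<subseteq> set w" by (metis set_rotate insert_subset list.set_intros empty_subsetI)
  then show ?thesis using w(1) by auto
qed

lemma followed_by_linear:
  assumes "gauss_diagram 2 D" "followed_by D p q"
  shows "\<exists>D'. rotated D D' \<and> next_in D' p q"
proof -
  obtain w1 w2 where D: "D = [w1, w2]" using assms(1) by (rule gauss2E)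
  have *: "next_to (p # q # u) p q" for u by simp
  obtain k u where "rotate k w1 = p # q # u \<or> rotate k w2 = p # q # u"
    using assms(2) by (auto simp: followed_by_def D)
  then show ?thesis
  proof
    assume "rotate k w1 = p # q # u"
    then have "next_in [rotate k w1, w2] p q" using * by (simp add: next_in_def)
    then show ?thesis unfolding D using rotated_twoI(2) by blast
  next
    assume "rotate k w2 = p # q # u"
    then have "next_in [w1, rotate k w2] p q" using * by (simp add: next_in_def)
    then show ?thesis unfolding D using rotated_twoI(3) by blast
  qed
qed

text \<open>
  Rotate the circle such that \<open>p\<close> comes first. A second adjacent pair on the same circle then cannot
  wrap around, since its second endpoint would have to be \<open>p\<close>.
\<close>

lemma followed_by_linear2:
  assumes v: "gauss_diagram 2 D" and pq: "followed_by D p q" and sf: "followed_by D r s"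
    and ne: "p \<noteq> s" "{p, q} \<inter> {r, s} = {}"
  shows "\<exists>D'. rotated D D' \<and> next_in D' p q \<and> next_in D' r s"
proof -
  obtain w1 w2 where D: "D = [w1, w2]" and dj: "set w1 \<inter> set w2 = {}" using v by (rule gauss2E)
  have nt: "next_to (p # q # u) p q" for p q :: "chord endpoint" and u by simp
  have same: "next_to (p # q # u) r s" if "rotate k w = p # q # u" "rotate l w = r # s # v" for w k l u v
  proof -
    obtain l' where "rotate l' (rotate k w) = w" using rotate_inverse by blast
    then have "rotate (l + l') (p # q # u) = r # s # v" using that by (simp flip: rotate_rotate)
    then have "next_to (rotate (l + l') (p # q # u)) r s" by simp
    from next_to_rotate[OF this] show ?thesis using ne by auto
  qed
  obtain k u where 1: "rotate k w1 = p # q # u \<or> rotate k w2 = p # q # u"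
    using pq by (auto simp: followed_by_def D)
  obtain l v where 2: "rotate l w1 = r # s # v \<or> rotate l w2 = r # s # v"
    using sf by (auto simp: followed_by_def D)
  have R: ?thesis if "next_to (rotate k w1) p q \<or> next_to (rotate l w2) p q"
    "next_to (rotate k w1) r s \<or> next_to (rotate l w2) r s" for k l
    unfolding D next_in_def using that rotated_twoI(1)[of w1 w2 k l]
    by (intro exI[of _ "[rotate k w1, rotate l w2]"]) auto
  from 1 2 show ?thesis
  proof (elim disjE)
    assume "rotate k w1 = p # q # u" "rotate l w1 = r # s # v"
    then show ?thesis using same[of k w1 u l v] nt[of p q u] R[of k 0] by metis
  next
    assume "rotate k w2 = p # q # u" "rotate l w2 = r # s # v"
    then show ?thesis using same[of k w2 u l v] nt[of p q u] R[of 0 k] by metis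
  next
    assume "rotate k w1 = p # q # u" "rotate l w2 = r # s # v"
    then show ?thesis using nt[of p q u] nt[of r s v] R[of k l] by metis
  next
    assume "rotate k w2 = p # q # u" "rotate l w1 = r # s # v"
    then show ?thesis using nt[of p q u] nt[of r s v] R[of l k] by metis
  qed
qed

lemma total_weight_chords: "chords D' = chords D \<Longrightarrow> total_weight D' m = total_weight D m"
  by (simp add: total_weight_def)

text \<open>
  Moving the first endpoint of a word to the end lowers all other heights on the circle by its
  sign.
\<close>

lemma rotate1_index:
  assumes v: "gauss_diagram 2 D" and D: "D = [w1, w2]"
    and D': "D' = [rotate1 w1, w2] \<and> w = w1 \<or> D' = [w1, rotate1 w2] \<and> w = w2"
    and w: "w = x # u"
  shows "gauss_diagram 2 D'" "chords D' = chords D" "chords_of_type D' a b = chords_of_type D a b"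
    "e \<in> set (concat D) \<Longrightarrow> height (concat D') e = height (concat D) e -
      (if e \<in> set w then endpoint_sign x - (if e = x then sign_sum w else 0) else 0)"
proof -
  have "rotated D D'" using D' rotated_twoI unfolding D by auto
  then show "gauss_diagram 2 D'" using rotated_gauss_diagram v by blast
  show "chords D' = chords D" using rotated_set[OF \<open>rotated D D'\<close>] by (simp add: chords_def)
  have "set (D' ! k) = set (D ! k)" for k
    using D' by (auto simp: D nth_Cons split: nat.splits)
  then show "chords_of_type D' a b = chords_of_type D a b"
    by (simp add: chords_of_type_def circle_def)
  have d: "distinct w1" "distinct w2" "set w1 \<inter> set w2 = {}"
    using v unfolding D by (auto simp: gauss_diagram_def)
  show "e \<in> set (concat D) \<Longrightarrow> height (concat D') e = height (concat D) e -
      (if e \<in> set w then endpoint_sign x - (if e = x then sign_sum w else 0) else 0)"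
    using D' d w by (auto simp: D height_append)
qed

lemma lifted_index_rotate1:
  assumes v: "gauss_diagram 2 D" and D: "D = [w1, w2]"
    and D': "D' = [rotate1 w1, w2] \<and> w = w1 \<or> D' = [w1, rotate1 w2] \<and> w = w2"
    and w: "w = x # u" and c: "c \<in> chords D"
  shows "lifted_index D' m c = lifted_index D m c +
      (if Initial c \<in> set w then endpoint_sign x - (if Initial c = x then sign_sum w else 0) else 0) -
      (if Terminal c \<in> set w then endpoint_sign x - (if Terminal c = x then sign_sum w else 0) else 0)"
proof -
  have "Initial c \<in> set (concat D)" "Terminal c \<in> set (concat D)" using c chords_iff[OF v, of c] by auto
  then show ?thesis
    unfolding lifted_index_def using rotate1_index(4)[OF v D D' w] by simp
qed

text \<open>
  The sum of signs on a circle is \<open>\<plusminus>\<lambda>\<close>, hence invisible modulo \<open>\<lambda>\<close>; what remains is a shift, in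
  opposite directions for the two types of nonself-chords. Arcs do not depend on the starting
  point, so the indices of self-chords are unchanged.
\<close>

lemma R_agree_rotate1:
  assumes v: "gauss_diagram 2 D" and D: "D = [w1, w2]"
    and D': "D' = [rotate1 w1, w2] \<and> w = w1 \<and> \<sigma> = (1::int) \<or> D' = [w1, rotate1 w2] \<and> w = w2 \<and> \<sigma> = -1"
    and w: "w = x # u"
  shows "R_agree D m D' m"
proof -
  have D0: "D' = [rotate1 w1, w2] \<and> w = w1 \<or> D' = [w1, rotate1 w2] \<and> w = w2" using D' by auto
  note ri = rotate1_index[OF v D D0 w]
  note li = lifted_index_rotate1[OF v D D0 w]
  have d: "distinct w1" "distinct w2" "set w1 \<inter> set w2 = {}"
    using v unfolding D by (auto simp: gauss_diagram_def)
  have tot: "sign_sum w1 = - lambda_diagram D" "sign_sum w2 = lambda_diagram D"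
    using sign_sum_circle[OF v] by (simp_all add: D)
  show ?thesis
  proof (rule R_agree_iso[where f = id and k = "\<sigma> * endpoint_sign x"])
    fix i c assume i: "i \<in> {1, 2}" and c: "c \<in> chords_of_type D i i"
    have "arc_sum (circle D' i) (Initial c) (Terminal c) =
        arc_sum (circle D i) (Initial c) (Terminal c)"
      using D' d i c arc_sum_rotate[of "circle D i" "Initial c" 1]
      by (auto simp: D chords_of_type_def)
    then show "Ind_self D' i (id c) - sg c * m (id c) = Ind_self D i c - sg c * m c"
      by (simp add: Ind_self_def)
  next
    fix c assume c: "c \<in> chords_of_type D 1 2"
    then have "c \<in> chords D" using types_subset_chords[OF v, of 1 2] by auto
    moreover have "Initial c \<in> set w1" "Terminal c \<in> set w2"
      using c by (auto simp: chords_of_type_def D)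
    ultimately show "lambda_diagram D dvd
        lifted_index D' m (id c) - lifted_index D m c - \<sigma> * endpoint_sign x"
      using D' d(3) tot by (auto simp: li)
  next
    fix c assume c: "c \<in> chords_of_type D 2 1"
    then have "c \<in> chords D" using types_subset_chords[OF v, of 2 1] by auto
    moreover have "Initial c \<in> set w2" "Terminal c \<in> set w1"
      using c by (auto simp: chords_of_type_def D)
    ultimately show "lambda_diagram D dvd
        lifted_index D' m (id c) - lifted_index D m c + \<sigma> * endpoint_sign x"
      using D' d(3) tot by (auto simp: li)
  qed (simp_all add: v ri(1,3) total_weight_chords[OF ri(2)])
qed

lemma R_agree_rotate:
  assumes v: "gauss_diagram 2 [w1, w2]"
  shows "R_agree [w1, w2] m [rotate k w1, rotate l w2] m"
proof -
  have a: "R_agree [w1, w2] m [rotate k w1, w2] m"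
  proof (induction k)
    case (Suc k)
    let ?D = "[rotate k w1, w2]"
    have v': "gauss_diagram 2 ?D"
      by (rule rotated_gauss_diagram[OF rotated_twoI(2) v])
    have "R_agree ?D m [rotate1 (rotate k w1), w2] m"
    proof (cases "rotate k w1")
      case Nil
      then show ?thesis by (simp add: R_agree_refl)
    next
      case (Cons x u)
      show ?thesis by (rule R_agree_rotate1[OF v' refl _ Cons]) auto
    qed
    then show ?case using Suc.IH by (auto intro: R_agree_trans)
  qed (simp add: R_agree_refl)
  have b: "R_agree [rotate k w1, w2] m [rotate k w1, rotate l w2] m"
  proof (induction l)
    case (Suc l)
    let ?D = "[rotate k w1, rotate l w2]"
    have v': "gauss_diagram 2 ?D"
      by (rule rotated_gauss_diagram[OF rotated_twoI(1) v])
    have "R_agree ?D m [rotate k w1, rotate1 (rotate l w2)] m"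
    proof (cases "rotate l w2")
      case Nil
      then show ?thesis by (simp add: R_agree_refl)
    next
      case (Cons x u)
      show ?thesis by (rule R_agree_rotate1[OF v' refl _ Cons]) auto
    qed
    then show ?case using Suc.IH by (auto intro: R_agree_trans)
  qed (simp add: R_agree_refl)
  show ?thesis by (rule R_agree_trans[OF a b])
qed

lemma R_agree_rotated:
  assumes "gauss_diagram 2 D" "rotated D D'"
  shows "R_agree D m D' m"
proof -
  obtain w1 w2 where D: "D = [w1, w2]" using assms(1) by (rule gauss2E)
  show ?thesis using assms R_agree_rotate unfolding D rotated_two by auto
qed

lemma R_agree_followed_by_swapped:
  assumes v: "gauss_diagram 2 D" and f: "followed_by D p q" and pq: "chord_of p \<noteq> chord_of q"
  shows "R_agree D m (swapped p q D) (swap_weight p q m)"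
proof -
  obtain D1 where D1: "rotated D D1" "next_in D1 p q" using followed_by_linear[OF v f] by blast
  have v1: "gauss_diagram 2 D1" by (rule rotated_gauss_diagram[OF D1(1) v])
  have v2: "gauss_diagram 2 (swapped p q D)"
    using gauss_diagram_swapped[OF v] followed_by_in_concat[OF f] by blast
  have "R_agree D m D1 m" by (rule R_agree_rotated[OF v D1(1)])
  also have "R_agree D1 m (swapped p q D1) (swap_weight p q m)"
    by (rule R_agree_swapped[OF v1 D1(2) pq])
  also have "R_agree (swapped p q D1) (swap_weight p q m) (swapped p q D) (swap_weight p q m)"
    by (rule R_agree_sym[OF R_agree_rotated[OF v2 rotated_swapped[OF D1(1)]]])
  finally show ?thesis .
qed

section \<open>Deletions and renamings\<close>

lemma next_to_height:
  assumes "distinct W" "next_to W x y"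
  shows "height W y = height W x + endpoint_sign x"
  using assms by (auto simp: next_to_iff height_append)

lemma not_precedes: "x \<notin> set w \<Longrightarrow> \<not> precedes w x y"
  using precedes_in_set by fast

lemma next_to_precedes:
  assumes "distinct W" "next_to W x y" "z \<noteq> x" "z \<noteq> y"
  shows "precedes W x z \<longleftrightarrow> precedes W y z" "precedes W z x \<longleftrightarrow> precedes W z y"
  using assms by (auto simp: next_to_iff precedes_append not_precedes)

lemma circle_next_to:
  assumes v: "gauss_diagram 2 D" and l: "next_in D x y" and i: "i \<in> {1, 2}"
  shows "distinct (circle D i)"
    "next_to (circle D i) x y \<or> x \<notin> set (circle D i) \<and> y \<notin> set (circle D i)"
proof -
  obtain w1 w2 where D: "D = [w1, w2]" and d: "distinct w1" "distinct w2" "set w1 \<inter> set w2 = {}"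
    using v by (rule gauss2E)
  show "distinct (circle D i)" using i d by (auto simp: D)
  show "next_to (circle D i) x y \<or> x \<notin> set (circle D i) \<and> y \<notin> set (circle D i)"
    using l i d by (auto simp: D next_in_def dest: next_to_in_set)
qed

text \<open>
  Only the sum of the signs of the deleted endpoints matters, and they are adjacent.
\<close>

lemma height_delete_isolated:
  assumes dW: "distinct W" and n: "next_to W x y" and xy: "{x, y} = {Initial c, Terminal c}"
    and e: "chord_of e \<noteq> c"
  shows "height (filter (\<lambda>e. chord_of e \<notin> {c}) W) e = height W e"
proof -
  have s: "endpoint_sign x + endpoint_sign y = 0" using xy by (auto simp: doubleton_eq_iff)
  have flt: "(\<lambda>e. chord_of e \<notin> {c}) = (\<lambda>e. e \<notin> {x, y})"
  proof
    fix e show "chord_of e \<notin> {c} \<longleftrightarrow> e \<notin> {x, y}" unfolding xy by (cases e) auto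
  qed
  show ?thesis unfolding flt
    by (rule height_delete_pair[OF dW n s]) (use e xy in \<open>auto simp: doubleton_eq_iff\<close>)
qed

lemma filter_parallel:
  assumes "{x, y} = {Initial c, Initial d}" "{x', y'} = {Terminal c, Terminal d}"
  shows "filter (\<lambda>e. chord_of e \<notin> {c, d}) w =
    filter (\<lambda>e. e \<notin> {x', y'}) (filter (\<lambda>e. e \<notin> {x, y}) w)"
  unfolding filter_filter assms
proof (rule filter_cong[OF refl])
  fix e show "chord_of e \<notin> {c, d} \<longleftrightarrow> e \<notin> {Initial c, Initial d} \<and> e \<notin> {Terminal c, Terminal d}"
    by (cases e) auto
qed

text \<open>
  The initial endpoints form an adjacent pair of opposite signs, and so do the terminal ones.
\<close>

lemma height_delete_parallel:
  assumes dW: "distinct W" and n1: "next_to W x y" "next_to W x' y'"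
    and xy: "{x, y} = {Initial c, Initial d}" "{x', y'} = {Terminal c, Terminal d}"
    and s: "sg d = - sg c" and e: "chord_of e \<notin> {c, d}"
  shows "height (filter (\<lambda>e. chord_of e \<notin> {c, d}) W) e = height W e"
proof -
  have s1: "endpoint_sign x + endpoint_sign y = 0" and s2: "endpoint_sign x' + endpoint_sign y' = 0"
    using s xy by (auto simp: doubleton_eq_iff)
  have ne: "x' \<noteq> x" "x' \<noteq> y" "y' \<noteq> x" "y' \<noteq> y" using xy by (auto simp: doubleton_eq_iff)
  let ?W = "filter (\<lambda>e. e \<notin> {x, y}) W"
  have n2: "next_to ?W x' y'" using n1(2) ne by (intro next_to_filter) auto
  have d: "distinct ?W" using dW by simp
  have "e \<noteq> x" "e \<noteq> y" "e \<noteq> x'" "e \<noteq> y'" using e xy by (auto simp: doubleton_eq_iff)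
  then show ?thesis
    unfolding filter_parallel[OF xy]
    using height_delete_pair[OF d n2 s2, of e] height_delete_pair[OF dW n1(1) s1, of e] by simp
qed

text \<open>
  An isolated chord of weight \<open>m c\<close> has corrected index \<open>- \<epsilon> (m c)\<close>, plus the sum of all signs on the
  circle if its arc is the long one.
\<close>

lemma agree_delete_isolated:
  assumes v: "gauss_diagram 2 D" and l: "next_in D x y" and xy: "{x, y} = {Initial c, Terminal c}"
  shows "lambda_diagram (delete_chords {c} D) = lambda_diagram D"
    "i \<in> {1, 2} \<Longrightarrow> self_writhe D m i n = self_writhe (delete_chords {c} D) m i n +
       (if c \<in> chords_of_type D i i \<and>
           (if x = Initial c then 0 else sign_sum (circle D i)) - sg c * m c = n then sg c else 0)"
    "shift_agree D m (delete_chords {c} D) m"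
    "total_weight D m = total_weight (delete_chords {c} D) m + m c"
    "c \<in> chords_of_type D 1 1 \<and> c \<notin> chords_of_type D 2 2 \<or>
     c \<notin> chords_of_type D 1 1 \<and> c \<in> chords_of_type D 2 2"
proof -
  have dW: "distinct (concat D)" by (rule distinct_concat_gauss[OF v])
  have n: "next_to (concat D) x y" by (rule next_in_concat[OF l])
  have s: "endpoint_sign x + endpoint_sign y = 0" using xy by (auto simp: doubleton_eq_iff)
  have flt: "(\<lambda>e. chord_of e \<notin> {c}) = (\<lambda>e. e \<notin> {x, y})"
  proof
    fix e show "chord_of e \<notin> {c} \<longleftrightarrow> e \<notin> {x, y}" unfolding xy by (cases e) auto
  qed
  have ht: "height (concat (delete_chords {c} D)) e = height (concat D) e" if "chord_of e \<notin> {c}" for e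
    unfolding concat_delete_chords using height_delete_isolated[OF dW n xy] that by simp
  have tot: "sign_sum (circle (delete_chords {c} D) 2) = sign_sum (circle D 2)"
    unfolding circle_delete_chords[OF v, of 2, simplified] flt
    by (rule sign_sum_delete_pair[OF circle_next_to[OF v l] s]) simp_all
  have ht': "\<forall>e. chord_of e \<notin> {c} \<longrightarrow> height (concat (delete_chords {c} D)) e = height (concat D) e"
    using ht by blast
  note ag = agree_delete_chords[OF v tot ht']
  show lam: "lambda_diagram (delete_chords {c} D) = lambda_diagram D" by (rule ag(1))
  obtain w1 w2 where D: "D = [w1, w2]" and d: "distinct w1" "distinct w2" "set w1 \<inter> set w2 = {}"
    using v by (rule gauss2E)
  have same: "Initial c \<in> set w1 \<and> Terminal c \<in> set w1 \<or> Initial c \<in> set w2 \<and> Terminal c \<in> set w2"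
    using l xy by (auto simp: D next_in_def doubleton_eq_iff dest: next_to_in_set)
  show "c \<in> chords_of_type D 1 1 \<and> c \<notin> chords_of_type D 2 2 \<or>
     c \<notin> chords_of_type D 1 1 \<and> c \<in> chords_of_type D 2 2"
    using same d(3) by (auto simp: D chords_of_type_def)
  have no: "c \<notin> chords_of_type D 1 2" "c \<notin> chords_of_type D 2 1"
    using same d(3) by (auto simp: D chords_of_type_def)
  have cc: "c \<in> chords D" using next_to_in_set[OF n] chords_iff[OF v, of c] xy
    by (auto simp: doubleton_eq_iff)
  have ind: "Ind_self D i c - sg c * m c =
      (if x = Initial c then 0 else sign_sum (circle D i)) - sg c * m c"
    if i: "i \<in> {1, 2}" and c: "c \<in> chords_of_type D i i" for i
  proof -
    have "height (concat D) y = height (concat D) x + endpoint_sign x"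
      by (rule next_to_height[OF dW n])
    moreover have "\<not> precedes (concat D) y x" "precedes (concat D) x y"
      using dW n by (auto simp: next_to_iff precedes_append)
    ultimately show ?thesis using xy unfolding Ind_self_eq[OF v i c] lifted_index_def
      by (auto simp: doubleton_eq_iff)
  qed
  have one: "{c'. c' \<in> A \<and> c' \<in> {c} \<and> P c'} = (if c \<in> A \<and> P c then {c} else {})" for A and P
    by auto
  show "i \<in> {1, 2} \<Longrightarrow> self_writhe D m i n = self_writhe (delete_chords {c} D) m i n +
       (if c \<in> chords_of_type D i i \<and>
           (if x = Initial c then 0 else sign_sum (circle D i)) - sg c * m c = n then sg c else 0)"
    using ag(2)[of i m n] ind[of i] unfolding one by (auto split: if_splits)
  have "residue_writhe (delete_chords {c} D) m 1 2 r = residue_writhe D m 1 2 r"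
    "residue_writhe (delete_chords {c} D) m 2 1 r = residue_writhe D m 2 1 r" for r
    using ag(3)[of 1 2 m r] ag(3)[of 2 1 m r] no unfolding one by auto
  then show "shift_agree D m (delete_chords {c} D) m"
    unfolding shift_agree_def by (intro exI[of _ 0]) simp
  have "{c'. c' \<in> chords D \<and> c' \<in> {c}} = {c}" using cc by auto
  then show "total_weight D m = total_weight (delete_chords {c} D) m + m c"
    using ag(4)[of m] by simp
qed

text \<open>
  Without weight, the index is one of the two excluded values.
\<close>

lemma R_agree_delete_isolated:
  assumes v: "gauss_diagram 2 D" and l: "next_in D x y" and xy: "{x, y} = {Initial c, Terminal c}"
    and m: "m c = 0"
  shows "R_agree D m (delete_chords {c} D) m"
  unfolding R_agree_def
  using agree_delete_isolated(1)[OF v l xy] agree_delete_isolated(2-4)[OF v l xy, where m = m]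
    agree_delete_isolated(5)[OF v l xy]
    m sign_sum_circle[OF v] by auto

text \<open>
  With weight \<open>- \<epsilon>\<close> the chord counts \<open>\<epsilon>\<close> among the shells by its index and \<open>- \<epsilon>\<close> by its weight.
\<close>

lemma S_agree_delete_isolated:
  assumes v: "gauss_diagram 2 D" and l: "next_in D x y" and xy: "{x, y} = {Initial c, Terminal c}"
    and m: "m c = - sg c"
  shows "S_agree D m (delete_chords {c} D) m"
  unfolding S_agree_def shell_count_def
  using agree_delete_isolated(1)[OF v l xy] agree_delete_isolated(2-4)[OF v l xy, where m = m]
    agree_delete_isolated(5)[OF v l xy]
    m sign_sum_circle[OF v] by auto

text \<open>
  Parallel chords of opposite signs have equal indices, so their contributions cancel.
\<close>

lemma R_agree_delete_parallel:
  assumes v: "gauss_diagram 2 D" and s: "sg d = - sg c" and m: "m c = 0" "m d = 0"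
    and I: "next_in D (Initial c) (Initial d) \<or> next_in D (Initial d) (Initial c)"
    and T: "next_in D (Terminal c) (Terminal d) \<or> next_in D (Terminal d) (Terminal c)"
  shows "R_agree D m (delete_chords {c, d} D) m"
proof -
  have dW: "distinct (concat D)" by (rule distinct_concat_gauss[OF v])
  have cd: "c \<noteq> d" using s by auto
  obtain x y where xy: "next_in D x y" "{x, y} = {Initial c, Initial d}" using I by blast
  obtain x' y' where xy': "next_in D x' y'" "{x', y'} = {Terminal c, Terminal d}" using T by blast
  have s1: "endpoint_sign x + endpoint_sign y = 0" and s2: "endpoint_sign x' + endpoint_sign y' = 0"
    using s xy(2) xy'(2) by (auto simp: doubleton_eq_iff)
  let ?W = "concat D"
  note flt = filter_parallel[OF xy(2) xy'(2)]
  have n1: "next_to ?W x y" "next_to ?W x' y'" using next_in_concat xy(1) xy'(1) by auto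
  have ne: "x' \<noteq> x" "x' \<noteq> y" "y' \<noteq> x" "y' \<noteq> y" using xy(2) xy'(2) by (auto simp: doubleton_eq_iff)
  have ht: "height (concat (delete_chords {c, d} D)) e = height ?W e" if "chord_of e \<notin> {c, d}" for e
    unfolding concat_delete_chords by (rule height_delete_parallel[OF dW n1 xy(2) xy'(2) s that])
  have tot: "sign_sum (circle (delete_chords {c, d} D) 2) = sign_sum (circle D 2)"
  proof -
    have d: "distinct (circle D 2)" by (rule circle_next_to[OF v xy(1)]) simp
    let ?w = "filter (\<lambda>e. e \<notin> {x, y}) (circle D 2)"
    have "next_to (circle D 2) x' y' \<or> x' \<notin> set (circle D 2) \<and> y' \<notin> set (circle D 2)"
      by (rule circle_next_to(2)[OF v xy'(1)]) simp
    then have "next_to ?w x' y' \<or> x' \<notin> set ?w \<and> y' \<notin> set ?w"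
    proof
      assume "next_to (circle D 2) x' y'"
      then have "next_to ?w x' y'" by (rule next_to_filter) (simp_all add: ne)
      then show ?thesis ..
    qed simp
    then have "sign_sum (filter (\<lambda>e. e \<notin> {x', y'}) ?w) = sign_sum ?w"
      by (intro sign_sum_delete_pair[OF _ _ s2]) (simp_all add: d)
    also have "\<dots> = sign_sum (circle D 2)"
      by (rule sign_sum_delete_pair[OF circle_next_to[OF v xy(1)] s1]) simp_all
    finally show ?thesis unfolding circle_delete_chords[OF v, of 2, simplified] flt .
  qed
  have ht': "\<forall>e. chord_of e \<notin> {c, d} \<longrightarrow> height (concat (delete_chords {c, d} D)) e = height ?W e"
    using ht by blast
  note ag = agree_delete_chords[OF v tot ht']
  have hI: "height ?W (Initial d) = height ?W (Initial c) - sg c"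
    using xy next_to_height[OF dW n1(1)] s by (auto simp: doubleton_eq_iff)
  have hT: "height ?W (Terminal d) = height ?W (Terminal c) + sg c"
    using xy' next_to_height[OF dW n1(2)] s by (auto simp: doubleton_eq_iff)
  have li: "lifted_index D m d = lifted_index D m c"
    unfolding lifted_index_def hI hT s m by simp
  have ty: "d \<in> chords_of_type D i j \<longleftrightarrow> c \<in> chords_of_type D i j" if "i \<in> {1, 2}" "j \<in> {1, 2}" for i j
  proof -
    obtain w1 w2 where D: "D = [w1, w2]" and dd: "set w1 \<inter> set w2 = {}" using v by (rule gauss2E)
    have "Initial d \<in> set w1 \<longleftrightarrow> Initial c \<in> set w1" "Initial d \<in> set w2 \<longleftrightarrow> Initial c \<in> set w2"
      "Terminal d \<in> set w1 \<longleftrightarrow> Terminal c \<in> set w1" "Terminal d \<in> set w2 \<longleftrightarrow> Terminal c \<in> set w2"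
      using I T dd by (auto simp: D next_in_def dest: next_to_in_set)
    then show ?thesis using that by (auto simp: D chords_of_type_def)
  qed
  have prec: "precedes ?W (Terminal d) (Initial d) \<longleftrightarrow> precedes ?W (Terminal c) (Initial c)"
  proof -
    have "precedes ?W (Terminal d) z \<longleftrightarrow> precedes ?W (Terminal c) z" if "z \<notin> {x', y'}" for z
      using next_to_precedes(1)[OF dW n1(2), of z] that xy'(2) by (auto simp: doubleton_eq_iff)
    moreover have "precedes ?W z (Initial d) \<longleftrightarrow> precedes ?W z (Initial c)" if "z \<notin> {x, y}" for z
      using next_to_precedes(2)[OF dW n1(1), of z] that xy(2) by (auto simp: doubleton_eq_iff)
    ultimately show ?thesis using xy(2) xy'(2) by (auto simp: doubleton_eq_iff)
  qed
  have ind: "Ind_self D i d - sg d * m d = Ind_self D i c - sg c * m c"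
    if i: "i \<in> {1, 2}" and c: "c \<in> chords_of_type D i i" for i
    using Ind_self_eq[OF v i c, of m] Ind_self_eq[OF v i, of d m] c ty[OF i i] li prec by simp
  have zero: "(\<Sum>c' | c' \<in> A \<and> c' \<in> {c, d} \<and> P c'. sg c') = 0"
    if "d \<in> A \<longleftrightarrow> c \<in> A" "c \<in> A \<Longrightarrow> P d \<longleftrightarrow> P c" for A :: "chord set" and P
  proof -
    have "{c'. c' \<in> A \<and> c' \<in> {c, d} \<and> P c'} = (if c \<in> A \<and> P c then {c, d} else {})"
      using that by auto
    then show ?thesis using s cd by simp
  qed
  have J: "self_writhe D m i n = self_writhe (delete_chords {c, d} D) m i n" if i: "i \<in> {1, 2}" for i n
    using ag(2)[OF i, of m n] zero[of "chords_of_type D i i" "\<lambda>c. Ind_self D i c - sg c * m c = n"]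
      ty[OF i i] ind[OF i] by simp
  have A: "residue_writhe D m i j r = residue_writhe (delete_chords {c, d} D) m i j r"
    if i: "i \<in> {1, 2}" and j: "j \<in> {1, 2}" for i j r
    using ag(3)[OF i j, of m r] ty[OF i j] li
      zero[of "chords_of_type D i j" "\<lambda>c. lambda_diagram D dvd lifted_index D m c - r"] by simp
  have "(\<Sum>c' | c' \<in> chords D \<and> c' \<in> {c, d}. m c') = 0"
    by (rule sum.neutral) (use m in auto)
  then have W: "total_weight D m = total_weight (delete_chords {c, d} D) m" using ag(4)[of m] by simp
  have "shift_agree D m (delete_chords {c, d} D) m"
    unfolding shift_agree_def by (intro exI[of _ 0]) (simp add: A)
  then show ?thesis unfolding R_agree_def using ag(1) J W by simp
qed

lemma height_map:
  assumes "inj_on g (insert e (set w))" "\<And>x. x \<in> set w \<Longrightarrow> endpoint_sign (g x) = endpoint_sign x"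
  shows "height (map g w) (g e) = height w e"
  using assms by (induction w) (auto simp: inj_on_def)

lemma precedes_map:
  assumes "inj_on g (insert x (insert y (set w)))"
  shows "precedes (map g w) (g x) (g y) \<longleftrightarrow> precedes w x y"
  using assms by (induction w) (auto simp: inj_on_def)

definition rename :: "(chord \<Rightarrow> chord) \<Rightarrow> gauss \<Rightarrow> gauss" where
  "rename f D = map (map (map_endpoint f)) D"

lemma same_diagram_iff:
  "same_diagram D D' \<longleftrightarrow> (\<exists>f. inj_on f (chords D) \<and> (\<forall>c\<in>chords D. positive (f c) = positive c) \<and>
     rotated (rename f D) D')"
  by (simp add: same_diagram_def rotated_def rename_def list_all2_map1)

lemma R_agree_rename:
  assumes v: "gauss_diagram 2 D" and v': "gauss_diagram 2 (rename f D)"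
    and inj: "inj_on f (chords D)" and pos: "\<And>c. c \<in> chords D \<Longrightarrow> positive (f c) = positive c"
    and m: "\<And>c. c \<in> chords D \<Longrightarrow> m' (f c) = m c"
  shows "R_agree D m (rename f D) m'"
proof -
  let ?g = "map_endpoint f"
  have sgn: "sg (f c) = sg c" if "c \<in> chords D" for c
    using pos[OF that] by (simp add: chord_sign_def)
  have cc: "concat (rename f D) = map ?g (concat D)" by (simp add: rename_def map_concat)
  have ginj: "inj_on ?g (set (concat D))"
  proof (rule inj_onI)
    fix a b assume "a \<in> set (concat D)" "b \<in> set (concat D)" "?g a = ?g b"
    moreover have "f (chord_of a) = f (chord_of b)"
      using \<open>?g a = ?g b\<close> by (cases a rule: endpoint.exhaust; cases b rule: endpoint.exhaust) auto
    ultimately have "chord_of a = chord_of b" using inj_onD[OF inj] chord_of_in_chords by blast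
    then show "a = b" using \<open>?g a = ?g b\<close> by (cases a; cases b) auto
  qed
  have gs: "endpoint_sign (?g x) = endpoint_sign x" if "x \<in> set (concat D)" for x
    using sgn[OF chord_of_in_chords[OF that]] by (cases x) auto
  have ht: "height (concat (rename f D)) (?g e) = height (concat D) e" if "e \<in> set (concat D)" for e
    unfolding cc by (rule height_map) (use that ginj gs in \<open>simp_all only: insert_absorb\<close>)
  have pr: "precedes (concat (rename f D)) (?g x) (?g y) \<longleftrightarrow> precedes (concat D) x y"
    if "x \<in> set (concat D)" "y \<in> set (concat D)" for x y
    unfolding cc by (rule precedes_map) (use that ginj in \<open>simp only: insert_absorb\<close>)
  have li: "lifted_index (rename f D) m' (f c) = lifted_index D m c" if "c \<in> chords D" for c
    using ht[of "Initial c"] ht[of "Terminal c"] that chords_iff[OF v, of c] m sgn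
    by (simp add: lifted_index_def)
  obtain w1 w2 where D: "D = [w1, w2]" using v by (rule gauss2E)
  have mem: "Initial c' \<in> ?g ` set (circle D i) \<longleftrightarrow> (\<exists>c. c' = f c \<and> Initial c \<in> set (circle D i))"
    "Terminal c' \<in> ?g ` set (circle D i) \<longleftrightarrow> (\<exists>c. c' = f c \<and> Terminal c \<in> set (circle D i))" for c' i
  proof -
    have g: "Initial c' = ?g e \<longleftrightarrow> (\<exists>c. c' = f c \<and> e = Initial c)"
      "Terminal c' = ?g e \<longleftrightarrow> (\<exists>c. c' = f c \<and> e = Terminal c)" for e
      by (cases e; auto)+
    then show "Initial c' \<in> ?g ` set (circle D i) \<longleftrightarrow> (\<exists>c. c' = f c \<and> Initial c \<in> set (circle D i))"
      "Terminal c' \<in> ?g ` set (circle D i) \<longleftrightarrow> (\<exists>c. c' = f c \<and> Terminal c \<in> set (circle D i))"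
      unfolding image_iff Bex_def g by blast+
  qed
  have circ: "set (circle (rename f D) i) = ?g ` set (circle D i)" if "i \<in> {1, 2}" for i
    using that by (auto simp: D rename_def)
  have circ': "set (circle D i) \<subseteq> set (concat D)" if "i \<in> {1, 2}" for i
    using that by (auto simp: D)
  have ty: "chords_of_type (rename f D) i j = f ` chords_of_type D i j"
    if i: "i \<in> {1, 2}" and j: "j \<in> {1, 2}" for i j
  proof -
    have "c1 = c2" if "f c1 = f c2" "Initial c1 \<in> set (circle D i)" "Terminal c2 \<in> set (circle D j)" for c1 c2
      using inj that circ'[OF i] circ'[OF j] chords_iff[OF v] unfolding inj_on_def by blast
    then show ?thesis unfolding chords_of_type_def circ[OF i] circ[OF j] mem by blast
  qed
  have tot: "sign_sum (circle (rename f D) i) = sign_sum (circle D i)" if i: "i \<in> {1, 2}" for i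
  proof -
    have "sign_sum (map ?g (circle D i)) = sign_sum (circle D i)"
      unfolding sign_sum_def map_map comp_def
      by (rule arg_cong[where f = sum_list], rule map_cong[OF refl]) (use gs circ'[OF i] in blast)
    then show ?thesis using i by (auto simp: D rename_def)
  qed
  have ch: "chords (rename f D) = f ` chords D"
    unfolding chords_def cc by (auto simp: image_image endpoint.map_sel image_iff) (metis endpoint.map_sel endpoint.exhaust_sel endpoint.simps(9,10) endpoint.sel)+
  show ?thesis
  proof (rule R_agree_iso[OF v v' ty inj sgn, where k = 0])
    fix i c assume i: "i \<in> {1, 2}" and c: "c \<in> chords_of_type D i i"
    then have cD: "c \<in> chords D" using types_subset_chords[OF v i] by blast
    have c': "f c \<in> chords_of_type (rename f D) i i" using c ty[OF i i] by blast
    have "precedes (concat (rename f D)) (Terminal (f c)) (Initial (f c)) \<longleftrightarrow>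
        precedes (concat D) (Terminal c) (Initial c)"
      using pr[of "Terminal c" "Initial c"] chords_iff[OF v, of c] cD by simp
    then show "Ind_self (rename f D) i (f c) - sg c * m' (f c) = Ind_self D i c - sg c * m c"
      using Ind_self_eq[OF v i c, of m] Ind_self_eq[OF v' i c', of m'] li[OF cD] tot[OF i] sgn[OF cD]
      by simp
  next
    show "total_weight (rename f D) m' = total_weight D m"
      unfolding total_weight_def ch using m by (subst sum.reindex[OF inj]) auto
  next
    fix c assume "c \<in> chords_of_type D 1 2"
    then have "c \<in> chords D" using types_subset_chords[OF v, of 1 2] by auto
    then show "lambda_diagram D dvd lifted_index (rename f D) m' (f c) - lifted_index D m c - 0"
      by (simp add: li)
  next
    fix c assume "c \<in> chords_of_type D 2 1"
    then have "c \<in> chords D" using types_subset_chords[OF v, of 2 1] by auto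
    then show "lambda_diagram D dvd lifted_index (rename f D) m' (f c) - lifted_index D m c + 0"
      by (simp add: li)
  qed
qed

section \<open>Invariance under the moves\<close>

lemma R_agree_delete_followed_by:
  assumes v: "gauss_diagram 2 D" and f: "followed_by D x y" and xy: "{x, y} = {Initial c, Terminal c}"
    and m: "m c = 0"
  shows "R_agree D m (delete_chords {c} D) m"
proof -
  obtain D1 where D1: "rotated D D1" "next_in D1 x y" using followed_by_linear[OF v f] by blast
  have v1: "gauss_diagram 2 D1" by (rule rotated_gauss_diagram[OF D1(1) v])
  note R_agree_rotated[OF v D1(1)]
  also note R_agree_delete_isolated[where m = m, OF v1 D1(2) xy m]
  also note R_agree_sym[OF R_agree_rotated[OF gauss_diagram_delete_chords[OF v] rotated_delete_chords[OF D1(1)]]]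
  finally show ?thesis .
qed

lemma S_agree_rotated: "gauss_diagram 2 D \<Longrightarrow> rotated D D' \<Longrightarrow> S_agree D m D' m"
  by (rule R_agree_imp_S_agree[OF R_agree_rotated])

lemma S_agree_delete_followed_by:
  assumes v: "gauss_diagram 2 D" and f: "followed_by D x y" and xy: "{x, y} = {Initial c, Terminal c}"
    and m: "m c = - sg c"
  shows "S_agree D m (delete_chords {c} D) m"
proof -
  obtain D1 where D1: "rotated D D1" "next_in D1 x y" using followed_by_linear[OF v f] by blast
  have v1: "gauss_diagram 2 D1" by (rule rotated_gauss_diagram[OF D1(1) v])
  note S_agree_rotated[OF v D1(1)]
  also note S_agree_delete_isolated[where m = m, OF v1 D1(2) xy m]
  also note S_agree_sym[OF S_agree_rotated[OF gauss_diagram_delete_chords[OF v] rotated_delete_chords[OF D1(1)]]]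
  finally show ?thesis .
qed

lemma R_agree_R1:
  assumes v: "gauss_diagram 2 D" and R: "R1 D D'"
  shows "R_agree D (\<lambda>_. 0) D' (\<lambda>_. 0)"
proof -
  obtain c where c: "adjacent D (Initial c) (Terminal c)" "D' = delete_chord c D"
    using R by (auto simp: R1_def)
  show ?thesis using c(1) R_agree_delete_followed_by[OF v, of _ _ c "\<lambda>_. 0"]
    unfolding c(2) delete_chord_eq adjacent_def by (auto simp: insert_commute)
qed

lemma R_agree_R2:
  assumes v: "gauss_diagram 2 D" and R: "R2 D D'"
  shows "R_agree D (\<lambda>_. 0) D' (\<lambda>_. 0)"
proof -
  obtain c d where s: "sg d = - sg c" and ad: "adjacent D (Initial c) (Initial d)"
    "adjacent D (Terminal c) (Terminal d)" and D': "D' = delete_chord c (delete_chord d D)"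
    using R by (auto simp: R2_def)
  obtain x y where xy: "followed_by D x y" "{x, y} = {Initial c, Initial d}"
    using ad(1) unfolding adjacent_def by blast
  obtain x' y' where xy': "followed_by D x' y'" "{x', y'} = {Terminal c, Terminal d}"
    using ad(2) unfolding adjacent_def by blast
  have "{x, y} \<inter> {x', y'} = {}" unfolding xy(2) xy'(2) by auto
  then obtain D1 where D1: "rotated D D1" "next_in D1 x y" "next_in D1 x' y'"
    using followed_by_linear2[OF v xy(1) xy'(1)] by auto
  have v1: "gauss_diagram 2 D1" by (rule rotated_gauss_diagram[OF D1(1) v])
  have K: "delete_chords {c} (delete_chords {d} E) = delete_chords {c, d} E" for E by (simp add: delete_chords_delete_chords insert_commute)
  note R_agree_rotated[OF v D1(1)]
  also have "R_agree D1 (\<lambda>_. 0) (delete_chords {c, d} D1) (\<lambda>_. 0)"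
    by (rule R_agree_delete_parallel[OF v1 s])
      (use D1(2,3) xy(2) xy'(2) in \<open>auto simp: doubleton_eq_iff\<close>)
  also note R_agree_sym[OF R_agree_rotated[OF gauss_diagram_delete_chords[OF v] rotated_delete_chords[OF D1(1)]]]
  finally show ?thesis unfolding D' delete_chord_eq K .
qed

text \<open>
  Writing R3 as three exchanges, every one of the chords \<open>a\<close>, \<open>b\<close>, \<open>c\<close> gains weight once and loses
  weight once.
\<close>

lemma R_agree_R3:
  assumes v: "gauss_diagram 2 D" and R: "R3 D D'"
  shows "R_agree D (\<lambda>_. 0) D' (\<lambda>_. 0)"
proof -
  obtain a b c where ne: "distinct [a, b, c]" and s: "sg a = sg b" "sg b = sg c"
    and f: "followed_by D (Initial a) (Initial b)" "followed_by D (Terminal a) (Initial c)"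
     "followed_by D (Terminal b) (Terminal c)"
    and D': "D' = map (map (transpose (Initial a) (Initial b) \<circ> transpose (Terminal a) (Initial c) \<circ>
                    transpose (Terminal b) (Terminal c))) D"
    using R unfolding R3_def by blast
  define D1 where "D1 = swapped (Terminal b) (Terminal c) D"
  define D2 where "D2 = swapped (Terminal a) (Initial c) D1"
  have D3: "D' = swapped (Initial a) (Initial b) D2"
    by (simp add: D' D2_def D1_def swapped_def comp_assoc)
  have v1: "gauss_diagram 2 D1" unfolding D1_def
    using gauss_diagram_swapped[OF v] followed_by_in_concat[OF f(3)] by blast
  have f1: "followed_by D1 (Terminal a) (Initial c)" "followed_by D1 (Initial a) (Initial b)"
    using followed_by_swapped[OF f(2), of "Terminal b" "Terminal c"]
      followed_by_swapped[OF f(1), of "Terminal b" "Terminal c"] ne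
    by (simp_all add: D1_def transpose_apply_other)
  have v2: "gauss_diagram 2 D2" unfolding D2_def
    using gauss_diagram_swapped[OF v1] followed_by_in_concat[OF f1(1)] by blast
  have f2: "followed_by D2 (Initial a) (Initial b)"
    using followed_by_swapped[OF f1(2), of "Terminal a" "Initial c"] ne
    by (simp add: D2_def transpose_apply_other)
  let ?m1 = "swap_weight (Terminal b) (Terminal c) (\<lambda>_. 0)"
  let ?m2 = "swap_weight (Terminal a) (Initial c) ?m1"
  let ?m3 = "swap_weight (Initial a) (Initial b) ?m2"
  have "R_agree D (\<lambda>_. 0) D1 ?m1"
    unfolding D1_def by (rule R_agree_followed_by_swapped[OF v f(3)]) (use ne in simp)
  also have "R_agree D1 ?m1 D2 ?m2"
    unfolding D2_def by (rule R_agree_followed_by_swapped[OF v1 f1(1)]) (use ne in simp)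
  also have "R_agree D2 ?m2 D' ?m3"
    unfolding D3 by (rule R_agree_followed_by_swapped[OF v2 f2]) (use ne in simp)
  also have "?m3 = (\<lambda>_. 0)"
    using ne s by (auto simp: swap_weight_def Let_def fun_eq_iff)
  finally show ?thesis .
qed

lemma R_agree_same_diagram:
  assumes v: "gauss_diagram 2 D" and v': "gauss_diagram 2 D'" and s: "same_diagram D D'"
  shows "R_agree D (\<lambda>_. 0) D' (\<lambda>_. 0)"
proof -
  obtain f where f: "inj_on f (chords D)" "\<forall>c\<in>chords D. positive (f c) = positive c"
    "rotated (rename f D) D'" using s unfolding same_diagram_iff by blast
  have v1: "gauss_diagram 2 (rename f D)" by (rule rotated_gauss_diagram[OF rotated_sym[OF f(3)] v'])
  have "R_agree D (\<lambda>_. 0) (rename f D) (\<lambda>_. 0)"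
    by (rule R_agree_rename[OF v v1 f(1)]) (use f(2) in auto)
  also note R_agree_rotated[OF v1 f(3)]
  finally show ?thesis .
qed

lemma R_agree_R_step: "R_step 2 D D' \<Longrightarrow> R_agree D (\<lambda>_. 0) D' (\<lambda>_. 0)"
  unfolding R_step_def
  using R_agree_R1 R_agree_R2 R_agree_R3 R_agree_same_diagram by blast

lemma followed_by_delete_chords:
  assumes "followed_by D p q" "chord_of p \<notin> X" "chord_of q \<notin> X"
  shows "followed_by (delete_chords X D) p q"
proof -
  obtain w k u where w: "w \<in> set D" "rotate k w = p # q # u" using assms(1) by (auto simp: followed_by_def)
  obtain k' where k': "filter (\<lambda>e. chord_of e \<notin> X) (rotate k w) =
      rotate k' (filter (\<lambda>e. chord_of e \<notin> X) w)" using filter_rotate by blast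
  have "rotate k' (filter (\<lambda>e. chord_of e \<notin> X) w) = p # q # filter (\<lambda>e. chord_of e \<notin> X) u"
    unfolding k'[symmetric] w(2) using assms(2,3) by simp
  then show ?thesis using w(1) by (auto simp: followed_by_def delete_chords_def)
qed

lemma R_agree_cong:
  assumes v: "gauss_diagram 2 D" and eq: "\<And>c. c \<in> chords D \<Longrightarrow> m' c = m c"
  shows "R_agree D m D m'"
proof (rule R_agree_iso[where f = id and k = 0])
  fix i c assume "i \<in> {1, 2}" "c \<in> chords_of_type D i i"
  then have "c \<in> chords D" using types_subset_chords v by blast
  then show "Ind_self D i (id c) - sg c * m' (id c) = Ind_self D i c - sg c * m c"
    using eq by simp
next
  fix c assume "c \<in> chords_of_type D 1 2"
  then have "c \<in> chords D" using types_subset_chords[OF v, of 1 2] by auto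
  then show "lambda_diagram D dvd lifted_index D m' (id c) - lifted_index D m c - 0"
    using eq by (simp add: lifted_index_def)
next
  fix c assume "c \<in> chords_of_type D 2 1"
  then have "c \<in> chords D" using types_subset_chords[OF v, of 2 1] by auto
  then show "lambda_diagram D dvd lifted_index D m' (id c) - lifted_index D m c + 0"
    using eq by (simp add: lifted_index_def)
next
  show "total_weight D m' = total_weight D m"
    unfolding total_weight_def by (rule sum.cong) (simp_all add: eq)
qed (simp_all add: v)

text \<open>
  Exchange the endpoint \<open>p\<close> with the endpoint of \<open>s\<close> after it. This makes \<open>s\<close> an isolated chord of
  weight \<open>- \<epsilon>\<^sub>s\<close>, which can be deleted, and it adds \<open>\<epsilon>\<^sub>s\<close> to the weight of the chord of \<open>p\<close>.
\<close>

lemma S_agree_shell: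
  assumes v: "gauss_diagram 2 D" and sh: "shell D s p" and ms: "m s = 0"
  shows "S_agree D m (delete_chords {s} D) (m(chord_of p := m (chord_of p) + sg s))"
proof -
  have ne: "chord_of p \<noteq> s" using sh by (simp add: shell_def)
  obtain x y where xy: "{x, y} = {Initial s, Terminal s}" "followed_by D x p" "followed_by D p y"
    and sy: "endpoint_sign p * endpoint_sign y = sg s"
  proof (cases "endpoint_sign p = 1")
    case True
    then show ?thesis using sh that[of "Initial s" "Terminal s"] by (simp add: shell_def)
  next
    case False
    then have "endpoint_sign p = -1" using endpoint_sign_cases[of p] by simp
    then show ?thesis using sh that[of "Terminal s" "Initial s"] by (simp add: shell_def insert_commute)
  qed
  have cy: "chord_of x = s" "chord_of y = s" and nxy: "x \<noteq> y" "x \<noteq> p" "y \<noteq> p"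
    using xy(1) ne by (auto simp: doubleton_eq_iff)
  obtain D1 where D1: "rotated D D1" "next_in D1 p y" using followed_by_linear[OF v xy(3)] by blast
  have v1: "gauss_diagram 2 D1" by (rule rotated_gauss_diagram[OF D1(1) v])
  define D2 where "D2 = swapped p y D1"
  have v2: "gauss_diagram 2 D2" unfolding D2_def
    using gauss_diagram_swapped[OF v1] next_in_in_concat[OF D1(2)] by blast
  have f2: "followed_by D2 x y"
    using followed_by_swapped[OF followed_by_rotated[OF D1(1) xy(2)], of p y] nxy
    by (simp add: D2_def transpose_apply_other)
  let ?m = "swap_weight p y m"
  have ms': "?m s = - sg s" using ne cy sy ms by (simp add: swap_weight_def Let_def)
  have kp: "delete_chords {s} D2 = delete_chords {s} D1"
  proof -
    have "filter (\<lambda>e. chord_of e \<notin> {s}) (map (transpose p y) w) = filter (\<lambda>e. chord_of e \<notin> {s}) w"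
      if w: "w \<in> set D1" for w
    proof (cases "next_to w p y")
      case True
      have "distinct w" using v1 w unfolding gauss_diagram_def by (auto simp: distinct_concat_iff)
      then show ?thesis using True map_transpose_adjacent[of _ p y] cy
        by (auto simp: next_to_iff)
    next
      case False
      obtain w' where w': "w' \<in> set D1" "next_to w' p y" using D1(2) by (auto simp: next_in_def)
      obtain w1 w2 where D: "D1 = [w1, w2]" "set w1 \<inter> set w2 = {}" using v1 by (rule gauss2E)
      have "p \<notin> set w \<and> y \<notin> set w"
        using False w' w D next_to_in_set[OF w'(2)] by auto
      then show ?thesis by (simp add: map_transpose_id)
    qed
    then show ?thesis by (simp add: delete_chords_def D2_def swapped_def)
  qed
  have pD: "chord_of p \<in> chords D" "s \<in> chords D"
    using followed_by_in_concat[OF xy(3)] chord_of_in_chords cy by metis+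
  have "S_agree D m D1 m" by (rule S_agree_rotated[OF v D1(1)])
  also have "S_agree D1 m D2 ?m" unfolding D2_def
    by (rule R_agree_imp_S_agree[OF R_agree_swapped[OF v1 D1(2)]]) (use ne cy in simp)
  also have "S_agree D2 ?m (delete_chords {s} D1) ?m"
    using S_agree_delete_followed_by[where m = ?m, OF v2 f2 xy(1) ms'] unfolding kp .
  also have "S_agree (delete_chords {s} D1) ?m (delete_chords {s} D) ?m"
    by (rule S_agree_sym[OF S_agree_rotated[OF gauss_diagram_delete_chords[OF v] rotated_delete_chords[OF D1(1)]]])
  also have "S_agree (delete_chords {s} D) ?m (delete_chords {s} D) (m(chord_of p := m (chord_of p) + sg s))"
    using ne cy sy
    by (intro R_agree_imp_S_agree[OF R_agree_cong[OF gauss_diagram_delete_chords[OF v]]])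
      (auto simp: chords_delete_chords swap_weight_def Let_def)
  finally show ?thesis .
qed

text \<open>
  Absorbing the shell at either endpoint of \<open>\<gamma>\<close> yields the same weighted diagram.
\<close>

lemma S_agree_S1:
  assumes v: "gauss_diagram 2 D" and v': "gauss_diagram 2 D'" and S: "S1 D D'"
  shows "S_agree D (\<lambda>_. 0) D' (\<lambda>_. 0)"
proof -
  obtain s \<gamma> p q where pq: "{p, q} = {Initial \<gamma>, Terminal \<gamma>}" and sh: "shell D s p" "shell D' s q"
    and eq: "delete_chord s D = delete_chord s D'" using S unfolding S1_def by blast
  have "chord_of p = \<gamma>" "chord_of q = \<gamma>" using pq by (auto simp: doubleton_eq_iff)
  then show ?thesis
    using S_agree_shell[OF v sh(1), of "\<lambda>_. 0"] S_agree_shell[OF v' sh(2), of "\<lambda>_. 0"] eq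
    unfolding delete_chord_eq by (auto intro: S_agree_trans S_agree_sym)
qed

text \<open>
  Absorbing the two new shells gives the weights that an exchange produces.
\<close>

lemma S_agree_S2:
  assumes v: "gauss_diagram 2 D" and v': "gauss_diagram 2 D'" and S: "S2 D D'"
  shows "S_agree D (\<lambda>_. 0) D' (\<lambda>_. 0)"
proof -
  obtain p q s t where ne: "chord_of p \<noteq> chord_of q" and f: "followed_by D p q"
    and s: "sg s = endpoint_sign p * endpoint_sign q"
    and t: "sg t = - (endpoint_sign p * endpoint_sign q)"
    and new: "s \<notin> chords D" "t \<notin> chords D" and sh: "shell D' s p" "shell D' t q"
    and eq: "delete_chord s (delete_chord t D') = map (map (transpose p q)) D"
    using S unfolding S2_def by blast
  have st: "s \<noteq> t" using s t by auto
  have pq: "chord_of p \<in> chords D" "chord_of q \<in> chords D"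
    using followed_by_in_concat[OF f] chord_of_in_chords by blast+
  have eq': "delete_chords {t} (delete_chords {s} D') = swapped p q D"
    using eq unfolding delete_chord_eq swapped_def delete_chords_delete_chords by (simp add: insert_commute)
  let ?m1 = "(\<lambda>_. 0)(chord_of p := sg s)"
  have 1: "S_agree D' (\<lambda>_. 0) (delete_chords {s} D') ?m1"
    using S_agree_shell[OF v' sh(1), of "\<lambda>_. 0"] by simp
  have sh': "shell (delete_chords {s} D') t q"
    using sh(2) st pq new unfolding shell_def
    by (auto intro!: followed_by_delete_chords split: if_splits)
  have 2: "S_agree (delete_chords {s} D') ?m1 (swapped p q D) (?m1(chord_of q := ?m1 (chord_of q) + sg t))"
    unfolding eq'[symmetric]
    by (rule S_agree_shell[OF gauss_diagram_delete_chords[OF v'] sh']) (use new pq in auto)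
  have m: "?m1(chord_of q := ?m1 (chord_of q) + sg t) = swap_weight p q (\<lambda>_. 0)"
    using ne s t by (auto simp: swap_weight_def Let_def)
  have "S_agree D (\<lambda>_. 0) (swapped p q D) (swap_weight p q (\<lambda>_. 0))"
    by (rule R_agree_imp_S_agree[OF R_agree_followed_by_swapped[OF v f ne]])
  then show ?thesis using 1 2 unfolding m by (meson S_agree_trans S_agree_sym)
qed

lemma S_agree_RS_step: "RS_step 2 D D' \<Longrightarrow> S_agree D (\<lambda>_. 0) D' (\<lambda>_. 0)"
  unfolding RS_step_def
  using R_agree_R1 R_agree_R2 R_agree_R3 R_agree_same_diagram S_agree_S1 S_agree_S2
    R_agree_imp_S_agree by blast

lemma R_agree_equivclp: "equivclp (R_step 2) D D' \<Longrightarrow> R_agree D (\<lambda>_. 0) D' (\<lambda>_. 0)"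
proof (induction rule: equivclp_induct)
  case (step D1 D2)
  then show ?case using R_agree_R_step R_agree_sym R_agree_trans by blast
qed (rule R_agree_refl)

lemma S_agree_equivclp: "equivclp (RS_step 2) D D' \<Longrightarrow> S_agree D (\<lambda>_. 0) D' (\<lambda>_. 0)"
proof (induction rule: equivclp_induct)
  case (step D1 D2)
  then show ?case using S_agree_RS_step S_agree_sym S_agree_trans by blast
qed (rule S_agree_refl)

section \<open>Linking classes and residues of indices\<close>

lemma t_power_add: "t_power a * t_power b = t_power (a + b)"
  by (simp add: t_power_def mult_single)

lemma t_power_0: "t_power 0 = 1"
  by (simp add: t_power_def)

lemma single_eq_t_power: "Poly_Mapping.single a v = Poly_Mapping.single 0 v * t_power a"
  by (simp add: t_power_def mult_single)

lemma t_power_dvd_nat: "(t_power s - 1) dvd (t_power (int k * s) - 1)"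
proof (induction k)
  case (Suc k)
  have "t_power (int (Suc k) * s) - 1 = t_power s * (t_power (int k * s) - 1) + (t_power s - 1)"
    by (simp add: right_diff_distrib t_power_add distrib_right add.commute)
  then show ?case using Suc.IH by (metis dvd_add dvd_mult dvd_refl)
qed (simp add: t_power_0)

lemma t_power_dvd: "(t_power s - 1) dvd (t_power (k * s) - 1)"
proof (cases "0 \<le> k")
  case True
  then show ?thesis using t_power_dvd_nat[of s "nat k"] by simp
next
  case False
  have "t_power (k * s) - 1 = - t_power (k * s) * (t_power (int (nat (- k)) * s) - 1)"
    using False by (simp add: right_diff_distrib t_power_add t_power_0)
  then show ?thesis using t_power_dvd_nat[of s "nat (- k)"] by (metis dvd_mult)
qed

lemma single_cong_dvd:
  assumes "s dvd a - b"
  shows "(t_power s - 1) dvd (Poly_Mapping.single a v - Poly_Mapping.single b v)"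
proof -
  obtain k where k: "a = b + k * s" using assms by (metis dvdE add.commute diff_add_cancel mult.commute)
  have "Poly_Mapping.single a v - Poly_Mapping.single b v =
      (Poly_Mapping.single 0 v * t_power b) * (t_power (k * s) - 1)"
    unfolding k single_eq_t_power[of "b + k * s"] single_eq_t_power[of b] t_power_add[symmetric]
    by (simp add: right_diff_distrib mult.assoc)
  then show ?thesis using t_power_dvd[of s k] by (metis dvd_mult)
qed

text \<open>
  The coefficient of \<open>t\<^sup>r\<close> in the quotient modulo \<open>t\<^sup>s - 1\<close>.
\<close>

definition residue_sum :: "int \<Rightarrow> laurent \<Rightarrow> int \<Rightarrow> int" where
  "residue_sum s f r = (\<Sum>n\<in>Poly_Mapping.keys f. if s dvd n - r then Poly_Mapping.lookup f n else 0)"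

lemma residue_sum_superset:
  assumes "finite A" "Poly_Mapping.keys f \<subseteq> A"
  shows "residue_sum s f r = (\<Sum>n\<in>A. if s dvd n - r then Poly_Mapping.lookup f n else 0)"
  unfolding residue_sum_def using assms
  by (intro sum.mono_neutral_left) (auto simp: in_keys_iff)

lemma residue_sum_diff: "residue_sum s (f - g) r = residue_sum s f r - residue_sum s g r"
proof -
  let ?A = "Poly_Mapping.keys f \<union> Poly_Mapping.keys g"
  have "Poly_Mapping.keys (f - g) \<subseteq> ?A" by (auto simp: in_keys_iff lookup_minus)
  then show ?thesis
    using residue_sum_superset[of ?A f s r] residue_sum_superset[of ?A g s r]
      residue_sum_superset[of ?A "f - g" s r]
    by (simp add: lookup_minus sum_subtractf[symmetric] if_distrib cong: if_cong)
qed

lemma residue_sum_zero [simp]: "residue_sum s 0 r = 0"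
  by (simp add: residue_sum_def)

lemma residue_sum_add: "residue_sum s (f + g) r = residue_sum s f r + residue_sum s g r"
  using residue_sum_diff[of s "f + g" g r] by simp

lemma residue_sum_sum: "residue_sum s (\<Sum>a\<in>A. F a) r = (\<Sum>a\<in>A. residue_sum s (F a) r)"
  by (induction A rule: infinite_finite_induct) (simp_all add: residue_sum_add)

lemma residue_sum_single: "residue_sum s (Poly_Mapping.single a v) r = (if s dvd a - r then v else 0)"
  by (simp add: residue_sum_def)

lemma monomial_expansion: "f = (\<Sum>a\<in>Poly_Mapping.keys f. Poly_Mapping.single a (Poly_Mapping.lookup f a))"
  for f :: laurent
proof (rule poly_mapping_eqI)
  fix k
  have lookup_sum: "Poly_Mapping.lookup (sum F A) k = (\<Sum>a\<in>A. Poly_Mapping.lookup (F a) k)"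
    for F :: "int \<Rightarrow> laurent" and A
    by (induction A rule: infinite_finite_induct) (simp_all add: lookup_add)
  show "Poly_Mapping.lookup f k = Poly_Mapping.lookup
      (\<Sum>a\<in>Poly_Mapping.keys f. Poly_Mapping.single a (Poly_Mapping.lookup f a)) k"
    unfolding lookup_sum by (simp add: lookup_single when_def in_keys_iff)
qed

lemma residue_sum_t_power: "residue_sum s (t_power k * f) r = residue_sum s f (r - k)"
proof -
  have "t_power k * f = (\<Sum>a\<in>Poly_Mapping.keys f. Poly_Mapping.single (a + k) (Poly_Mapping.lookup f a))"
    by (subst monomial_expansion[of f]) (simp add: sum_distrib_left t_power_def mult_single add.commute)
  then have "residue_sum s (t_power k * f) r =
      (\<Sum>a\<in>Poly_Mapping.keys f. if s dvd a + k - r then Poly_Mapping.lookup f a else 0)"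
    by (simp add: residue_sum_sum residue_sum_single)
  then show ?thesis unfolding residue_sum_def by (simp add: algebra_simps)
qed

text \<open>
  Modulo \<open>t\<^sup>s - 1\<close> every monomial can be replaced by the one whose exponent is reduced modulo \<open>s\<close>.
\<close>

lemma t_power_dvd_iff:
  assumes s: "0 < s"
  shows "(t_power s - 1) dvd f \<longleftrightarrow> (\<forall>r. residue_sum s f r = 0)"
proof
  assume "(t_power s - 1) dvd f"
  then obtain h where "f = t_power s * h - h" by (auto elim!: dvdE simp: left_diff_distrib)
  moreover have "residue_sum s h (r - s) = residue_sum s h r" for r
  proof -
    have "s dvd n - (r - s) \<longleftrightarrow> s dvd n - r" for n
    proof -
      have "n - (r - s) = (n - r) + s" by simp
      then show ?thesis by (simp only: dvd_add_triv_right_iff)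
    qed
    then show ?thesis by (simp add: residue_sum_def)
  qed
  ultimately show "\<forall>r. residue_sum s f r = 0"
    by (simp add: residue_sum_diff residue_sum_t_power)
next
  assume z: "\<forall>r. residue_sum s f r = 0"
  let ?K = "Poly_Mapping.keys f" and ?v = "Poly_Mapping.lookup f"
  let ?g = "\<Sum>a\<in>?K. Poly_Mapping.single (a mod s) (?v a)"
  have "?g = (\<Sum>r\<in>{0..<s}. \<Sum>a\<in>{a\<in>?K. a mod s = r}. Poly_Mapping.single (a mod s) (?v a))"
    using s by (intro sum.group[symmetric]) auto
  also have "\<dots> = (\<Sum>r\<in>{0..<s}. Poly_Mapping.single r (residue_sum s f r))"
  proof (rule sum.cong[OF refl])
    fix r assume r: "r \<in> {0..<s}"
    have "{a\<in>?K. a mod s = r} = {a\<in>?K. s dvd a - r}"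
      using r by (auto simp: mod_eq_dvd_iff[symmetric])
    then have "residue_sum s f r = (\<Sum>a\<in>{a\<in>?K. a mod s = r}. ?v a)"
      unfolding residue_sum_def by (simp add: sum.inter_filter)
    moreover have "Poly_Mapping.single r (sum g A) = (\<Sum>a\<in>A. Poly_Mapping.single r (g a))" for g :: "int \<Rightarrow> int" and A
      by (induction A rule: infinite_finite_induct) (simp_all add: single_add)
    ultimately show "(\<Sum>a\<in>{a\<in>?K. a mod s = r}. Poly_Mapping.single (a mod s) (?v a)) =
        Poly_Mapping.single r (residue_sum s f r)" by simp
  qed
  also have "\<dots> = 0" using z by simp
  finally have "f = (\<Sum>a\<in>?K. Poly_Mapping.single a (?v a) - Poly_Mapping.single (a mod s) (?v a))"
    unfolding sum_subtractf using monomial_expansion[of f] by simp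
  moreover have "(t_power s - 1) dvd \<dots>"
    by (intro dvd_sum single_cong_dvd) (simp add: mod_eq_dvd_iff[symmetric])
  ultimately show "(t_power s - 1) dvd f" by simp
qed

lemma Lambda_class_eq_iff:
  assumes "0 < s"
  shows "Lambda_class s f = Lambda_class s g \<longleftrightarrow> (\<forall>r. residue_sum (int s) f r = residue_sum (int s) g r)"
proof -
  have mem: "h \<in> Lambda_class s f \<longleftrightarrow> (\<forall>r. residue_sum (int s) h r = residue_sum (int s) f r)" for h f
    using assms by (simp add: Lambda_class_def t_power_dvd_iff residue_sum_diff)
  show ?thesis unfolding set_eq_iff mem by metis
qed

lemma Gamma_class_eq_iff:
  assumes s: "0 < s"
  shows "Gamma_class s f g = Gamma_class s f' g' \<longleftrightarrow> (\<exists>k. \<forall>r.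
    residue_sum (int s) f' r = residue_sum (int s) f (r - k) \<and>
    residue_sum (int s) g' r = residue_sum (int s) g (r + k))"
proof
  assume eq: "Gamma_class s f g = Gamma_class s f' g'"
  have "(Lambda_class s (t_power 0 * f'), Lambda_class s (t_power (- 0) * g')) \<in> Gamma_class s f' g'"
    unfolding Gamma_class_def by blast
  then obtain k where "Lambda_class s f' = Lambda_class s (t_power k * f)"
    "Lambda_class s g' = Lambda_class s (t_power (- k) * g)"
    unfolding eq[symmetric] by (auto simp: Gamma_class_def t_power_0)
  then show "\<exists>k. \<forall>r. residue_sum (int s) f' r = residue_sum (int s) f (r - k) \<and>
    residue_sum (int s) g' r = residue_sum (int s) g (r + k)"
    unfolding Lambda_class_eq_iff[OF s] residue_sum_t_power by (intro exI[of _ k]) simp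
next
  assume "\<exists>k. \<forall>r. residue_sum (int s) f' r = residue_sum (int s) f (r - k) \<and>
    residue_sum (int s) g' r = residue_sum (int s) g (r + k)"
  then obtain k where k: "\<And>r. residue_sum (int s) f' r = residue_sum (int s) f (r - k)"
    "\<And>r. residue_sum (int s) g' r = residue_sum (int s) g (r + k)" by blast
  have L: "Lambda_class s (t_power j * f') = Lambda_class s (t_power (j + k) * f)"
    "Lambda_class s (t_power (- j) * g') = Lambda_class s (t_power (- (j + k)) * g)" for j
    unfolding Lambda_class_eq_iff[OF s] residue_sum_t_power by (simp_all add: k algebra_simps)
  show "Gamma_class s f g = Gamma_class s f' g'"
  proof (rule set_eqI)
    fix p
    have "(\<exists>j. p = (Lambda_class s (t_power j * f), Lambda_class s (t_power (- j) * g))) \<longleftrightarrow>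
        (\<exists>j. p = (Lambda_class s (t_power (j + k) * f), Lambda_class s (t_power (- (j + k)) * g)))"
      by (metis diff_add_cancel)
    then show "p \<in> Gamma_class s f g \<longleftrightarrow> p \<in> Gamma_class s f' g'"
      unfolding Gamma_class_def by (simp add: L)
  qed
qed

lemma residue_sum_F_poly:
  assumes v: "gauss_diagram 2 D" and i: "i \<in> {1, 2}"
  shows "residue_sum s (F_poly D \<gamma>0 i j) r =
    (\<Sum>c | c \<in> chords_of_type D i j \<and> s dvd Ind_nonself D \<gamma>0 i j c - r. sg c)"
proof -
  let ?J = "J_nonself D \<gamma>0 i j" and ?I = "Ind_nonself D \<gamma>0 i j" and ?A = "chords_of_type D i j"
  let ?N = "?I ` ?A"
  have fin: "finite ?A" using v i by simp
  have sub: "{n. ?J n \<noteq> 0} \<subseteq> ?N"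
  proof
    fix n assume "n \<in> {n. ?J n \<noteq> 0}"
    then have "{c \<in> ?A. ?I c = n} \<noteq> {}" unfolding J_nonself_def by fastforce
    then show "n \<in> ?N" by auto
  qed
  have mon: "of_int v * t_power n = Poly_Mapping.single n v" for v n
  proof -
    have "of_int v = (Poly_Mapping.single 0 v :: laurent)"
      by (metis single_of_int of_int_eq_id id_apply)
    then show ?thesis unfolding single_eq_t_power[of n v] by simp
  qed
  have "residue_sum s (F_poly D \<gamma>0 i j) r = (\<Sum>n | ?J n \<noteq> 0. if s dvd n - r then ?J n else 0)"
    unfolding F_poly_def residue_sum_sum mon residue_sum_single ..
  also have "\<dots> = (\<Sum>n\<in>?N. if s dvd n - r then ?J n else 0)"
    using fin sub by (intro sum.mono_neutral_left) auto
  also have "\<dots> = (\<Sum>n\<in>?N. \<Sum>c\<in>{c\<in>?A. ?I c = n}. if s dvd ?I c - r then sg c else 0)"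
    unfolding J_nonself_def by (intro sum.cong refl) auto
  also have "\<dots> = (\<Sum>c\<in>?A. if s dvd ?I c - r then sg c else 0)"
    using fin by (intro sum.group) auto
  also have "\<dots> = (\<Sum>c | c \<in> ?A \<and> s dvd ?I c - r. sg c)"
    using fin by (simp add: sum.inter_filter)
  finally show ?thesis .
qed

text \<open>
  An arc ending at \<open>\<gamma>\<^sub>0\<close> followed by one starting there is a difference of heights plus a term
  depending only on \<open>\<gamma>\<^sub>0\<close>. The endpoints of \<open>\<gamma>\<^sub>0\<close> have opposite signs, and so the terms for the two
  types are negatives of each other.
\<close>

lemma Ind_nonself_cong:
  assumes v: "gauss_diagram 2 D" and \<gamma>0: "\<gamma>0 \<in> nonself_chords D"
  shows "\<exists>k. (\<forall>c\<in>chords_of_type D 1 2.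
      lambda_diagram D dvd Ind_nonself D \<gamma>0 1 2 c - lifted_index D (\<lambda>_. 0) c + k) \<and>
    (\<forall>c\<in>chords_of_type D 2 1.
      lambda_diagram D dvd Ind_nonself D \<gamma>0 2 1 c - lifted_index D (\<lambda>_. 0) c - k)"
proof -
  obtain w1 w2 where D: "D = [w1, w2]" and d: "distinct w1" "distinct w2" "set w1 \<inter> set w2 = {}"
    using v by (rule gauss2E)
  let ?l = "lambda_diagram D"
  have tot: "sign_sum w1 = - ?l" "sign_sum w2 = ?l" using sign_sum_circle[OF v] by (simp_all add: D)
  have arc: "?l dvd arc_sum w p q - (height w q - height w p - endpoint_sign p)"
    if "w = w1 \<or> w = w2" "p \<in> set w" "q \<in> set w" "p \<noteq> q" for w p q
    using arc_sum_eq[of w p q] that d tot by auto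
  define p1 where "p1 = endpoint_on D 1 \<gamma>0"
  define p2 where "p2 = endpoint_on D 2 \<gamma>0"
  have en: "endpoint_on [w1, w2] (Suc 0) \<gamma>0 = p1" "endpoint_on [w1, w2] 2 \<gamma>0 = p2"
    by (simp_all add: p1_def p2_def D)
  have \<gamma>: "Initial \<gamma>0 \<in> set w1 \<and> Terminal \<gamma>0 \<in> set w2 \<or> Initial \<gamma>0 \<in> set w2 \<and> Terminal \<gamma>0 \<in> set w1"
    using \<gamma>0 by (auto simp: nonself_chords_def chords_of_type_def D)
  have p: "p1 = Initial \<gamma>0 \<and> p2 = Terminal \<gamma>0 \<and> Initial \<gamma>0 \<in> set w1 \<or>
      p1 = Terminal \<gamma>0 \<and> p2 = Initial \<gamma>0 \<and> Initial \<gamma>0 \<in> set w2"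
    using \<gamma> d(3) by (auto simp: p1_def p2_def endpoint_on_def D)
  have pm: "p1 \<in> set w1" "p2 \<in> set w2" using p \<gamma> d(3) by auto
  have ps: "endpoint_sign p1 = - endpoint_sign p2" "chord_of p1 = \<gamma>0" "chord_of p2 = \<gamma>0" using p by auto
  \<comment> \<open>this is the lifted index of \<open>\<gamma>\<^sub>0\<close>, or its negative, up to a multiple of \<open>\<lambda>\<close>\<close>
  define k where "k = height w2 p2 + endpoint_sign p2 - height w1 p1"
  have li12: "lifted_index D (\<lambda>_. 0) c = sign_sum w1 + height w2 (Terminal c) - height w1 (Initial c) + sg c"
    if "Initial c \<in> set w1" "Terminal c \<in> set w2" for c
    using that d(3) by (auto simp: lifted_index_def D height_append)
  have li21: "lifted_index D (\<lambda>_. 0) c = height w1 (Terminal c) - (sign_sum w1 + height w2 (Initial c)) + sg c"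
    if "Initial c \<in> set w2" "Terminal c \<in> set w1" for c
    using that d(3) by (auto simp: lifted_index_def D height_append)
  have "?l dvd Ind_nonself D \<gamma>0 1 2 c - lifted_index D (\<lambda>_. 0) c + k"
    if c: "c \<in> chords_of_type D 1 2" for c
  proof -
    have m: "Initial c \<in> set w1" "Terminal c \<in> set w2" using c by (auto simp: chords_of_type_def D)
    show ?thesis
    proof (cases "c = \<gamma>0")
      case True
      then have "p1 = Initial c" "p2 = Terminal c" using p m d(3) by auto
      then show ?thesis using m tot by (simp add: Ind_nonself_def True li12 k_def)
    next
      case False
      then have ne: "Initial c \<noteq> p1" "p2 \<noteq> Terminal c" using ps by auto
      have "Ind_nonself D \<gamma>0 1 2 c - lifted_index D (\<lambda>_. 0) c + k =
        (arc_sum w1 (Initial c) p1 - (height w1 p1 - height w1 (Initial c) - endpoint_sign (Initial c))) +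
        (arc_sum w2 p2 (Terminal c) - (height w2 (Terminal c) - height w2 p2 - endpoint_sign p2)) + ?l"
        using False unfolding li12[OF m] tot by (simp add: Ind_nonself_def en k_def D)
      then show ?thesis using arc[of w1 "Initial c" p1] arc[of w2 p2 "Terminal c"] m pm ne
        by (metis dvd_add dvd_refl)
    qed
  qed
  moreover have "?l dvd Ind_nonself D \<gamma>0 2 1 c - lifted_index D (\<lambda>_. 0) c - k"
    if c: "c \<in> chords_of_type D 2 1" for c
  proof -
    have m: "Initial c \<in> set w2" "Terminal c \<in> set w1" using c by (auto simp: chords_of_type_def D)
    show ?thesis
    proof (cases "c = \<gamma>0")
      case True
      then have "p1 = Terminal c" "p2 = Initial c" using p m d(3) by auto
      then show ?thesis using m tot by (simp add: Ind_nonself_def True li21 k_def)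
    next
      case False
      then have ne: "Initial c \<noteq> p2" "p1 \<noteq> Terminal c" using ps by auto
      have "Ind_nonself D \<gamma>0 2 1 c - lifted_index D (\<lambda>_. 0) c - k =
        (arc_sum w2 (Initial c) p2 - (height w2 p2 - height w2 (Initial c) - endpoint_sign (Initial c))) +
        (arc_sum w1 p1 (Terminal c) - (height w1 (Terminal c) - height w1 p1 - endpoint_sign p1)) - ?l"
        using False ps(1) unfolding li21[OF m] tot
        by (simp add: Ind_nonself_def en k_def D)
      then show ?thesis using arc[of w2 "Initial c" p2] arc[of w1 p1 "Terminal c"] m pm ne
        by (metis dvd_add dvd_diff dvd_refl)
    qed
  qed
  ultimately show ?thesis by blast
qed

lemma residue_sum_F_poly_shift:
  assumes v: "gauss_diagram 2 D" and \<gamma>0: "\<gamma>0 \<in> nonself_chords D"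
  obtains k where
    "\<And>r. residue_sum (lambda_diagram D) (F_poly D \<gamma>0 1 2) r = residue_writhe D (\<lambda>_. 0) 1 2 (r + k)"
    "\<And>r. residue_sum (lambda_diagram D) (F_poly D \<gamma>0 2 1) r = residue_writhe D (\<lambda>_. 0) 2 1 (r - k)"
proof -
  let ?l = "lambda_diagram D" and ?x = "lifted_index D (\<lambda>_. 0)"
  obtain k where k: "\<And>c. c \<in> chords_of_type D 1 2 \<Longrightarrow> ?l dvd Ind_nonself D \<gamma>0 1 2 c - ?x c + k"
    "\<And>c. c \<in> chords_of_type D 2 1 \<Longrightarrow> ?l dvd Ind_nonself D \<gamma>0 2 1 c - ?x c - k"
    using Ind_nonself_cong[OF assms] by blast
  have *: "?l dvd a - r \<longleftrightarrow> ?l dvd b - (r + j)" if "?l dvd a - b + j" for a b r j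
  proof -
    have "a - r = (a - b + j) + (b - (r + j))" by simp
    then show ?thesis using that by (metis dvd_add_right_iff)
  qed
  have **: "(\<Sum>c | c \<in> chords_of_type D i j \<and> P c. sg c) = (\<Sum>c | c \<in> chords_of_type D i j \<and> Q c. sg c)"
    if "\<And>c. c \<in> chords_of_type D i j \<Longrightarrow> P c \<longleftrightarrow> Q c" for i j P Q
    by (rule sum.cong) (use that in auto)
  have i: "1 \<in> {1, 2 :: nat}" "2 \<in> {1, 2 :: nat}" by auto
  have "residue_sum ?l (F_poly D \<gamma>0 1 2) r = residue_writhe D (\<lambda>_. 0) 1 2 (r + k)" for r
    unfolding residue_sum_F_poly[OF v i(1)] residue_writhe_def
    by (rule **) (rule *, rule k)
  moreover have "residue_sum ?l (F_poly D \<gamma>0 2 1) r = residue_writhe D (\<lambda>_. 0) 2 1 (r - k)" for r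
    unfolding residue_sum_F_poly[OF v i(2)] residue_writhe_def
  proof (rule **)
    fix c assume "c \<in> chords_of_type D 2 1"
    then show "?l dvd Ind_nonself D \<gamma>0 2 1 c - r \<longleftrightarrow> ?l dvd ?x c - (r - k)"
      using *[of "Ind_nonself D \<gamma>0 2 1 c" "?x c" "- k" r] k(2) by simp
  qed
  ultimately show thesis by (rule that)
qed

text \<open>
  Both the dependence on the reference chord and the choice of representatives of a class in
  \<open>\<Gamma>(\<lambda>)\<close> are shifts of the same kind.
\<close>

theorem F_diagram_eq_iff:
  assumes v: "gauss_diagram 2 D" and v': "gauss_diagram 2 D'"
    and \<gamma>: "\<gamma> \<in> nonself_chords D" and \<gamma>': "\<gamma>' \<in> nonself_chords D'"
    and l: "lambda_diagram D' = lambda_diagram D" "0 < lambda_diagram D"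
  shows "F_diagram D \<gamma> = F_diagram D' \<gamma>' \<longleftrightarrow> shift_agree D (\<lambda>_. 0) D' (\<lambda>_. 0)"
proof -
  let ?A = "residue_writhe D (\<lambda>_. 0)" and ?B = "residue_writhe D' (\<lambda>_. 0)"
  obtain k where k: "\<And>r. residue_sum (lambda_diagram D) (F_poly D \<gamma> 1 2) r = ?A 1 2 (r + k)"
    "\<And>r. residue_sum (lambda_diagram D) (F_poly D \<gamma> 2 1) r = ?A 2 1 (r - k)"
    using residue_sum_F_poly_shift[OF v \<gamma>] by blast
  obtain k' where k': "\<And>r. residue_sum (lambda_diagram D) (F_poly D' \<gamma>' 1 2) r = ?B 1 2 (r + k')"
    "\<And>r. residue_sum (lambda_diagram D) (F_poly D' \<gamma>' 2 1) r = ?B 2 1 (r - k')"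
    using residue_sum_F_poly_shift[OF v' \<gamma>'] unfolding l(1) by blast
  have "F_diagram D \<gamma> = F_diagram D' \<gamma>' \<longleftrightarrow> (\<exists>j. \<forall>r. ?B 1 2 (r + k') = ?A 1 2 (r - j + k) \<and>
      ?B 2 1 (r - k') = ?A 2 1 (r + j - k))"
    unfolding F_diagram_def l(1) using l(2) Gamma_class_eq_iff[of "nat (lambda_diagram D)"] k k' by simp
  also have "\<dots> \<longleftrightarrow> (\<exists>j. \<forall>r. ?B 1 2 r = ?A 1 2 (r - j) \<and> ?B 2 1 r = ?A 2 1 (r + j))"
  proof
    assume "\<exists>j. \<forall>r. ?B 1 2 (r + k') = ?A 1 2 (r - j + k) \<and> ?B 2 1 (r - k') = ?A 2 1 (r + j - k)"
    then obtain j where j: "\<And>r. ?B 1 2 (r + k') = ?A 1 2 (r - j + k)" "\<And>r. ?B 2 1 (r - k') = ?A 2 1 (r + j - k)"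
      by blast
    have "?B 1 2 r = ?A 1 2 (r - (k' + j - k)) \<and> ?B 2 1 r = ?A 2 1 (r + (k' + j - k))" for r
      using j(1)[of "r - k'"] j(2)[of "r + k'"] by (simp add: algebra_simps)
    then show "\<exists>j. \<forall>r. ?B 1 2 r = ?A 1 2 (r - j) \<and> ?B 2 1 r = ?A 2 1 (r + j)" by blast
  next
    assume "\<exists>j. \<forall>r. ?B 1 2 r = ?A 1 2 (r - j) \<and> ?B 2 1 r = ?A 2 1 (r + j)"
    then obtain j where j: "\<And>r. ?B 1 2 r = ?A 1 2 (r - j)" "\<And>r. ?B 2 1 r = ?A 2 1 (r + j)" by blast
    have "?B 1 2 (r + k') = ?A 1 2 (r - (j + k - k') + k) \<and> ?B 2 1 (r - k') = ?A 2 1 (r + (j + k - k') - k)" for r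
      unfolding j by (simp add: algebra_simps)
    then show "\<exists>j. \<forall>r. ?B 1 2 (r + k') = ?A 1 2 (r - j + k) \<and> ?B 2 1 (r - k') = ?A 2 1 (r + j - k)" by blast
  qed
  finally show ?thesis unfolding shift_agree_def .
qed

section \<open>Inserting shells\<close>

text \<open>
  Chords of the underlying diagram get even labels, and shells get odd ones.
\<close>

definition lift_chord :: "chord \<Rightarrow> chord" where
  "lift_chord c = Chord (2 * label c) (positive c)"

abbreviation lift :: "chord endpoint \<Rightarrow> chord endpoint" where
  "lift \<equiv> map_endpoint lift_chord"

text \<open>
  Shells are named by the endpoint that they surround and their depth; the code makes this
  naming injective.
\<close>

fun endpoint_code :: "chord endpoint \<Rightarrow> nat" where
  "endpoint_code (Initial c) = 4 * label c + (if positive c then 1 else 0)"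
| "endpoint_code (Terminal c) = 4 * label c + (if positive c then 3 else 2)"

definition shell_chord :: "chord endpoint \<Rightarrow> nat \<Rightarrow> bool \<Rightarrow> chord" where
  "shell_chord p i b = Chord (2 * prod_encode (endpoint_code p, i) + 1) b"

lemma lift_chord_inject [simp]: "lift_chord c = lift_chord d \<longleftrightarrow> c = d"
  by (cases c; cases d) (simp add: lift_chord_def)

lemma sg_lift_chord [simp]: "sg (lift_chord c) = sg c"
  by (simp add: chord_sign_def lift_chord_def)

lemma endpoint_sign_lift [simp]: "endpoint_sign (lift e) = endpoint_sign e"
  by (cases e) auto

lemma chord_of_lift [simp]: "chord_of (lift e) = lift_chord (chord_of e)"
  by (cases e) auto

lemma lift_inject [simp]: "lift e = lift e' \<longleftrightarrow> e = e'"
  by (cases e; cases e') auto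

lemma endpoint_code_inject: "endpoint_code p = endpoint_code q \<longleftrightarrow> p = q"
proof
  assume "endpoint_code p = endpoint_code q"
  then have "endpoint_code p div 4 = endpoint_code q div 4" "endpoint_code p mod 4 = endpoint_code q mod 4"
    by simp_all
  then show "p = q"
    by (cases p; cases q; cases "chord_of p"; cases "chord_of q") (auto split: if_splits)
qed simp

lemma shell_chord_inject [simp]: "shell_chord p i b = shell_chord q j b' \<longleftrightarrow> p = q \<and> i = j \<and> b = b'"
  by (auto simp: shell_chord_def endpoint_code_inject)

lemma lift_neq_shell [simp]: "lift_chord c \<noteq> shell_chord p i b" "shell_chord p i b \<noteq> lift_chord c"
  unfolding lift_chord_def shell_chord_def chord.inject by presburger+

lemma sg_shell_chord [simp]: "sg (shell_chord p i b) = (if b then 1 else -1)"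
  by (simp add: chord_sign_def shell_chord_def)

text \<open>
  The first shell of the list is the outermost one.
\<close>

definition surround :: "chord list \<Rightarrow> chord endpoint \<Rightarrow> chord endpoint list" where
  "surround S p = (if endpoint_sign p = 1
     then map Initial S @ [p] @ rev (map Terminal S) else map Terminal S @ [p] @ rev (map Initial S))"

text \<open>
  The shells are counted with sign, and all shells at one endpoint have the same sign.
\<close>

definition shells :: "(chord endpoint \<Rightarrow> int) \<Rightarrow> chord endpoint \<Rightarrow> chord list" where
  "shells \<mu> e = map (\<lambda>i. shell_chord e i (0 < \<mu> e)) [0..<nat \<bar>\<mu> e\<bar>]"

definition expand_word :: "(chord endpoint \<Rightarrow> int) \<Rightarrow> chord endpoint list \<Rightarrow> chord endpoint list" where
  "expand_word \<mu> w = concat (map (\<lambda>e. surround (shells \<mu> e) (lift e)) w)"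

definition expand :: "(chord endpoint \<Rightarrow> int) \<Rightarrow> gauss \<Rightarrow> gauss" where
  "expand \<mu> D = map (expand_word \<mu>) D"

definition insert_shell :: "chord \<Rightarrow> chord endpoint \<Rightarrow> gauss \<Rightarrow> gauss" where
  "insert_shell s p D = map (\<lambda>w. concat (map (\<lambda>e. if e = p then surround [s] p else [e]) w)) D"

lemma surround_Nil [simp]: "surround [] p = [p]"
  by (simp add: surround_def)

lemma set_surround: "set (surround S p) = insert p (Initial ` set S \<union> Terminal ` set S)"
  by (auto simp: surround_def)

lemma shells_zero: "\<mu> e = 0 \<Longrightarrow> shells \<mu> e = []"
  by (simp add: shells_def)

lemma expand_word_simps [simp]:
  "expand_word \<mu> [] = []"
  "expand_word \<mu> (e # w) = surround (shells \<mu> e) (lift e) @ expand_word \<mu> w"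
  "expand_word \<mu> (v @ w) = expand_word \<mu> v @ expand_word \<mu> w"
  by (simp_all add: expand_word_def)

lemma concat_expand: "concat (expand \<mu> D) = expand_word \<mu> (concat D)"
  unfolding expand_def by (induction D) auto

lemma expand_cong:
  assumes "\<And>e. e \<in> set (concat D) \<Longrightarrow> \<mu> e = \<mu>' e"
  shows "expand \<mu> D = expand \<mu>' D"
  unfolding expand_def expand_word_def
proof (intro map_cong refl arg_cong[where f = concat])
  fix w e assume "w \<in> set D" "e \<in> set w"
  then have "\<mu> e = \<mu>' e" using assms by auto
  then show "surround (shells \<mu> e) (lift e) = surround (shells \<mu>' e) (lift e)"
    by (simp add: shells_def)
qed

lemma concat_map_single: "(\<And>x. x \<in> set l \<Longrightarrow> g x = [x]) \<Longrightarrow> concat (map g l) = l"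
  by (induction l) auto

text \<open>
  The shell list starts with the outermost shell, so adding a last element to it is the insertion
  of an innermost shell.
\<close>

lemma insert_shell_expand:
  assumes "shells \<mu>' p = shells \<mu> p @ [s]" "\<And>e. e \<noteq> p \<Longrightarrow> \<mu>' e = \<mu> e"
  shows "expand \<mu>' D = insert_shell s (lift p) (expand \<mu> D)"
proof -
  define g where "g = (\<lambda>e. if e = lift p then surround [s] (lift p) else [e])"
  have g1: "g x = [x]" if "x \<in> Initial ` set (shells \<mu> e) \<union> Terminal ` set (shells \<mu> e)" for x e
  proof -
    have "chord_of x \<noteq> chord_of (lift p)" using that by (auto simp: shells_def)
    then show ?thesis by (auto simp: g_def)
  qed
  have "concat (map g (surround (shells \<mu> e) (lift e))) = surround (shells \<mu>' e) (lift e)" for e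
  proof (cases "e = p")
    case False
    then have "concat (map g (surround (shells \<mu> e) (lift e))) = surround (shells \<mu> e) (lift e)"
    proof (intro concat_map_single)
      fix x assume "x \<in> set (surround (shells \<mu> e) (lift e))"
      then have "x = lift e \<or> x \<in> Initial ` set (shells \<mu> e) \<union> Terminal ` set (shells \<mu> e)"
        unfolding set_surround by blast
      then show "g x = [x]"
      proof
        assume "x = lift e"
        then show ?thesis using False by (simp add: g_def)
      qed (rule g1)
    qed
    moreover have "shells \<mu>' e = shells \<mu> e" using assms(2)[OF False] by (simp add: shells_def)
    ultimately show ?thesis by simp
  next
    case True
    have a: "concat (map g (map Initial (shells \<mu> p))) = map Initial (shells \<mu> p)"
      "concat (map g (map Terminal (shells \<mu> p))) = map Terminal (shells \<mu> p)"
      "concat (map g (rev (map Initial (shells \<mu> p)))) = rev (map Initial (shells \<mu> p))"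
      "concat (map g (rev (map Terminal (shells \<mu> p)))) = rev (map Terminal (shells \<mu> p))"
      by (rule concat_map_single, rule g1[of _ p], simp)+
    have b: "g (lift p) = surround [s] (lift p)" by (simp add: g_def)
    show ?thesis
    proof (cases "endpoint_sign p = 1")
      case sp: True
      have "surround (shells \<mu> p) (lift p) =
          map Initial (shells \<mu> p) @ [lift p] @ rev (map Terminal (shells \<mu> p))"
        using sp by (simp add: surround_def)
      then show ?thesis unfolding True assms(1) using sp
        by (simp only: map_append concat_append a list.map concat.simps b) (simp add: surround_def)
    next
      case sp: False
      have "surround (shells \<mu> p) (lift p) =
          map Terminal (shells \<mu> p) @ [lift p] @ rev (map Initial (shells \<mu> p))"
        using sp by (simp add: surround_def)
      then show ?thesis unfolding True assms(1) using sp
        by (simp only: map_append concat_append a list.map concat.simps b) (simp add: surround_def)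
    qed
  qed
  then have "concat (map g (expand_word \<mu> w)) = expand_word \<mu>' w" for w
    by (induction w) auto
  then show ?thesis unfolding expand_def insert_shell_def g_def[symmetric] by simp
qed

lemma shells_grow:
  "0 \<le> \<mu> p \<Longrightarrow> shells (\<mu>(p := \<mu> p + 1)) p = shells \<mu> p @ [shell_chord p (nat (\<mu> p)) True]"
  "\<mu> p \<le> 0 \<Longrightarrow> shells (\<mu>(p := \<mu> p - 1)) p = shells \<mu> p @ [shell_chord p (nat (- \<mu> p)) False]"
proof -
  show "shells (\<mu>(p := \<mu> p + 1)) p = shells \<mu> p @ [shell_chord p (nat (\<mu> p)) True]" if "0 \<le> \<mu> p"
  proof (cases "\<mu> p = 0")
    case False
    then show ?thesis using that by (simp add: shells_def nat_add_distrib)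
  qed (simp add: shells_def)
  show "shells (\<mu>(p := \<mu> p - 1)) p = shells \<mu> p @ [shell_chord p (nat (- \<mu> p)) False]" if "\<mu> p \<le> 0"
  proof -
    have n: "nat \<bar>\<mu> p - 1\<bar> = Suc (nat \<bar>\<mu> p\<bar>)" "nat (- \<mu> p) = nat \<bar>\<mu> p\<bar>"
      using that by auto
    have b: "(0 < \<mu> p - 1) = False" "(0 < \<mu> p) = False" using that by auto
    show ?thesis unfolding shells_def fun_upd_same n b by simp
  qed
qed

lemmas expand_grow =
  insert_shell_expand[OF shells_grow(1)] insert_shell_expand[OF shells_grow(2)]

lemma insert_shell_split:
  assumes "gauss_diagram n D" "p \<in> set (concat D)"
  obtains Ds1 a b Ds2 where "D = Ds1 @ (a @ p # b) # Ds2"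
    "\<And>s. insert_shell s p D = Ds1 @ (a @ surround [s] p @ b) # Ds2"
proof -
  obtain w where w: "w \<in> set D" "p \<in> set w" using assms(2) by auto
  obtain Ds1 Ds2 where D: "D = Ds1 @ w # Ds2" using split_list[OF w(1)] by blast
  obtain a b where w': "w = a @ p # b" using split_list[OF w(2)] by blast
  have d: "distinct (concat D)" using assms(1) by (simp add: gauss_diagram_def)
  have *: "concat (map (\<lambda>e. if e = p then surround [s] p else [e]) v) = v" if "p \<notin> set v" for v s
    by (rule concat_map_single) (use that in auto)
  have "\<forall>v\<in>set Ds1 \<union> set Ds2. p \<notin> set v" "p \<notin> set a" "p \<notin> set b" using d unfolding D w' by auto
  then have "insert_shell s p D = Ds1 @ (a @ surround [s] p @ b) # Ds2" for s
    using * by (auto simp: insert_shell_def D w' intro!: map_idI)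
  then show thesis using that D w' by blast
qed

lemma insert_shell_props:
  assumes v: "gauss_diagram n D" and p: "p \<in> set (concat D)" and s: "s \<notin> chords D"
  shows "gauss_diagram n (insert_shell s p D)" "delete_chords {s} (insert_shell s p D) = D"
    "shell (insert_shell s p D) s p" "chords (insert_shell s p D) = insert s (chords D)"
proof -
  obtain Ds1 a b Ds2 where D: "D = Ds1 @ (a @ p # b) # Ds2"
    and I: "insert_shell s p D = Ds1 @ (a @ surround [s] p @ b) # Ds2"
    using insert_shell_split[OF v p] by metis
  have ns: "Initial s \<notin> set (concat D)" "Terminal s \<notin> set (concat D)" using s chords_iff[OF v] by auto
  have sc: "set (concat (insert_shell s p D)) = insert (Initial s) (insert (Terminal s) (set (concat D)))"
    unfolding I by (auto simp: D set_surround)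
  have "distinct (concat (insert_shell s p D))"
    using v ns unfolding I unfolding D gauss_diagram_def by (auto simp: surround_def)
  then show "gauss_diagram n (insert_shell s p D)"
    using v sc unfolding gauss_diagram_def by (auto simp: insert_shell_def simp del: set_concat)
  show "chords (insert_shell s p D) = insert s (chords D)"
    unfolding chords_def sc by auto
  have ps: "chord_of p \<noteq> s" using p s chord_of_in_chords by blast
  have "filter (\<lambda>e. chord_of e \<notin> {s}) v = v" if "set v \<subseteq> set (concat D)" for v
    using that s chord_of_in_chords by (intro filter_True) blast
  moreover have "v \<in> set Ds1 \<union> set Ds2 \<union> {a, b} \<Longrightarrow> set v \<subseteq> set (concat D)" for v
    unfolding D by auto
  ultimately have "filter (\<lambda>e. chord_of e \<notin> {s}) v = v" if "v \<in> set Ds1 \<union> set Ds2 \<union> {a, b}" for v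
    using that by blast
  then show "delete_chords {s} (insert_shell s p D) = D"
    unfolding delete_chords_def I unfolding D using ps by (auto simp: surround_def intro!: map_idI)
  have "next_in (insert_shell s p D) x y" if "next_to (surround [s] p) x y" for x y
    unfolding I next_in_def using that by (auto simp: next_to_append)
  then show "shell (insert_shell s p D) s p"
    unfolding shell_def using ps by (auto intro!: next_in_followed_by simp: surround_def)
qed

abbreviation RS_equiv :: "gauss \<Rightarrow> gauss \<Rightarrow> bool" where
  "RS_equiv \<equiv> equivclp (RS_step 2)"

lemma RS_equiv_refl: "RS_equiv D D" by simp

lemma RS_equiv_sym: "RS_equiv D D' \<Longrightarrow> RS_equiv D' D"
  by (rule equivclp_sym)

lemma RS_equiv_trans [trans]: "RS_equiv D D' \<Longrightarrow> RS_equiv D' D'' \<Longrightarrow> RS_equiv D D''"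
  by (rule equivclp_trans)

lemma RS_equiv_step: "RS_step 2 D D' \<Longrightarrow> RS_equiv D D'"
  by (rule r_into_equivclp)

text \<open>
  This is S1 from the point of view of the diagram without the shell.
\<close>

lemma RS_equiv_move_shell:
  assumes v: "gauss_diagram 2 D" and s: "s \<notin> chords D" and c: "c \<in> chords D"
    and pq: "{p, q} = {Initial c, Terminal c}"
  shows "RS_equiv (insert_shell s p D) (insert_shell s q D)"
proof -
  have "p \<in> set (concat D)" "q \<in> set (concat D)"
    using c chords_iff[OF v, of c] pq by (auto simp: doubleton_eq_iff)
  note P = insert_shell_props[OF v this(1) s] insert_shell_props[OF v this(2) s]
  have "S1 (insert_shell s p D) (insert_shell s q D)"
    unfolding S1_def delete_chord_eq using P pq by metis
  then show ?thesis using P by (intro RS_equiv_step) (simp add: RS_step_def)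
qed

text \<open>
  Parallel shells of opposite signs form a pair that R2 deletes.
\<close>

lemma RS_equiv_cancel_shells:
  assumes v: "gauss_diagram 2 D" and s: "s \<notin> chords D" "t \<notin> chords D" and p: "p \<in> set (concat D)"
    and st: "sg s = - sg t"
  shows "RS_equiv (insert_shell s p (insert_shell t p D)) D"
proof -
  let ?D = "insert_shell s p (insert_shell t p D)"
  note P1 = insert_shell_props[OF v p s(2)]
  have ne: "s \<noteq> t" using st by auto
  have p1: "p \<in> set (concat (insert_shell t p D))"
    using p P1(4) in_concat_iff_chord[OF P1(1), of p] in_concat_iff_chord[OF v, of p] by simp
  have s1: "s \<notin> chords (insert_shell t p D)" using P1(4) s ne by simp
  note P2 = insert_shell_props[OF P1(1) p1 s1]
  have pc: "chord_of p \<in> chords D" using p chord_of_in_chords by blast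
  have K: "delete_chords {s} (delete_chords {t} ?D) = D"
    using P1(2) P2(2) delete_chords_delete_chords[of "{t}" "{s}" ?D] delete_chords_delete_chords[of "{s}" "{t}" ?D] by (simp add: insert_commute)
  obtain Ds1 a b Ds2 where D: "D = Ds1 @ (a @ p # b) # Ds2"
    and I: "insert_shell t p D = Ds1 @ (a @ surround [t] p @ b) # Ds2"
    using insert_shell_split[OF v p] by metis
  have "?D = Ds1 @ (a @ surround [t, s] p @ b) # Ds2"
  proof -
    have pn: "p \<notin> set a" "p \<notin> set b" "\<forall>v\<in>set Ds1 \<union> set Ds2. p \<notin> set v"
      "Initial t \<noteq> p" "Terminal t \<noteq> p"
      using distinct_concat_gauss[OF v] pc s unfolding D by auto
    have *: "concat (map (\<lambda>e. if e = p then surround [s] p else [e]) v) = v" if "p \<notin> set v" for v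
      by (rule concat_map_single) (use that in auto)
    show ?thesis using pn * unfolding I
      by (auto simp: insert_shell_def surround_def intro!: map_idI)
  qed
  then have "next_in ?D x y" if "next_to (surround [t, s] p) x y" for x y
    using that by (auto simp: next_in_def next_to_append)
  then have "next_in ?D (Initial t) (Initial s) \<and> next_in ?D (Terminal s) (Terminal t) \<or>
      next_in ?D (Terminal t) (Terminal s) \<and> next_in ?D (Initial s) (Initial t)"
    by (cases "endpoint_sign p = 1") (auto simp: surround_def)
  then have "adjacent ?D (Initial s) (Initial t)" "adjacent ?D (Terminal s) (Terminal t)"
    unfolding adjacent_def using next_in_followed_by by blast+
  moreover have "sg t = - sg s" using st by simp
  ultimately have "R2 ?D D"
    unfolding R2_def delete_chord_eq using K by metis
  then show ?thesis using P2(1) v by (intro RS_equiv_step) (simp add: RS_step_def)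
qed

lemma RS_equiv_same_diagram: "gauss_diagram 2 D \<Longrightarrow> gauss_diagram 2 D' \<Longrightarrow> same_diagram D D' \<Longrightarrow> RS_equiv D D'"
  by (rule RS_equiv_step) (simp add: RS_step_def)

lemma rename_id:
  assumes "\<And>c. c \<in> chords D \<Longrightarrow> f c = c"
  shows "rename f D = D"
proof -
  have "map_endpoint f e = e" if "e \<in> set (concat D)" for e
    using assms[OF chord_of_in_chords[OF that]] by (cases e rule: endpoint.exhaust) auto
  then show ?thesis unfolding rename_def by (intro map_idI) auto
qed

lemma rotated_refl: "rotated D D"
  unfolding rotated_def by (rule list.rel_refl) (metis rotate0 id_apply)

lemma RS_equiv_rotated:
  assumes "gauss_diagram 2 D" "rotated D D'"
  shows "RS_equiv D D'"
proof (rule RS_equiv_same_diagram[OF assms(1) rotated_gauss_diagram[OF assms(2,1)]])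
  show "same_diagram D D'"
    unfolding same_diagram_iff using assms(2) rename_id[of D id] by (intro exI[of _ id]) auto
qed

lemma RS_equiv_rename_shell:
  assumes v: "gauss_diagram 2 D" and s: "s \<notin> chords D" "t \<notin> chords D" and p: "p \<in> set (concat D)"
    and st: "sg s = sg t"
  shows "RS_equiv (insert_shell s p D) (insert_shell t p D)"
proof (rule RS_equiv_same_diagram)
  note P = insert_shell_props[OF v p s(1)] insert_shell_props[OF v p s(2)]
  show "gauss_diagram 2 (insert_shell s p D)" "gauss_diagram 2 (insert_shell t p D)"
    using P by auto
  let ?f = "id(s := t)"
  have pc: "chord_of p \<noteq> s" using p s chord_of_in_chords by blast
  obtain Ds1 a b Ds2 where D: "D = Ds1 @ (a @ p # b) # Ds2"
    and I: "\<And>s. insert_shell s p D = Ds1 @ (a @ surround [s] p @ b) # Ds2"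
    using insert_shell_split[OF v p] by metis
  have "rename ?f D = D" by (rule rename_id) (use s in auto)
  then have "rename ?f (insert_shell s p D) = insert_shell t p D"
    unfolding I unfolding D using pc by (cases p) (auto simp: rename_def surround_def chord_sign_def)
  moreover have "positive t = positive s" using st by (auto simp: chord_sign_def split: if_splits)
  moreover have "inj_on ?f (chords (insert_shell s p D))" using P s by (auto simp: inj_on_def)
  ultimately show "same_diagram (insert_shell s p D) (insert_shell t p D)"
    unfolding same_diagram_iff using rotated_refl by (intro exI[of _ ?f]) auto
qed

section \<open>Weights realized by shells\<close>

lemma expand_zero: "(\<And>e. e \<in> set (concat D) \<Longrightarrow> \<mu> e = 0) \<Longrightarrow> expand \<mu> D = rename lift_chord D"
  unfolding expand_def rename_def
proof (rule map_cong[OF refl])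
  fix w assume "w \<in> set D" and z: "\<And>e. e \<in> set (concat D) \<Longrightarrow> \<mu> e = 0"
  then have "\<And>e. e \<in> set w \<Longrightarrow> \<mu> e = 0" by auto
  then show "expand_word \<mu> w = map lift w" by (induction w) (auto simp: shells_zero)
qed

lemma chords_expand:
  "chords (expand \<mu> D) \<subseteq> lift_chord ` chords D \<union>
     {shell_chord q i (0 < \<mu> q) | q i. q \<in> set (concat D) \<and> i < nat \<bar>\<mu> q\<bar>}"
proof -
  have "chord_of ` set (expand_word \<mu> w) \<subseteq> lift_chord ` chord_of ` set w \<union>
     {shell_chord q i (0 < \<mu> q) | q i. q \<in> set w \<and> i < nat \<bar>\<mu> q\<bar>}" for w
    by (induction w) (auto simp: set_surround shells_def)
  then show ?thesis unfolding chords_def concat_expand by blast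
qed

lemma lift_in_expand: "p \<in> set (concat D) \<Longrightarrow> lift p \<in> set (concat (expand \<mu> D))"
proof -
  have "p \<in> set w \<Longrightarrow> lift p \<in> set (expand_word \<mu> w)" for w
    by (induction w) (auto simp: set_surround)
  then show "p \<in> set (concat D) \<Longrightarrow> lift p \<in> set (concat (expand \<mu> D))"
    unfolding concat_expand by blast
qed

lemma fresh_shell:
  assumes "i \<ge> nat \<bar>\<mu> p\<bar>"
  shows "shell_chord p i b \<notin> chords (expand \<mu> D)"
  using chords_expand[of \<mu> D] assms by fastforce

lemma gauss_diagram_rename:
  assumes v: "gauss_diagram n D" and f: "inj f"
  shows "gauss_diagram n (rename f D)"
proof -
  let ?g = "map_endpoint f"
  have cc: "concat (rename f D) = map ?g (concat D)" by (simp add: rename_def map_concat)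
  have "distinct (map ?g (concat D))"
    using distinct_concat_gauss[OF v] endpoint.inj_map[OF f] unfolding distinct_map
    by (blast intro: inj_on_subset)
  moreover have i: "Initial c = ?g e \<longleftrightarrow> (\<exists>d. c = f d \<and> e = Initial d)"
    "Terminal c = ?g e \<longleftrightarrow> (\<exists>d. c = f d \<and> e = Terminal d)" for c e
    by (cases e; auto)+
  have "Initial c \<in> set (map ?g (concat D)) \<longleftrightarrow> Terminal c \<in> set (map ?g (concat D))" for c
    unfolding set_map image_iff Bex_def i using v unfolding gauss_diagram_def by blast
  ultimately show ?thesis using v unfolding gauss_diagram_def cc by (simp add: rename_def)
qed

lemma gauss_diagram_lift: "gauss_diagram n D \<Longrightarrow> gauss_diagram n (rename lift_chord D)"
  by (rule gauss_diagram_rename) (simp_all add: inj_def)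

lemma expand_shrink:
  assumes "\<mu> p \<noteq> 0"
  obtains \<mu>0 b where "\<mu>0 = \<mu>(p := \<mu> p - (if b then 1 else -1))" "b \<longleftrightarrow> 0 < \<mu> p"
    "nat \<bar>\<mu>0 p\<bar> < nat \<bar>\<mu> p\<bar>"
    "\<And>D. expand \<mu> D = insert_shell (shell_chord p (nat \<bar>\<mu>0 p\<bar>) b) (lift p) (expand \<mu>0 D)"
proof (cases "0 < \<mu> p")
  case True
  let ?\<mu> = "\<mu>(p := \<mu> p - 1)"
  have "?\<mu>(p := ?\<mu> p + 1) = \<mu>" by simp
  moreover have "nat (?\<mu> p) = nat \<bar>?\<mu> p\<bar>" using True by simp
  ultimately have "expand \<mu> D = insert_shell (shell_chord p (nat \<bar>?\<mu> p\<bar>) True) (lift p) (expand ?\<mu> D)" for D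
    using expand_grow(1)[of ?\<mu> p D] True by simp
  then show thesis using that[of ?\<mu> True] True by auto
next
  case False
  let ?\<mu> = "\<mu>(p := \<mu> p + 1)"
  have "?\<mu>(p := ?\<mu> p - 1) = \<mu>" by simp
  moreover have "nat (- ?\<mu> p) = nat \<bar>?\<mu> p\<bar>" using False assms by simp
  ultimately have "expand \<mu> D = insert_shell (shell_chord p (nat \<bar>?\<mu> p\<bar>) False) (lift p) (expand ?\<mu> D)" for D
    using expand_grow(2)[of ?\<mu> p D] False assms by simp
  then show thesis using that[of ?\<mu> False] False assms by auto
qed

text \<open>
  Induction on the number of shells, inserting one shell at a time.
\<close>

lemma gauss_diagram_expand:
  assumes v: "gauss_diagram n D"
  shows "gauss_diagram n (expand \<mu> D)"
proof (induction "\<Sum>e\<in>set (concat D). nat \<bar>\<mu> e\<bar>" arbitrary: \<mu> rule: less_induct)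
  case less
  show ?case
  proof (cases "\<exists>p\<in>set (concat D). \<mu> p \<noteq> 0")
    case False
    then have "expand \<mu> D = rename lift_chord D" by (intro expand_zero) blast
    then show ?thesis using gauss_diagram_lift[OF v] by simp
  next
    case True
    then obtain p where p: "p \<in> set (concat D)" "\<mu> p \<noteq> 0" by blast
    obtain \<mu>0 b where m: "\<mu>0 = \<mu>(p := \<mu> p - (if b then 1 else -1))" "nat \<bar>\<mu>0 p\<bar> < nat \<bar>\<mu> p\<bar>"
      "\<And>D. expand \<mu> D = insert_shell (shell_chord p (nat \<bar>\<mu>0 p\<bar>) b) (lift p) (expand \<mu>0 D)"
      using expand_shrink[of \<mu> p, OF p(2)] by metis
    have "(\<Sum>e\<in>set (concat D). nat \<bar>\<mu>0 e\<bar>) < (\<Sum>e\<in>set (concat D). nat \<bar>\<mu> e\<bar>)"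
      by (rule sum_strict_mono_ex1) (use p(1) m(2) in \<open>auto simp: m(1)\<close>)
    then have "gauss_diagram n (expand \<mu>0 D)" by (rule less)
    then show ?thesis unfolding m(3)
      by (rule insert_shell_props(1)) (simp_all only: lift_in_expand[OF p(1)] fresh_shell not_False_eq_True order_refl)
  qed
qed

text \<open>
  A new innermost shell extends the shells that are present if the signs agree, and cancels the
  innermost one of them otherwise.
\<close>

lemma RS_equiv_absorb_shell:
  assumes v: "gauss_diagram 2 D" and p: "p \<in> set (concat D)" and s: "s \<notin> chords (expand \<mu> D)"
  shows "RS_equiv (insert_shell s (lift p) (expand \<mu> D)) (expand (\<mu>(p := \<mu> p + sg s)) D)"
proof -
  have ve: "gauss_diagram 2 (expand \<mu> D)" for \<mu> by (rule gauss_diagram_expand[OF v])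
  note pe = lift_in_expand[OF p]
  consider "sg s = 1" "0 \<le> \<mu> p" | "sg s = -1" "\<mu> p \<le> 0" | "sg s = 1" "\<mu> p < 0" | "sg s = -1" "0 < \<mu> p"
    using sg_cases[of s] by linarith
  then show ?thesis
  proof cases
    case 1
    then have "expand (\<mu>(p := \<mu> p + 1)) D = insert_shell (shell_chord p (nat (\<mu> p)) True) (lift p) (expand \<mu> D)"
      by (intro expand_grow(1)) auto
    moreover have "shell_chord p (nat (\<mu> p)) True \<notin> chords (expand \<mu> D)"
      by (rule fresh_shell) (use 1 in auto)
    ultimately show ?thesis using RS_equiv_rename_shell[OF ve s _ pe] 1 by simp
  next
    case 2
    then have "expand (\<mu>(p := \<mu> p - 1)) D = insert_shell (shell_chord p (nat (- \<mu> p)) False) (lift p) (expand \<mu> D)"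
      by (intro expand_grow(2)) auto
    moreover have "shell_chord p (nat (- \<mu> p)) False \<notin> chords (expand \<mu> D)"
      by (rule fresh_shell) (use 2 in auto)
    ultimately show ?thesis using RS_equiv_rename_shell[OF ve s _ pe] 2 by simp
  next
    case 3
    then have "\<mu> p \<noteq> 0" by simp
    then obtain \<mu>0 b where m: "\<mu>0 = \<mu>(p := \<mu> p - (if b then 1 else -1))" "b \<longleftrightarrow> 0 < \<mu> p"
      "expand \<mu> D = insert_shell (shell_chord p (nat \<bar>\<mu>0 p\<bar>) b) (lift p) (expand \<mu>0 D)"
      using expand_shrink[of \<mu> p] by metis
    have f: "shell_chord p (nat \<bar>\<mu>0 p\<bar>) b \<notin> chords (expand \<mu>0 D)" by (rule fresh_shell) simp
    have s0: "s \<notin> chords (expand \<mu>0 D)"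
      using s insert_shell_props(4)[OF ve pe f] unfolding m(3) by simp
    show ?thesis using RS_equiv_cancel_shells[OF ve s0 f pe] m 3 by simp
  next
    case 4
    then have "\<mu> p \<noteq> 0" by simp
    then obtain \<mu>0 b where m: "\<mu>0 = \<mu>(p := \<mu> p - (if b then 1 else -1))" "b \<longleftrightarrow> 0 < \<mu> p"
      "expand \<mu> D = insert_shell (shell_chord p (nat \<bar>\<mu>0 p\<bar>) b) (lift p) (expand \<mu>0 D)"
      using expand_shrink[of \<mu> p] by metis
    have f: "shell_chord p (nat \<bar>\<mu>0 p\<bar>) b \<notin> chords (expand \<mu>0 D)" by (rule fresh_shell) simp
    have s0: "s \<notin> chords (expand \<mu>0 D)"
      using s insert_shell_props(4)[OF ve pe f] unfolding m(3) by simp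
    show ?thesis using RS_equiv_cancel_shells[OF ve s0 f pe] m 4 by simp
  qed
qed

lemma fresh_chord:
  assumes "finite A"
  obtains s where "s \<notin> A" "positive s = b"
proof -
  obtain n where "n \<notin> label ` A" using ex_new_if_finite[of "label ` A"] assms by auto
  then have "Chord n b \<notin> A" by force
  then show thesis using that[of "Chord n b"] by simp
qed

text \<open>
  Pop a shell at one end of the chord, and push it at the other end.
\<close>

lemma RS_equiv_expand_move1:
  assumes v: "gauss_diagram 2 D" and pq: "{p, q} = {Initial c, Terminal c}" and c: "c \<in> chords D"
  shows "RS_equiv (expand (\<mu>(p := \<mu> p + 1)) D) (expand (\<mu>(q := \<mu> q + 1)) D)"
proof -
  obtain s where s: "s \<notin> chords (expand \<mu> D)" "positive s = True"
    using fresh_chord[OF finite_chords] by blast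
  have 1: "sg s = 1" using s(2) by (simp add: chord_sign_def)
  have mem: "p \<in> set (concat D)" "q \<in> set (concat D)"
    using c chords_iff[OF v, of c] pq by (auto simp: doubleton_eq_iff)
  note ve = gauss_diagram_expand[OF v, of \<mu>]
  have "lift_chord c \<in> chords (expand \<mu> D)"
    using chord_of_in_chords[OF lift_in_expand[OF mem(1), of \<mu>]] pq by (auto simp: doubleton_eq_iff)
  moreover have "{lift p, lift q} = {Initial (lift_chord c), Terminal (lift_chord c)}"
    using pq by (auto simp: doubleton_eq_iff)
  ultimately have "RS_equiv (insert_shell s (lift p) (expand \<mu> D)) (insert_shell s (lift q) (expand \<mu> D))"
    by (intro RS_equiv_move_shell[OF ve s(1)])
  then show ?thesis
    using RS_equiv_absorb_shell[OF v mem(1) s(1)] RS_equiv_absorb_shell[OF v mem(2) s(1)] unfolding 1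
    by (blast intro: RS_equiv_trans RS_equiv_sym)
qed

lemma RS_equiv_expand_move:
  assumes v: "gauss_diagram 2 D" and c: "c \<in> chords D"
  shows "RS_equiv (expand \<mu> D) (expand (\<mu>(Initial c := \<mu> (Initial c) + k, Terminal c := \<mu> (Terminal c) - k)) D)"
proof -
  \<comment> \<open>negative \<open>k\<close> is the same statement read backwards\<close>
  have A: "RS_equiv (expand \<mu> D) (expand (\<mu>(Initial c := \<mu> (Initial c) + int n, Terminal c := \<mu> (Terminal c) - int n)) D)"
    for \<mu> n
  proof (induction n)
    case (Suc n)
    let ?m = "\<lambda>a b. \<mu>(Initial c := \<mu> (Initial c) + a, Terminal c := \<mu> (Terminal c) - b)"
    let ?\<mu> = "?m (int n) (int (Suc n))"
    have e: "?\<mu>(Terminal c := ?\<mu> (Terminal c) + 1) = ?m (int n) (int n)"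
      "?\<mu>(Initial c := ?\<mu> (Initial c) + 1) = ?m (int (Suc n)) (int (Suc n))"
      by (auto simp: fun_eq_iff)
    have "RS_equiv (expand (?m (int n) (int n)) D) (expand (?m (int (Suc n)) (int (Suc n))) D)"
      unfolding e[symmetric] by (rule RS_equiv_expand_move1[OF v _ c]) auto
    from RS_equiv_trans[OF Suc.IH this] show ?case .
  qed (simp add: RS_equiv_refl)
  show ?thesis
  proof (cases "0 \<le> k")
    case True
    then show ?thesis using A[of \<mu> "nat k"] by simp
  next
    case False
    let ?\<mu> = "\<mu>(Initial c := \<mu> (Initial c) + k, Terminal c := \<mu> (Terminal c) - k)"
    have "?\<mu>(Initial c := ?\<mu> (Initial c) + int (nat (- k)), Terminal c := ?\<mu> (Terminal c) - int (nat (- k))) = \<mu>"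
      using False by (auto simp: fun_eq_iff)
    then show ?thesis using A[of ?\<mu> "nat (- k)"] by (metis RS_equiv_sym)
  qed
qed

text \<open>
  Shells can be moved along each chord separately, so only their number at both ends together
  matters.
\<close>

lemma RS_equiv_expand_cong:
  assumes v: "gauss_diagram 2 D"
    and eq: "\<And>c. c \<in> chords D \<Longrightarrow> \<mu> (Initial c) + \<mu> (Terminal c) = \<mu>' (Initial c) + \<mu>' (Terminal c)"
  shows "RS_equiv (expand \<mu> D) (expand \<mu>' D)"
proof -
  have "RS_equiv (expand \<mu> D) (expand (\<lambda>e. if chord_of e \<in> A then \<mu>' e else \<mu> e) D)"
    if "finite A" "A \<subseteq> chords D" for A
    using that
  proof (induction A rule: finite_induct)
    case (insert c A)
    let ?m = "\<lambda>A e. if chord_of e \<in> A then \<mu>' e else \<mu> e"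
    let ?k = "\<mu>' (Initial c) - \<mu> (Initial c)"
    have "(?m A)(Initial c := ?m A (Initial c) + ?k, Terminal c := ?m A (Terminal c) - ?k) =
        ?m (insert c A)"
    proof
      fix e
      show "((?m A)(Initial c := ?m A (Initial c) + ?k, Terminal c := ?m A (Terminal c) - ?k)) e =
        ?m (insert c A) e"
        using insert.hyps(2) insert.prems eq[of c] by (cases e) auto
    qed
    then show ?case using insert RS_equiv_expand_move[OF v, of c "?m A" ?k] by (auto intro: RS_equiv_trans)
  qed (simp add: RS_equiv_refl)
  from this[OF finite_chords subset_refl]
  have "RS_equiv (expand \<mu> D) (expand (\<lambda>e. if chord_of e \<in> chords D then \<mu>' e else \<mu> e) D)" .
  also have "expand (\<lambda>e. if chord_of e \<in> chords D then \<mu>' e else \<mu> e) D = expand \<mu>' D"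
    by (rule expand_cong) (simp only: chord_of_in_chords if_True)
  finally show ?thesis .
qed

text \<open>
  Putting all shells at the terminal endpoints is an arbitrary choice (\<open>RS_equiv_realize\<close>).
\<close>

definition realize :: "gauss \<Rightarrow> (chord \<Rightarrow> int) \<Rightarrow> gauss" where
  "realize D m = expand (\<lambda>e. case e of Initial c \<Rightarrow> 0 | Terminal c \<Rightarrow> m c) D"

lemma RS_equiv_realize:
  assumes "gauss_diagram 2 D" "\<And>c. c \<in> chords D \<Longrightarrow> \<mu> (Initial c) + \<mu> (Terminal c) = m c"
  shows "RS_equiv (expand \<mu> D) (realize D m)"
  unfolding realize_def by (rule RS_equiv_expand_cong) (use assms in auto)

lemma RS_equiv_realize_zero:
  assumes v: "gauss_diagram 2 D"
  shows "RS_equiv D (realize D (\<lambda>_. 0))"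
proof -
  have "realize D (\<lambda>_. 0) = rename lift_chord D"
    unfolding realize_def by (rule expand_zero) (simp split: endpoint.splits)
  moreover have "same_diagram D (rename lift_chord D)"
    unfolding same_diagram_iff using rotated_refl
    by (intro exI[of _ lift_chord]) (auto simp: inj_on_def lift_chord_def chord.expand)
  ultimately show ?thesis using RS_equiv_same_diagram[OF v gauss_diagram_lift[OF v]] by simp
qed

lemma rotated_expand: "rotated D D' \<Longrightarrow> rotated (expand \<mu> D) (expand \<mu> D')"
proof -
  have *: "\<exists>k'. expand_word \<mu> (rotate k w) = rotate k' (expand_word \<mu> w)" for k w
  proof -
    define a where "a = take (k mod length w) w"
    define b where "b = drop (k mod length w) w"
    have w: "w = a @ b" and r: "rotate k w = b @ a"
      by (simp_all add: a_def b_def rotate_drop_take)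
    have "expand_word \<mu> (rotate k w) = rotate (length (expand_word \<mu> a)) (expand_word \<mu> w)"
      unfolding r unfolding w by (simp add: rotate_append)
    then show ?thesis by blast
  qed
  show "rotated D D' \<Longrightarrow> rotated (expand \<mu> D) (expand \<mu> D')"
    unfolding rotated_def expand_def by (induction rule: list_all2_induct) (use * in auto)
qed

lemma RS_equiv_realize_rotated:
  assumes "gauss_diagram 2 D" "rotated D D'"
  shows "RS_equiv (realize D m) (realize D' m)"
  unfolding realize_def by (rule RS_equiv_rotated[OF gauss_diagram_expand[OF assms(1)] rotated_expand[OF assms(2)]])

lemma next_in_expand:
  assumes "next_in D p q" "\<mu> p = 0" "\<mu> q = 0"
  shows "next_in (expand \<mu> D) (lift p) (lift q)"
proof -
  obtain w where w: "w \<in> set D" "next_to w p q" using assms(1) by (auto simp: next_in_def)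
  obtain a b where "w = a @ p # q # b" using w(2) by (auto simp: next_to_iff)
  then have "expand_word \<mu> w = expand_word \<mu> a @ lift p # lift q # expand_word \<mu> b"
    using assms by (simp add: shells_zero)
  then have "next_to (expand_word \<mu> w) (lift p) (lift q)" by (auto simp: next_to_iff)
  then show ?thesis using w(1) by (auto simp: next_in_def expand_def)
qed

lemma chord_of_shells:
  "x \<in> Initial ` set (shells \<mu> e) \<union> Terminal ` set (shells \<mu> e) \<Longrightarrow> chord_of x \<noteq> lift_chord c"
  by (auto simp: shells_def)

lemma lift_notin_surround:
  assumes "e \<noteq> p"
  shows "lift p \<notin> set (surround (shells \<mu> e) (lift e))"
proof
  assume "lift p \<in> set (surround (shells \<mu> e) (lift e))"
  then have "lift p = lift e \<or> lift p \<in> Initial ` set (shells \<mu> e) \<union> Terminal ` set (shells \<mu> e)"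
    unfolding set_surround by (simp only: insert_iff)
  then show False
  proof
    assume "lift p \<in> Initial ` set (shells \<mu> e) \<union> Terminal ` set (shells \<mu> e)"
    from chord_of_shells[OF this, of "chord_of p"] show False by simp
  qed (use assms in simp)
qed

lemma swapped_expand:
  assumes "\<mu> p = 0" "\<mu> q = 0"
  shows "swapped (lift p) (lift q) (expand \<mu> D) = expand \<mu> (swapped p q D)"
proof -
  have *: "map (transpose (lift p) (lift q)) (surround (shells \<mu> e) (lift e)) =
      surround (shells \<mu> (transpose p q e)) (lift (transpose p q e))" for e
  proof (cases "e = p \<or> e = q")
    case True
    then show ?thesis using assms by (auto simp: shells_zero)
  next
    case False
    have "transpose (lift p) (lift q) x = x" if "x \<in> set (surround (shells \<mu> e) (lift e))" for x
    proof -
      have "x \<noteq> lift p \<and> x \<noteq> lift q"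
        using that False lift_notin_surround[of e p \<mu>] lift_notin_surround[of e q \<mu>] by metis
      then show ?thesis by (simp add: transpose_apply_other)
    qed
    then show ?thesis using False by (simp add: transpose_apply_other map_idI)
  qed
  have "map (transpose (lift p) (lift q)) (expand_word \<mu> w) = expand_word \<mu> (map (transpose p q) w)" for w
    by (induction w) (simp_all add: *)
  then show ?thesis by (simp add: swapped_def expand_def)
qed

lemma delete_chords_expand:
  assumes "\<And>e. chord_of e \<in> X \<Longrightarrow> \<mu> e = 0"
  shows "delete_chords (lift_chord ` X) (expand \<mu> D) = expand \<mu> (delete_chords X D)"
proof -
  let ?P = "\<lambda>e. chord_of e \<notin> lift_chord ` X"
  have *: "filter ?P (surround (shells \<mu> e) (lift e)) =
      (if chord_of e \<in> X then [] else surround (shells \<mu> e) (lift e))" for e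
  proof (cases "chord_of e \<in> X")
    case True
    then show ?thesis using assms[OF True] by (simp add: shells_zero)
  next
    case False
    have "?P x" if "x \<in> set (surround (shells \<mu> e) (lift e))" for x
      using that False chord_of_shells[of x \<mu> e] unfolding set_surround by auto
    then show ?thesis using False by simp
  qed
  have "filter ?P (expand_word \<mu> w) = expand_word \<mu> (filter (\<lambda>e. chord_of e \<notin> X) w)" for w
    by (induction w) (simp_all add: *)
  then show ?thesis by (simp add: delete_chords_def expand_def)
qed

text \<open>
  All shells of the two chords are first moved to the endpoints that are not exchanged, so that \<open>p\<close>
  and \<open>q\<close> are adjacent in the expanded diagram as well. If \<open>p\<close> and \<open>q\<close> have no shells, the two shells
  created by S2 are exactly those that the expansion puts there for the new weights.
\<close>

lemma RS_equiv_realize_swapped: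
  assumes v: "gauss_diagram 2 D" and l: "next_in D p q" and pq: "chord_of p \<noteq> chord_of q"
  shows "RS_equiv (realize D m) (realize (swapped p q D) (swap_weight p q m))"
proof -
  \<comment> \<open>the shells of the chords of \<open>p\<close> and \<open>q\<close> sit at their other endpoints\<close>
  define \<mu> where "\<mu> = (\<lambda>e. if e \<in> {p, q} then 0 else case e of
    Initial c \<Rightarrow> if Terminal c \<in> {p, q} then m c else 0 | Terminal c \<Rightarrow> m c)"
  have z: "\<mu> p = 0" "\<mu> q = 0" by (simp_all add: \<mu>_def)
  have sum: "\<mu> (Initial c) + \<mu> (Terminal c) = m c" for c
    using pq by (auto simp: \<mu>_def)
  have mem: "p \<in> set (concat D)" "q \<in> set (concat D)" using next_in_in_concat[OF l] by auto
  have v': "gauss_diagram 2 (swapped p q D)" using gauss_diagram_swapped[OF v mem] .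
  have ch: "chords (swapped p q D) = chords D"
    using mem unfolding chords_def concat_swapped by (subst set_map_transpose) auto
  have mem': "p \<in> set (concat (swapped p q D))" "q \<in> set (concat (swapped p q D))"
    using mem unfolding concat_swapped by (subst set_map_transpose, simp, simp)+
  define a where "a = endpoint_sign p * endpoint_sign q"
  have a1: "a = 1 \<or> a = -1"
    using endpoint_sign_cases[of p] endpoint_sign_cases[of q] by (auto simp: a_def)
  let ?D = "swapped p q D"
  let ?s = "shell_chord p 0 (a = 1)" and ?t = "shell_chord q 0 (a = -1)"
  let ?m1 = "\<mu>(q := - a)" and ?m2 = "\<mu>(q := - a, p := a)"
  have ss: "sg ?s = a" "sg ?t = - a" using a1 by auto
  have ne: "p \<noteq> q" using pq by auto
  have e1: "expand ?m1 ?D = insert_shell ?t (lift q) (expand \<mu> ?D)"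
    by (rule insert_shell_expand) (use a1 z in \<open>auto simp: shells_def\<close>)
  have e2: "expand ?m2 ?D = insert_shell ?s (lift p) (expand ?m1 ?D)"
    by (rule insert_shell_expand) (use a1 z ne in \<open>auto simp: shells_def\<close>)
  have f1: "?t \<notin> chords (expand \<mu> ?D)" by (rule fresh_shell) (simp add: z)
  have f2: "?s \<notin> chords (expand ?m1 ?D)" by (rule fresh_shell) (simp add: z ne)
  note ve = gauss_diagram_expand[OF v']
  note P1 = insert_shell_props[OF ve lift_in_expand[OF mem'(2)] f1, folded e1]
  note P2 = insert_shell_props[OF ve lift_in_expand[OF mem'(1)] f2, folded e2]
  have e2': "expand ?m2 ?D = insert_shell ?t (lift q) (expand (\<mu>(p := a)) ?D)"
    by (rule insert_shell_expand) (use a1 z ne in \<open>auto simp: shells_def\<close>)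
  have f3: "?t \<notin> chords (expand (\<mu>(p := a)) ?D)" by (rule fresh_shell) (use z ne in simp)
  note P3 = insert_shell_props[OF ve lift_in_expand[OF mem'(2)] f3, folded e2']
  have "delete_chords {?s} (delete_chords {?t} (expand ?m2 ?D)) = delete_chords {?t} (delete_chords {?s} (expand ?m2 ?D))"
    by (simp add: delete_chords_delete_chords insert_commute)
  also have "\<dots> = expand \<mu> ?D" by (simp only: P2(2) P1(2))
  finally have K: "delete_chords {?s} (delete_chords {?t} (expand ?m2 ?D)) = map (map (transpose (lift p) (lift q))) (expand \<mu> D)"
    by (simp only: swapped_expand[of \<mu> p q D, OF z, symmetric] swapped_def[of "lift p"])
  have nf: "?s \<notin> chords (expand \<mu> D)" "?t \<notin> chords (expand \<mu> D)"
    by (rule fresh_shell, simp add: z)+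
  have "S2 (expand \<mu> D) (expand ?m2 ?D)"
    unfolding S2_def delete_chord_eq
    by (rule exI[of _ "lift p"], rule exI[of _ "lift q"], rule exI[of _ ?s], rule exI[of _ ?t])
      (use pq K nf P2(3) P3(3) ss next_in_followed_by[OF next_in_expand[OF l z]] in \<open>simp add: a_def\<close>)
  then have "RS_step 2 (expand \<mu> D) (expand ?m2 ?D)"
    unfolding RS_step_def using gauss_diagram_expand[OF v] ve by blast
  then have 2: "RS_equiv (expand \<mu> D) (expand ?m2 ?D)" by (rule RS_equiv_step)
  have 1: "RS_equiv (realize D m) (expand \<mu> D)" by (rule RS_equiv_sym[OF RS_equiv_realize[OF v]]) (rule sum)
  have 3: "RS_equiv (expand ?m2 ?D) (realize ?D (swap_weight p q m))"
  proof (rule RS_equiv_realize[OF v'])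
    fix c
    have "?m2 (Initial c) + ?m2 (Terminal c) = \<mu> (Initial c) + \<mu> (Terminal c) +
        (if c = chord_of p then a else 0) - (if c = chord_of q then a else 0)"
      using pq z by (cases p; cases q) auto
    then show "?m2 (Initial c) + ?m2 (Terminal c) = swap_weight p q m c"
      using pq unfolding sum by (simp add: swap_weight_def Let_def a_def)
  qed
  show ?thesis using 1 2 3 by (blast intro: RS_equiv_trans)
qed

lemma RS_equiv_realize_delete_isolated:
  assumes v: "gauss_diagram 2 D" and l: "next_in D x y" and xy: "{x, y} = {Initial c, Terminal c}"
    and m: "m c = 0"
  shows "RS_equiv (realize D m) (realize (delete_chords {c} D) m)"
proof -
  let ?\<mu> = "\<lambda>e. case e of Initial c \<Rightarrow> 0 | Terminal c \<Rightarrow> m c"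
  have z: "?\<mu> e = 0" if "chord_of e \<in> {c}" for e using that m by (cases e) auto
  have k: "delete_chords {lift_chord c} (expand ?\<mu> D) = expand ?\<mu> (delete_chords {c} D)"
    using delete_chords_expand[of "{c}" ?\<mu> D, OF z] by simp
  have "next_in (expand ?\<mu> D) (lift x) (lift y)"
  proof (rule next_in_expand[OF l])
    show "?\<mu> x = 0" by (rule z) (use xy in \<open>auto simp: doubleton_eq_iff\<close>)
    show "?\<mu> y = 0" by (rule z) (use xy in \<open>auto simp: doubleton_eq_iff\<close>)
  qed
  then have "adjacent (expand ?\<mu> D) (Initial (lift_chord c)) (Terminal (lift_chord c))"
    unfolding adjacent_def using xy next_in_followed_by by (auto simp: doubleton_eq_iff)
  then have "R1 (expand ?\<mu> D) (expand ?\<mu> (delete_chords {c} D))"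
    unfolding R1_def delete_chord_eq k[symmetric] by blast
  then have "RS_step 2 (expand ?\<mu> D) (expand ?\<mu> (delete_chords {c} D))"
    unfolding RS_step_def using gauss_diagram_expand v gauss_diagram_delete_chords by blast
  then show ?thesis unfolding realize_def by (rule RS_equiv_step)
qed

lemma RS_equiv_realize_delete_parallel:
  assumes v: "gauss_diagram 2 D" and s: "sg d = - sg c" and m: "m c = 0" "m d = 0"
    and I: "next_in D (Initial c) (Initial d)" and T: "next_in D (Terminal c) (Terminal d)"
  shows "RS_equiv (realize D m) (realize (delete_chords {c, d} D) m)"
proof -
  let ?\<mu> = "\<lambda>e. case e of Initial c \<Rightarrow> 0 | Terminal c \<Rightarrow> m c"
  have z: "?\<mu> e = 0" if "chord_of e \<in> {c, d}" for e using that m by (cases e) auto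
  have k: "delete_chords {lift_chord c} (delete_chords {lift_chord d} (expand ?\<mu> D)) = expand ?\<mu> (delete_chords {c, d} D)"
    using delete_chords_expand[of "{c, d}" ?\<mu> D, OF z] by (simp add: delete_chords_delete_chords insert_commute)
  have "next_in (expand ?\<mu> D) (lift (Initial c)) (lift (Initial d))"
    "next_in (expand ?\<mu> D) (lift (Terminal c)) (lift (Terminal d))"
    by (rule next_in_expand[OF I] next_in_expand[OF T]; rule z; simp)+
  then have "R2 (expand ?\<mu> D) (expand ?\<mu> (delete_chords {c, d} D))"
    unfolding R2_def delete_chord_eq k[symmetric] adjacent_def
    using next_in_followed_by s
    by (intro exI[of _ "lift_chord c"] exI[of _ "lift_chord d"]) auto
  then have "RS_step 2 (expand ?\<mu> D) (expand ?\<mu> (delete_chords {c, d} D))"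
    unfolding RS_step_def using gauss_diagram_expand v gauss_diagram_delete_chords by blast
  then show ?thesis unfolding realize_def by (rule RS_equiv_step)
qed

lemma insert_shell_expand_base:
  assumes "\<mu> p = 0" "\<mu> (Initial s) = 0" "\<mu> (Terminal s) = 0"
  shows "expand \<mu> (insert_shell s p D) = insert_shell (lift_chord s) (lift p) (expand \<mu> D)"
proof -
  let ?g = "\<lambda>e. if e = p then surround [s] p else [e]"
  let ?h = "\<lambda>e. if e = lift p then surround [lift_chord s] (lift p) else [e]"
  have *: "expand_word \<mu> (?g e) = concat (map ?h (surround (shells \<mu> e) (lift e)))" for e
  proof (cases "e = p")
    case True
    then show ?thesis using assms by (simp add: shells_zero surround_def)
  next
    case False
    have "concat (map ?h (surround (shells \<mu> e) (lift e))) = surround (shells \<mu> e) (lift e)"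
    proof (rule concat_map_single)
      fix x assume "x \<in> set (surround (shells \<mu> e) (lift e))"
      then have "x \<noteq> lift p" using lift_notin_surround[OF False] by metis
      then show "?h x = [x]" by simp
    qed
    then show ?thesis using False by simp
  qed
  have "expand_word \<mu> (concat (map ?g w)) = concat (map ?h (expand_word \<mu> w))" for w
  proof (induction w)
    case (Cons e w)
    then show ?case using *[of e] by simp
  qed simp
  then show ?thesis by (simp add: expand_def insert_shell_def)
qed

text \<open>
  If the shells of the chord of \<open>p\<close> are kept at its other endpoint, expansion commutes with the
  insertion of \<open>s\<close>.
\<close>

lemma RS_equiv_realize_absorb:
  assumes v: "gauss_diagram 2 D" and p: "p \<in> set (concat D)" and s: "s \<notin> chords D" and m: "m s = 0"
  shows "RS_equiv (realize (insert_shell s p D) m) (realize D (m(chord_of p := m (chord_of p) + sg s)))"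
proof -
  define \<mu> where "\<mu> = (\<lambda>e. if e = p then 0 else case e of
    Initial c \<Rightarrow> if Terminal c = p then m c else 0 | Terminal c \<Rightarrow> m c)"
  have ps: "chord_of p \<noteq> s" using p s chord_of_in_chords by blast
  have z: "\<mu> p = 0" "\<mu> (Initial s) = 0" "\<mu> (Terminal s) = 0" using ps m by (auto simp: \<mu>_def)
  have sum: "\<mu> (Initial c) + \<mu> (Terminal c) = m c" for c by (auto simp: \<mu>_def)
  note P = insert_shell_props[OF v p s]
  have f: "lift_chord s \<notin> chords (expand \<mu> D)" using chords_expand[of \<mu> D] s by auto
  have "RS_equiv (realize (insert_shell s p D) m) (expand \<mu> (insert_shell s p D))"
    by (rule RS_equiv_sym[OF RS_equiv_realize[OF P(1)]]) (rule sum)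
  also have "RS_equiv (expand \<mu> (insert_shell s p D)) (expand (\<mu>(p := \<mu> p + sg s)) D)"
    unfolding insert_shell_expand_base[OF z] using RS_equiv_absorb_shell[OF v p f] by simp
  also have "RS_equiv (expand (\<mu>(p := \<mu> p + sg s)) D) (realize D (m(chord_of p := m (chord_of p) + sg s)))"
  proof (rule RS_equiv_realize[OF v])
    fix c
    have "(\<mu>(p := \<mu> p + sg s)) (Initial c) + (\<mu>(p := \<mu> p + sg s)) (Terminal c) =
        \<mu> (Initial c) + \<mu> (Terminal c) + (if c = chord_of p then sg s else 0)"
      by (cases p rule: endpoint.exhaust) auto
    then show "(\<mu>(p := \<mu> p + sg s)) (Initial c) + (\<mu>(p := \<mu> p + sg s)) (Terminal c) =
        (m(chord_of p := m (chord_of p) + sg s)) c"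
      unfolding sum by simp
  qed
  finally show ?thesis .
qed

section \<open>Moves of weighted diagrams\<close>

text \<open>
  Every move of weighted diagrams is needed twice: its realizations are related by moves, and it
  preserves the invariants. Both are recorded together.
\<close>

definition dequiv :: "gauss \<Rightarrow> (chord \<Rightarrow> int) \<Rightarrow> gauss \<Rightarrow> (chord \<Rightarrow> int) \<Rightarrow> bool" where
  "dequiv D m D' m' \<longleftrightarrow> gauss_diagram 2 D \<and> gauss_diagram 2 D' \<and>
     RS_equiv (realize D m) (realize D' m') \<and> S_agree D m D' m'"

lemma dequiv_refl: "gauss_diagram 2 D \<Longrightarrow> dequiv D m D m"
  by (simp add: dequiv_def RS_equiv_refl S_agree_refl)

lemma dequiv_sym: "dequiv D m D' m' \<Longrightarrow> dequiv D' m' D m"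
  unfolding dequiv_def using RS_equiv_sym S_agree_sym by blast

lemma dequiv_trans [trans]: "dequiv D m D' m' \<Longrightarrow> dequiv D' m' D'' m'' \<Longrightarrow> dequiv D m D'' m''"
  unfolding dequiv_def using RS_equiv_trans S_agree_trans by blast

lemma dequivD: "dequiv D m D' m' \<Longrightarrow> gauss_diagram 2 D" "dequiv D m D' m' \<Longrightarrow> gauss_diagram 2 D'"
  by (simp_all add: dequiv_def)

lemma dequiv_cong:
  assumes "gauss_diagram 2 D" "\<And>c. c \<in> chords D \<Longrightarrow> m' c = m c"
  shows "dequiv D m D m'"
proof -
  have "realize D m' = realize D m" unfolding realize_def
  proof (rule expand_cong)
    fix e assume "e \<in> set (concat D)"
    then have "m' (chord_of e) = m (chord_of e)" by (intro assms(2) chord_of_in_chords)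
    then show "(case e of Initial c \<Rightarrow> 0 | Terminal c \<Rightarrow> m' c) = (case e of Initial c \<Rightarrow> 0 | Terminal c \<Rightarrow> m c)"
      by (cases e) auto
  qed
  then show ?thesis
    using assms R_agree_imp_S_agree[OF R_agree_cong[of D m' m]] by (simp add: dequiv_def RS_equiv_refl)
qed

lemma dequiv_rotated: "gauss_diagram 2 D \<Longrightarrow> rotated D D' \<Longrightarrow> dequiv D m D' m"
  by (simp add: dequiv_def rotated_gauss_diagram RS_equiv_realize_rotated S_agree_rotated)

lemma dequiv_swapped:
  assumes "gauss_diagram 2 D" "next_in D p q" "chord_of p \<noteq> chord_of q"
  shows "dequiv D m (swapped p q D) (swap_weight p q m)"
  using assms next_in_in_concat[OF assms(2)]
  by (simp add: dequiv_def RS_equiv_realize_swapped R_agree_imp_S_agree[OF R_agree_swapped] gauss_diagram_swapped del: set_concat)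

lemma dequiv_delete_isolated:
  assumes "gauss_diagram 2 D" "next_in D x y" "{x, y} = {Initial c, Terminal c}" "m c = 0"
  shows "dequiv D m (delete_chords {c} D) m"
  using assms RS_equiv_realize_delete_isolated[where m = m, OF assms]
    R_agree_imp_S_agree[OF R_agree_delete_isolated[where m = m, OF assms]]
  by (simp add: dequiv_def gauss_diagram_delete_chords)

lemma dequiv_delete_bare_parallel:
  assumes "gauss_diagram 2 D" "sg d = - sg c" "m c = 0" "m d = 0"
    "next_in D (Initial c) (Initial d)" "next_in D (Terminal c) (Terminal d)"
  shows "dequiv D m (delete_chords {c, d} D) m"
  using assms RS_equiv_realize_delete_parallel[where m = m, OF assms]
    R_agree_imp_S_agree[OF R_agree_delete_parallel[of D d c m]]
  by (simp add: dequiv_def gauss_diagram_delete_chords)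

lemma dequiv_absorb:
  assumes v: "gauss_diagram 2 D" and p: "p \<in> set (concat D)" and s: "s \<notin> chords D" and m: "m s = 0"
  shows "dequiv (insert_shell s p D) m D (m(chord_of p := m (chord_of p) + sg s))"
proof -
  note P = insert_shell_props[OF v p s]
  show ?thesis
    using RS_equiv_realize_absorb[where m = m, OF assms] S_agree_shell[where m = m, OF P(1,3) m] P(1) v
    unfolding dequiv_def P(2) by blast
qed

lemma swapped_context:
  assumes "distinct (concat (Ds1 @ (a @ p # q # b) # Ds2))"
  shows "swapped p q (Ds1 @ (a @ p # q # b) # Ds2) = Ds1 @ (a @ q # p # b) # Ds2"
proof -
  have "map (transpose p q) w = w" if "w \<in> set Ds1 \<union> set Ds2" for w
    by (rule map_transpose_id) (use assms that in auto)
  moreover have "map (transpose p q) (a @ p # q # b) = a @ q # p # b"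
    by (rule map_transpose_adjacent) (use assms in auto)
  ultimately show ?thesis unfolding swapped_def by (simp add: map_idI)
qed

lemma next_in_context: "next_in (Ds1 @ (a @ p # q # b) # Ds2) p q"
  by (auto simp: next_in_def next_to_iff)

lemma dequiv_swap:
  assumes v: "gauss_diagram 2 (Ds1 @ (a @ p # q # b) # Ds2)" and pq: "chord_of p \<noteq> chord_of q"
  shows "dequiv (Ds1 @ (a @ p # q # b) # Ds2) m (Ds1 @ (a @ q # p # b) # Ds2) (swap_weight p q m)"
  using dequiv_swapped[OF v next_in_context pq]
  unfolding swapped_context[OF distinct_concat_gauss[OF v]] .

lemma delete_chords_context:
  assumes "gauss_diagram n (Ds1 @ (a @ x # y # b) # Ds2)" "{x, y} = {Initial c, Terminal c}"
  shows "delete_chords {c} (Ds1 @ (a @ x # y # b) # Ds2) = Ds1 @ (a @ b) # Ds2"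
proof -
  let ?D = "Ds1 @ (a @ x # y # b) # Ds2"
  have d: "distinct (concat ?D)" by (rule distinct_concat_gauss[OF assms(1)])
  have "filter (\<lambda>e. chord_of e \<notin> {c}) w = w" if "Initial c \<notin> set w" "Terminal c \<notin> set w" for w
  proof (rule filter_True, rule ballI)
    fix e assume "e \<in> set w"
    then show "chord_of e \<notin> {c}" using that by (cases e rule: endpoint.exhaust) auto
  qed
  moreover have "Initial c \<notin> set w \<and> Terminal c \<notin> set w" if "w \<in> set Ds1 \<union> set Ds2 \<union> {a, b}" for w
    using that d assms(2) by (auto simp: doubleton_eq_iff)
  ultimately have "filter (\<lambda>e. chord_of e \<notin> {c}) w = w" if "w \<in> set Ds1 \<union> set Ds2 \<union> {a, b}" for w
    using that by blast
  moreover have "chord_of x = c" "chord_of y = c" using assms(2) by (auto simp: doubleton_eq_iff)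
  ultimately show ?thesis by (simp add: delete_chords_def map_idI)
qed

lemma dequiv_delete:
  assumes v: "gauss_diagram 2 (Ds1 @ (a @ x # y # b) # Ds2)" and xy: "{x, y} = {Initial c, Terminal c}"
    and m: "m c = 0"
  shows "dequiv (Ds1 @ (a @ x # y # b) # Ds2) m (Ds1 @ (a @ b) # Ds2) m"
  using dequiv_delete_isolated[where m = m, OF v next_in_context xy m] unfolding delete_chords_context[OF v xy] .

lemma gauss_diagram_insert:
  assumes v: "gauss_diagram n (Ds1 @ (a @ b) # Ds2)" and c: "c \<notin> chords (Ds1 @ (a @ b) # Ds2)"
    and xy: "{x, y} = {Initial c, Terminal c}"
  shows "gauss_diagram n (Ds1 @ (a @ x # y # b) # Ds2)"
    "chords (Ds1 @ (a @ x # y # b) # Ds2) = insert c (chords (Ds1 @ (a @ b) # Ds2))"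
proof -
  let ?D = "Ds1 @ (a @ b) # Ds2" and ?D' = "Ds1 @ (a @ x # y # b) # Ds2"
  have n: "x \<notin> set (concat ?D)" "y \<notin> set (concat ?D)" "x \<noteq> y"
    using xy chords_iff[OF v, of c] c by (auto simp: doubleton_eq_iff)
  have s: "set (concat ?D') = {x, y} \<union> set (concat ?D)" by auto
  have "distinct (concat ?D')" using n distinct_concat_gauss[OF v] by auto
  moreover have "Initial d \<in> set (concat ?D') \<longleftrightarrow> Terminal d \<in> set (concat ?D')" for d
    using v unfolding s xy gauss_diagram_def by (auto simp del: set_concat)
  ultimately show "gauss_diagram n ?D'" using v by (simp add: gauss_diagram_def)
  have "chord_of ` {x, y} = {c}" unfolding xy by auto
  then show "chords ?D' = insert c (chords ?D)" unfolding chords_def s image_Un by simp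
qed

lemma dequiv_insert:
  assumes v: "gauss_diagram 2 (Ds1 @ (a @ b) # Ds2)" and c: "c \<notin> chords (Ds1 @ (a @ b) # Ds2)"
    and xy: "{x, y} = {Initial c, Terminal c}"
  shows "dequiv (Ds1 @ (a @ b) # Ds2) m (Ds1 @ (a @ x # y # b) # Ds2) (m(c := 0))"
proof -
  have "dequiv (Ds1 @ (a @ b) # Ds2) m (Ds1 @ (a @ b) # Ds2) (m(c := 0))"
    by (rule dequiv_cong[OF v]) (use c in auto)
  also have "dequiv (Ds1 @ (a @ b) # Ds2) (m(c := 0)) (Ds1 @ (a @ x # y # b) # Ds2) (m(c := 0))"
    by (rule dequiv_sym[OF dequiv_delete[OF gauss_diagram_insert(1)[OF v c xy] xy]]) simp
  finally show ?thesis .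
qed

lemma insert_shell_context:
  assumes "gauss_diagram n (Ds1 @ (a @ p # b) # Ds2)"
  shows "insert_shell s p (Ds1 @ (a @ p # b) # Ds2) = Ds1 @ (a @ surround [s] p @ b) # Ds2"
proof -
  have d: "distinct (concat (Ds1 @ (a @ p # b) # Ds2))" by (rule distinct_concat_gauss[OF assms])
  have "concat (map (\<lambda>e. if e = p then surround [s] p else [e]) v) = v" if "p \<notin> set v" for v
    by (rule concat_map_single) (use that in auto)
  moreover have "\<forall>v\<in>set Ds1 \<union> set Ds2. p \<notin> set v" "p \<notin> set a" "p \<notin> set b" using d by auto
  ultimately show ?thesis by (auto simp: insert_shell_def intro!: map_idI)
qed

text \<open>
  Insert an auxiliary isolated chord \<open>w\<close> next to \<open>c\<close>, and exchange the two endpoints in the middle.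
  Then \<open>c\<close> has weight \<open>0\<close> and is a shell around an endpoint of \<open>w\<close>. Absorbing it takes the weight of
  \<open>w\<close> back to \<open>0\<close>, so that \<open>w\<close> can be deleted.
\<close>

lemma dequiv_delete_shell_like:
  assumes v: "gauss_diagram 2 (Ds1 @ (a @ x # y # b) # Ds2)" and xy: "{x, y} = {Initial c, Terminal c}"
    and m: "m c = - sg c"
  shows "dequiv (Ds1 @ (a @ x # y # b) # Ds2) m (Ds1 @ (a @ b) # Ds2) m"
proof -
  let ?D = "Ds1 @ (a @ x # y # b) # Ds2" and ?E = "Ds1 @ (a @ b) # Ds2"
  obtain w where w: "w \<notin> chords ?D" "positive w = True" using fresh_chord[OF finite_chords] by blast
  have sw: "sg w = 1" using w(2) by (simp add: chord_sign_def)
  have cD: "c \<in> chords ?D"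
  proof -
    have "Initial c \<in> {x, y}" unfolding xy by simp
    then have "Initial c \<in> set (concat ?D)" by auto
    then show ?thesis by (rule chords_iff(1)[OF v, THEN iffD2])
  qed
  have wc: "w \<noteq> c" using w cD by auto
  have v0: "gauss_diagram 2 ?E" using gauss_diagram_delete_chords[OF v, of "{c}"] unfolding delete_chords_context[OF v xy] .
  have ch0: "chords ?E = chords ?D - {c}" using chords_delete_chords[of "{c}" ?D] unfolding delete_chords_context[OF v xy] .
  have w0: "w \<notin> chords ?E" using ch0 w by simp
  have c0: "c \<notin> chords ?E" using ch0 by simp
  let ?W = "Ds1 @ (a @ Initial w # Terminal w # b) # Ds2"
  note gW = gauss_diagram_insert[OF v0 w0 refl]
  have cW: "c \<notin> chords ?W" using gW(2) c0 wc by simp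
  have fin: "dequiv ?W m2 ?E m" if "m2 w = 0" "\<And>d. d \<noteq> w \<Longrightarrow> d \<noteq> c \<Longrightarrow> m2 d = m d" for m2
  proof -
    have "dequiv ?W m2 ?E m2" by (rule dequiv_delete[OF gW(1) refl]) (rule that)
    also have "dequiv ?E m2 ?E m" by (rule dequiv_cong[OF v0]) (use that w0 c0 in metis)
    finally show ?thesis .
  qed
  from xy consider "x = Initial c" "y = Terminal c" | "x = Terminal c" "y = Initial c"
    by (auto simp: doubleton_eq_iff)
  then show ?thesis
  proof cases
    case 1
    let ?m1 = "m(w := 0)"
    let ?m2 = "swap_weight (Terminal w) (Initial c) ?m1"
    let ?D1 = "Ds1 @ (a @ Initial w # Terminal w # x # y # b) # Ds2"
    let ?D2 = "Ds1 @ (a @ Initial w # Initial c # Terminal w # Terminal c # b) # Ds2"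
    have m2: "?m2 w = - sg c" "?m2 c = 0" "\<And>d. d \<noteq> w \<Longrightarrow> d \<noteq> c \<Longrightarrow> ?m2 d = m d"
      using wc sw m by (auto simp: swap_weight_def Let_def)
    have "dequiv ?D m ?D1 ?m1"
      using dequiv_insert[of Ds1 a "x # y # b" Ds2 w] v w by simp
    also have "dequiv ?D1 ?m1 ?D2 ?m2"
      using dequiv_swap[of Ds1 "a @ [Initial w]" "Terminal w" "Initial c" "Terminal c # b" Ds2 ?m1]
        gauss_diagram_insert(1)[of 2 Ds1 a "x # y # b" Ds2 w] v w wc 1 by simp
    also have "dequiv ?D2 ?m2 ?W (?m2(w := 0))"
    proof -
      have "insert_shell c (Terminal w) ?W = ?D2"
        using insert_shell_context[of 2 Ds1 "a @ [Initial w]" "Terminal w" b Ds2 c] gW(1) sw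
        by (simp add: surround_def)
      moreover have "Terminal w \<in> set (concat ?W)" by simp
      ultimately show ?thesis
        using dequiv_absorb[where m = ?m2 and p = "Terminal w", OF gW(1) _ cW m2(2)] m2(1) by simp
    qed
    also have "dequiv ?W (?m2(w := 0)) ?E m" by (rule fin) (use m2 in auto)
    finally show ?thesis .
  next
    case 2
    let ?m1 = "m(w := 0)"
    let ?m2 = "swap_weight (Initial c) (Initial w) ?m1"
    let ?D1 = "Ds1 @ (a @ x # y # Initial w # Terminal w # b) # Ds2"
    let ?D2 = "Ds1 @ (a @ Terminal c # Initial w # Initial c # Terminal w # b) # Ds2"
    have m2: "?m2 w = - sg c" "?m2 c = 0" "\<And>d. d \<noteq> w \<Longrightarrow> d \<noteq> c \<Longrightarrow> ?m2 d = m d"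
      using wc sw m by (auto simp: swap_weight_def Let_def)
    have "dequiv ?D m ?D1 ?m1"
      using dequiv_insert[of Ds1 "a @ [x, y]" b Ds2 w] v w by simp
    also have "dequiv ?D1 ?m1 ?D2 ?m2"
      using dequiv_swap[of Ds1 "a @ [Terminal c]" "Initial c" "Initial w" "Terminal w # b" Ds2 ?m1]
        gauss_diagram_insert(1)[of 2 Ds1 "a @ [x, y]" b Ds2 w] v w wc 2 by simp
    also have "dequiv ?D2 ?m2 ?W (?m2(w := 0))"
    proof -
      have "insert_shell c (Initial w) ?W = ?D2"
        using insert_shell_context[of 2 Ds1 a "Initial w" "Terminal w # b" Ds2 c] gW(1) sw
        by (simp add: surround_def)
      moreover have "Initial w \<in> set (concat ?W)" by simp
      ultimately show ?thesis
        using dequiv_absorb[where m = ?m2 and p = "Initial w", OF gW(1) _ cW m2(2)] m2(1) by simp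
    qed
    also have "dequiv ?W (?m2(w := 0)) ?E m" by (rule fin) (use m2 in auto)
    finally show ?thesis .
  qed
qed

text \<open>
  R2 itself requires that no shells are in the way. An auxiliary isolated chord \<open>w\<close>, stretched over the
  two terminal endpoints, keeps its weight \<open>0\<close>, since the signs of these endpoints are opposite, and
  it moves the weights of \<open>c\<close> and \<open>d\<close> one step towards \<open>0\<close>.
\<close>

lemma dequiv_delete_parallel:
  assumes "gauss_diagram 2 D" "sg d = - sg c" "m d = - m c"
    "next_in D (Initial c) (Initial d)" "next_in D (Terminal c) (Terminal d)"
  shows "dequiv D m (delete_chords {c, d} D) m"
  using assms
proof (induction "nat \<bar>m c\<bar>" arbitrary: D m rule: less_induct)
  case less
  note v = less.prems(1) and s = less.prems(2) and md = less.prems(3) and I = less.prems(4) and T = less.prems(5)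
  show ?case
  proof (cases "m c = 0")
    case True
    then show ?thesis using dequiv_delete_bare_parallel[OF v s _ _ I T] md by simp
  next
    case False
    define \<delta> where "\<delta> = sg c * sgn (m c)"
    have \<delta>: "\<delta> = 1 \<or> \<delta> = -1" using False sg_cases[of c] by (auto simp: \<delta>_def sgn_if)
    \<comment> \<open>the sign of the auxiliary chord decides in which direction the weight of \<open>c\<close> moves\<close>
    obtain w where w: "w \<notin> chords D" "positive w \<longleftrightarrow> \<delta> = 1" using fresh_chord[OF finite_chords] by blast
    have sw: "sg w = \<delta>" using w(2) \<delta> by (auto simp: chord_sign_def)
    have cd: "c \<in> chords D" "d \<in> chords D"
      using next_in_in_concat[OF I] chord_of_in_chords[of _ D] by (metis endpoint.sel)+
    have ne: "c \<noteq> d" "w \<noteq> c" "w \<noteq> d" using s w cd by auto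
    obtain v' where v': "v' \<in> set D" "next_to v' (Terminal c) (Terminal d)" using T by (auto simp: next_in_def)
    obtain Ds1 Ds2 where D0: "D = Ds1 @ v' # Ds2" using split_list[OF v'(1)] by blast
    obtain a b where v'': "v' = a @ Terminal c # Terminal d # b" using v'(2) by (auto simp: next_to_iff)
    have D: "D = Ds1 @ (a @ Terminal c # Terminal d # b) # Ds2" using D0 v'' by simp
    let ?D1 = "Ds1 @ (a @ Initial w # Terminal w # Terminal c # Terminal d # b) # Ds2"
    let ?D2 = "Ds1 @ (a @ Initial w # Terminal c # Terminal w # Terminal d # b) # Ds2"
    let ?D3 = "Ds1 @ (a @ Initial w # Terminal c # Terminal d # Terminal w # b) # Ds2"
    let ?m1 = "m(w := 0)"
    let ?m2 = "swap_weight (Terminal w) (Terminal c) ?m1"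
    let ?m3 = "swap_weight (Terminal w) (Terminal d) ?m2"
    have 1: "dequiv D m ?D1 ?m1" unfolding D
      by (rule dequiv_insert) (use v w D in auto)
    have 2: "dequiv ?D1 ?m1 ?D2 ?m2"
      using dequiv_swap[of Ds1 "a @ [Initial w]" "Terminal w" "Terminal c" "Terminal d # b" Ds2 ?m1]
        dequivD(2)[OF 1] ne by simp
    have 3: "dequiv ?D2 ?m2 ?D3 ?m3"
      using dequiv_swap[of Ds1 "a @ [Initial w, Terminal c]" "Terminal w" "Terminal d" "b" Ds2 ?m2]
        dequivD(2)[OF 2] ne by simp
    have v3: "gauss_diagram 2 ?D3" by (rule dequivD(2)[OF 3])
    have m3: "?m3 w = 0" "?m3 c = m c - sgn (m c)" "?m3 d = - ?m3 c"
      "\<And>e. e \<notin> {w, c, d} \<Longrightarrow> ?m3 e = m e"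
      using ne md s by (auto simp: swap_weight_def Let_def sw \<delta>_def mult.commute)
    have lt: "nat \<bar>?m3 c\<bar> < nat \<bar>m c\<bar>" unfolding m3(2) using False by (auto simp: sgn_if)
    have T3: "next_in ?D3 (Terminal c) (Terminal d)"
      using next_in_context[of Ds1 "a @ [Initial w]" "Terminal c" "Terminal d"] by simp
    have I3: "next_in ?D3 (Initial c) (Initial d)"
      using I unfolding D next_in_def by (auto simp: next_to_append)
    have 4: "dequiv ?D3 ?m3 (delete_chords {c, d} ?D3) ?m3"
      by (rule less.hyps[OF lt v3 s m3(3) I3 T3])
    let ?f = "filter (\<lambda>e. chord_of e \<notin> {c, d})"
    have k3: "delete_chords {c, d} ?D3 = map ?f Ds1 @ (?f a @ Initial w # Terminal w # ?f b) # map ?f Ds2"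
      using ne by (simp add: delete_chords_def)
    have k: "delete_chords {c, d} D = map ?f Ds1 @ (?f a @ ?f b) # map ?f Ds2"
      by (simp add: delete_chords_def D)
    have "dequiv (delete_chords {c, d} ?D3) ?m3 (delete_chords {c, d} D) ?m3"
      unfolding k k3 by (rule dequiv_delete) (use gauss_diagram_delete_chords[OF v3, of "{c, d}"] k3 m3 in auto)
    moreover have "dequiv (delete_chords {c, d} D) ?m3 (delete_chords {c, d} D) m"
    proof (rule dequiv_cong[OF gauss_diagram_delete_chords[OF v]])
      fix e assume "e \<in> chords (delete_chords {c, d} D)"
      then have "e \<notin> {w, c, d}" using w by (auto simp: chords_delete_chords)
      then show "m e = ?m3 e" using m3(4)[of e] by simp
    qed
    ultimately show ?thesis using 1 2 3 4 by (meson dequiv_trans)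
  qed
qed

text \<open>
  The weights for which the lifted indices are the prescribed numbers \<open>z\<close>.
\<close>

definition weight_of :: "gauss \<Rightarrow> (chord \<Rightarrow> int) \<Rightarrow> chord \<Rightarrow> int" where
  "weight_of D z c = sg c * (height (concat D) (Terminal c) - height (concat D) (Initial c) + sg c - z c)"

lemma lifted_index_weight_of [simp]: "lifted_index D (weight_of D z) c = z c"
  by (simp add: lifted_index_def weight_of_def)

lemma weight_of_lifted_index: "lifted_index D m c = z c \<Longrightarrow> weight_of D z c = m c"
  unfolding weight_of_def lifted_index_def by (auto simp: algebra_simps)

text \<open>
  Prescribing indices instead of weights makes exchanges invisible: they do not change \<open>z\<close>.
\<close>

definition zequiv :: "gauss \<Rightarrow> (chord \<Rightarrow> int) \<Rightarrow> gauss \<Rightarrow> (chord \<Rightarrow> int) \<Rightarrow> bool" where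
  "zequiv D z D' z' \<longleftrightarrow> dequiv D (weight_of D z) D' (weight_of D' z')"

lemma zequiv_refl: "gauss_diagram 2 D \<Longrightarrow> zequiv D z D z"
  by (simp add: zequiv_def dequiv_refl)

lemma zequiv_sym: "zequiv D z D' z' \<Longrightarrow> zequiv D' z' D z"
  unfolding zequiv_def by (rule dequiv_sym)

lemma zequiv_trans [trans]: "zequiv D z D' z' \<Longrightarrow> zequiv D' z' D'' z'' \<Longrightarrow> zequiv D z D'' z''"
  unfolding zequiv_def by (rule dequiv_trans)

lemma zequivI:
  assumes "dequiv D (weight_of D z) D' m'" "\<And>c. c \<in> chords D' \<Longrightarrow> lifted_index D' m' c = z' c"
  shows "zequiv D z D' z'"
  unfolding zequiv_def using assms weight_of_lifted_index
  by (blast intro: dequiv_trans dequiv_cong dequivD)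

lemma zequiv_cong: "gauss_diagram 2 D \<Longrightarrow> (\<And>c. c \<in> chords D \<Longrightarrow> z' c = z c) \<Longrightarrow> zequiv D z D z'"
  by (rule zequivI[OF dequiv_refl]) auto

lemma zequiv_swap:
  assumes v: "gauss_diagram 2 (Ds1 @ (a @ p # q # b) # Ds2)" and pq: "chord_of p \<noteq> chord_of q"
  shows "zequiv (Ds1 @ (a @ p # q # b) # Ds2) z (Ds1 @ (a @ q # p # b) # Ds2) z"
proof (rule zequivI[OF dequiv_swap[OF v pq]])
  let ?D = "Ds1 @ (a @ p # q # b) # Ds2"
  fix c
  show "lifted_index (Ds1 @ (a @ q # p # b) # Ds2) (swap_weight p q (weight_of ?D z)) c = z c"
    using lifted_index_swapped(1)[OF v next_in_context pq, of "weight_of ?D z" c]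
    unfolding swapped_context[OF distinct_concat_gauss[OF v]] by simp
qed

lemma zequiv_delete:
  assumes v: "gauss_diagram 2 (Ds1 @ (a @ x # y # b) # Ds2)" and xy: "{x, y} = {Initial c, Terminal c}"
    and z: "z c \<in> {0, 1}"
  shows "zequiv (Ds1 @ (a @ x # y # b) # Ds2) z (Ds1 @ (a @ b) # Ds2) z"
proof (rule zequivI)
  let ?D = "Ds1 @ (a @ x # y # b) # Ds2" and ?D' = "Ds1 @ (a @ b) # Ds2"
  have n: "next_to (concat ?D) x y" by (rule next_in_concat[OF next_in_context])
  have d: "distinct (concat ?D)" by (rule distinct_concat_gauss[OF v])
  have "height (concat ?D) (Terminal c) - height (concat ?D) (Initial c) = - sg c"
    using next_to_height[OF d n] xy by (auto simp: doubleton_eq_iff)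
  then have "weight_of ?D z c = - sg c * z c" by (simp add: weight_of_def)
  then show "dequiv ?D (weight_of ?D z) ?D' (weight_of ?D z)"
    using z dequiv_delete[where m = "weight_of ?D z", OF v xy]
      dequiv_delete_shell_like[where m = "weight_of ?D z", OF v xy] by auto
  fix e assume "e \<in> chords ?D'"
  then have "e \<noteq> c" using delete_chords_context[OF v xy] chords_delete_chords[of "{c}" ?D] by auto
  then have "height (concat ?D') (Initial e) = height (concat ?D) (Initial e)"
    "height (concat ?D') (Terminal e) = height (concat ?D) (Terminal e)"
    using height_delete_isolated[OF d n xy] unfolding delete_chords_context[OF v xy, symmetric] concat_delete_chords
    by simp_all
  then have "lifted_index ?D' (weight_of ?D z) e = lifted_index ?D (weight_of ?D z) e"
    by (simp only: lifted_index_def)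
  then show "lifted_index ?D' (weight_of ?D z) e = z e" by simp
qed

lemma zequiv_delete_parallel:
  assumes v: "gauss_diagram 2 D" and s: "sg d = - sg c" and z: "z c = z d"
    and I: "next_in D (Initial c) (Initial d)" and T: "next_in D (Terminal c) (Terminal d)"
  shows "zequiv D z (delete_chords {c, d} D) z"
proof (rule zequivI)
  note d = distinct_concat_gauss[OF v] and nI = next_in_concat[OF I] and nT = next_in_concat[OF T]
  have "weight_of D z d = - weight_of D z c"
    using next_to_height[OF d nI] next_to_height[OF d nT] s z by (simp add: weight_of_def)
  then show "dequiv D (weight_of D z) (delete_chords {c, d} D) (weight_of D z)"
    by (rule dequiv_delete_parallel[OF v s _ I T])
  fix e assume "e \<in> chords (delete_chords {c, d} D)"
  then have "e \<notin> {c, d}" by (simp add: chords_delete_chords)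
  then have "height (concat (delete_chords {c, d} D)) (Initial e) = height (concat D) (Initial e)"
    "height (concat (delete_chords {c, d} D)) (Terminal e) = height (concat D) (Terminal e)"
    unfolding concat_delete_chords by (intro height_delete_parallel[OF d nI nT refl refl s]; simp)+
  then have "lifted_index (delete_chords {c, d} D) (weight_of D z) e = lifted_index D (weight_of D z) e"
    by (simp only: lifted_index_def)
  then show "lifted_index (delete_chords {c, d} D) (weight_of D z) e = z e" by simp
qed

lemma zequivD: "zequiv D z D' z' \<Longrightarrow> gauss_diagram 2 D" "zequiv D z D' z' \<Longrightarrow> gauss_diagram 2 D'"
  unfolding zequiv_def using dequivD by blast+

lemma zequiv_move_front:
  assumes "gauss_diagram 2 (Ds1 @ (a @ w @ x # b) # Ds2)" "\<forall>e\<in>set w. chord_of e \<noteq> chord_of x"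
  shows "zequiv (Ds1 @ (a @ w @ x # b) # Ds2) z (Ds1 @ (a @ x # w @ b) # Ds2) z"
  using assms
proof (induction w arbitrary: b rule: rev_induct)
  case Nil
  then show ?case by (simp add: zequiv_refl)
next
  case (snoc e w)
  have "zequiv (Ds1 @ ((a @ w) @ e # x # b) # Ds2) z (Ds1 @ ((a @ w) @ x # e # b) # Ds2) z"
    by (rule zequiv_swap) (use snoc.prems in auto)
  also have "zequiv (Ds1 @ ((a @ w) @ x # e # b) # Ds2) z (Ds1 @ (a @ x # w @ (e # b)) # Ds2) z"
    using snoc.IH[of "e # b"] zequivD(2)[OF calculation] snoc.prems by simp
  finally show ?case by simp
qed

text \<open>
  Sorting by exchanges: bring the first endpoint of \<open>w'\<close> to the front, and continue with the rest.
  The exchanges never concern the two endpoints of one chord, because these are in the same order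
  in both words.
\<close>

lemma zequiv_permute_word:
  assumes "gauss_diagram 2 (Ds1 @ (a @ w) # Ds2)" "set w = set w'" "distinct w'"
    "\<And>c. Initial c \<in> set w \<Longrightarrow> Terminal c \<in> set w \<Longrightarrow>
       precedes w (Terminal c) (Initial c) \<longleftrightarrow> precedes w' (Terminal c) (Initial c)"
  shows "zequiv (Ds1 @ (a @ w) # Ds2) z (Ds1 @ (a @ w') # Ds2) z"
  using assms
proof (induction w' arbitrary: a w)
  case Nil
  then show ?case by (simp add: zequiv_refl)
next
  case (Cons x w')
  have dw: "distinct w" using distinct_concat_gauss[OF Cons.prems(1)] by auto
  have "x \<in> set w" using Cons.prems(2) by simp
  then obtain u v where w: "w = u @ x # v" using split_list by metis
  have xu: "x \<notin> set u" "x \<notin> set v" using dw w by auto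
  have ne: "chord_of e \<noteq> chord_of x" if e: "e \<in> set u" for e
  proof
    assume c: "chord_of e = chord_of x"
    have "e \<noteq> x" using e xu by auto
    have ord: "precedes w e x" "\<not> precedes w x e" "\<not> precedes (x # w') e x" "precedes (x # w') x e"
      using e xu \<open>e \<noteq> x\<close> by (auto simp: w precedes_append dest: precedes_in_set)
    have mem: "e \<in> set w" "x \<in> set w" using e w by auto
    show False
    proof (cases x)
      case (Initial d)
      then have "e = Terminal d" using c \<open>e \<noteq> x\<close> by (cases e rule: endpoint.exhaust) auto
      then show False using Cons.prems(4)[of d] Initial mem ord by simp
    next
      case (Terminal d)
      then have "e = Initial d" using c \<open>e \<noteq> x\<close> by (cases e rule: endpoint.exhaust) auto
      then show False using Cons.prems(4)[of d] Terminal mem ord by simp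
    qed
  qed
  have 1: "zequiv (Ds1 @ (a @ w) # Ds2) z (Ds1 @ (a @ x # u @ v) # Ds2) z"
    unfolding w by (rule zequiv_move_front) (use Cons.prems(1) w ne in auto)
  have "zequiv (Ds1 @ ((a @ [x]) @ (u @ v)) # Ds2) z (Ds1 @ ((a @ [x]) @ w') # Ds2) z"
  proof (rule Cons.IH)
    show "gauss_diagram 2 (Ds1 @ ((a @ [x]) @ (u @ v)) # Ds2)" using zequivD(2)[OF 1] by simp
    show "set (u @ v) = set w'" using Cons.prems(2,3) xu w by auto
    show "distinct w'" using Cons.prems(3) by simp
    fix c assume m: "Initial c \<in> set (u @ v)" "Terminal c \<in> set (u @ v)"
    then have n: "x \<noteq> Initial c" "x \<noteq> Terminal c" using xu by auto
    have "precedes (u @ v) (Terminal c) (Initial c) \<longleftrightarrow> precedes w (Terminal c) (Initial c)"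
      using n by (auto simp: w precedes_append)
    also have "\<dots> \<longleftrightarrow> precedes (x # w') (Terminal c) (Initial c)"
      by (rule Cons.prems(4)) (use m w in auto)
    also have "\<dots> \<longleftrightarrow> precedes w' (Terminal c) (Initial c)" using n by auto
    finally show "precedes (u @ v) (Terminal c) (Initial c) \<longleftrightarrow> precedes w' (Terminal c) (Initial c)" .
  qed
  then show ?case using 1 by (auto intro: zequiv_trans)
qed

lemma zequiv_permute:
  assumes v: "gauss_diagram 2 [w1, w2]" and s: "set w1 = set w1'" "set w2 = set w2'"
    and d: "distinct w1'" "distinct w2'"
    and o1: "\<And>c. Initial c \<in> set w1 \<Longrightarrow> Terminal c \<in> set w1 \<Longrightarrow>
       precedes w1 (Terminal c) (Initial c) \<longleftrightarrow> precedes w1' (Terminal c) (Initial c)"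
    and o2: "\<And>c. Initial c \<in> set w2 \<Longrightarrow> Terminal c \<in> set w2 \<Longrightarrow>
       precedes w2 (Terminal c) (Initial c) \<longleftrightarrow> precedes w2' (Terminal c) (Initial c)"
  shows "zequiv [w1, w2] z [w1', w2'] z"
proof -
  have 1: "zequiv [w1, w2] z [w1', w2] z"
    using zequiv_permute_word[of "[]" "[]" w1 "[w2]" w1' z] v s d o1 by simp
  have "zequiv [w1', w2] z [w1', w2'] z"
    using zequiv_permute_word[of "[w1']" "[]" w2 "[]" w2' z] zequivD(2)[OF 1] s d o2 by simp
  with 1 show ?thesis by (rule zequiv_trans)
qed

section \<open>Standard diagrams\<close>

lemma zequiv_rotate1:
  assumes v: "gauss_diagram 2 D" and D: "D = [w1, w2]"
    and D': "D' = [rotate1 w1, w2] \<and> w = w1 \<or> D' = [w1, rotate1 w2] \<and> w = w2"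
    and w: "w = x # u"
  shows "zequiv D z D' (\<lambda>c. z c +
      (if Initial c \<in> set w then endpoint_sign x - (if Initial c = x then sign_sum w else 0) else 0) -
      (if Terminal c \<in> set w then endpoint_sign x - (if Terminal c = x then sign_sum w else 0) else 0))"
proof (rule zequivI)
  note ri = rotate1_index[OF v D D' w]
  have "rotated D D'" using D' rotated_twoI unfolding D by auto
  then show "dequiv D (weight_of D z) D' (weight_of D z)" by (rule dequiv_rotated[OF v])
  fix c assume "c \<in> chords D'"
  then show "lifted_index D' (weight_of D z) c = z c +
      (if Initial c \<in> set w then endpoint_sign x - (if Initial c = x then sign_sum w else 0) else 0) -
      (if Terminal c \<in> set w then endpoint_sign x - (if Terminal c = x then sign_sum w else 0) else 0)"
    unfolding ri(2) using lifted_index_rotate1[OF v D D' w, of c "weight_of D z"] by simp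
qed

lemma zequiv_lambda: "zequiv D z D' z' \<Longrightarrow> lambda_diagram D' = lambda_diagram D"
  by (simp add: zequiv_def dequiv_def S_agree_def)

text \<open>
  A chord \<open>c\<close> of type \<open>(s, t)\<close>.
\<close>

type_synonym entry = "chord \<times> nat \<times> nat"

definition word_of :: "nat \<Rightarrow> entry list \<Rightarrow> chord endpoint list" where
  "word_of i xs = concat (map (\<lambda>(c, s, t).
     (if s = i then [Initial c] else []) @ (if t = i then [Terminal c] else [])) xs)"

text \<open>
  A representative of all diagrams with these chords in which every self-chord starts before it
  ends.
\<close>

definition std :: "entry list \<Rightarrow> gauss" where
  "std xs = [word_of 1 xs, word_of 2 xs]"

definition proper :: "entry list \<Rightarrow> bool" where
  "proper xs \<longleftrightarrow> distinct (map fst xs) \<and> (\<forall>(c, s, t)\<in>set xs. s \<in> {1, 2} \<and> t \<in> {1, 2})"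

lemma word_of_simps [simp]:
  "word_of i [] = []"
  "word_of i ((c, s, t) # xs) =
     (if s = i then [Initial c] else []) @ (if t = i then [Terminal c] else []) @ word_of i xs"
  by (simp_all add: word_of_def)

lemma in_word_of:
  "Initial c \<in> set (word_of i xs) \<longleftrightarrow> (\<exists>t. (c, i, t) \<in> set xs)"
  "Terminal c \<in> set (word_of i xs) \<longleftrightarrow> (\<exists>s. (c, s, i) \<in> set xs)"
  by (induction xs) auto

lemma properD: "proper xs \<Longrightarrow> (c, s, t) \<in> set xs \<Longrightarrow> s \<in> {1, 2} \<and> t \<in> {1, 2}"
  by (auto simp: proper_def)

lemma proper_unique: "proper xs \<Longrightarrow> (c, st) \<in> set xs \<Longrightarrow> (c, st') \<in> set xs \<Longrightarrow> st = st'"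
  unfolding proper_def by (metis eq_key_imp_eq_value)

lemma in_word_of_entry:
  assumes x: "proper xs" and d: "(d, s, t) \<in> set xs"
  shows "Initial d \<in> set (word_of i xs) \<longleftrightarrow> s = i" "Terminal d \<in> set (word_of i xs) \<longleftrightarrow> t = i"
proof -
  have "s = i \<and> t = t'" if "(d, i, t') \<in> set xs" for t' using proper_unique[OF x d that] by simp
  then show "Initial d \<in> set (word_of i xs) \<longleftrightarrow> s = i" using d unfolding in_word_of by blast
  have "s = s' \<and> t = i" if "(d, s', i) \<in> set xs" for s' using proper_unique[OF x d that] by simp
  then show "Terminal d \<in> set (word_of i xs) \<longleftrightarrow> t = i" using d unfolding in_word_of by blast
qed

lemma proper_Cons: "proper ((c, s, t) # xs) \<longleftrightarrow> proper xs \<and> c \<notin> fst ` set xs \<and> s \<in> {1, 2} \<and> t \<in> {1, 2}"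
  by (auto simp: proper_def)

lemma proper_mset:
  assumes "mset xs = mset ys"
  shows "proper xs \<longleftrightarrow> proper ys"
proof -
  have "mset (map fst xs) = mset (map fst ys)" using assms by simp
  then have "distinct (map fst xs) \<longleftrightarrow> distinct (map fst ys)" by (rule mset_eq_imp_distinct_iff)
  moreover have "set xs = set ys" using assms by (rule mset_eq_setD)
  ultimately show ?thesis by (simp add: proper_def)
qed

lemma not_in_word_of:
  assumes "c \<notin> fst ` set xs"
  shows "Initial c \<notin> set (word_of i xs)" "Terminal c \<notin> set (word_of i xs)"
  using assms by (force simp: in_word_of)+

lemma distinct_word_of: "proper xs \<Longrightarrow> distinct (word_of i xs)"
proof (induction xs)
  case (Cons e xs)
  obtain c s t where e: "e = (c, s, t)" by (cases e) auto
  show ?case using Cons not_in_word_of[of c xs i] by (auto simp: e proper_Cons)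
qed simp

lemma word_of_order:
  assumes "proper xs"
  shows "\<not> precedes (word_of i xs) (Terminal c) (Initial c) \<or> Initial c \<notin> set (word_of i xs)"
  using assms
proof (induction xs)
  case (Cons e xs)
  obtain d s t where e: "e = (d, s, t)" by (cases e) auto
  have xs: "proper xs" "d \<notin> fst ` set xs" using Cons.prems by (auto simp: e proper_Cons)
  show ?case using Cons.IH[OF xs(1)] not_in_word_of[OF xs(2), of i]
    by (cases "c = d") (auto simp: e precedes_append dest: precedes_in_set)
qed simp

lemma in_word_of_all:
  assumes "proper xs"
  shows "Initial c \<in> set (word_of 1 xs) \<union> set (word_of 2 xs) \<longleftrightarrow> (\<exists>s t. (c, s, t) \<in> set xs)"
    "Terminal c \<in> set (word_of 1 xs) \<union> set (word_of 2 xs) \<longleftrightarrow> (\<exists>s t. (c, s, t) \<in> set xs)"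
  unfolding Un_iff in_word_of using properD[OF assms, of c] by blast+

lemma gauss_diagram_std:
  assumes "proper xs"
  shows "gauss_diagram 2 (std xs)"
proof -
  have "set (word_of 1 xs) \<inter> set (word_of 2 xs) = {}"
  proof (rule ccontr)
    assume "set (word_of 1 xs) \<inter> set (word_of 2 xs) \<noteq> {}"
    then obtain e where e: "e \<in> set (word_of 1 xs)" "e \<in> set (word_of 2 xs)" by blast
    show False
    proof (cases e)
      case (Initial c)
      then obtain t t' where "(c, 1, t) \<in> set xs" "(c, 2, t') \<in> set xs"
        using e in_word_of(1) by metis
      then show False using proper_unique[OF assms] by fastforce
    next
      case (Terminal c)
      then obtain t t' where "(c, t, 1) \<in> set xs" "(c, t', 2) \<in> set xs"
        using e in_word_of(2) by metis
      then show False using proper_unique[OF assms] by fastforce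
    qed
  qed
  moreover have "Initial c \<in> set (concat (std xs)) \<longleftrightarrow> Terminal c \<in> set (concat (std xs))" for c
    using in_word_of_all[OF assms, of c] by (simp add: std_def)
  ultimately show ?thesis
    using distinct_word_of[OF assms] unfolding gauss_diagram_def by (simp add: std_def)
qed

lemma chords_std:
  assumes "proper xs"
  shows "c \<in> chords (std xs) \<longleftrightarrow> (\<exists>s t. (c, s, t) \<in> set xs)"
  unfolding chords_iff(1)[OF gauss_diagram_std[OF assms]]
  using in_word_of_all(1)[OF assms, of c] by (simp add: std_def)

lemma types_std:
  assumes "proper xs" "i \<in> {1, 2}" "j \<in> {1, 2}"
  shows "chords_of_type (std xs) i j = {c. (c, i, j) \<in> set xs}"
proof -
  have "circle (std xs) i = word_of i xs" "circle (std xs) j = word_of j xs"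
    using assms(2,3) by (auto simp: std_def)
  moreover have "(\<exists>t. (c, i, t) \<in> set xs) \<and> (\<exists>s. (c, s, j) \<in> set xs) \<longleftrightarrow> (c, i, j) \<in> set xs" for c
    using proper_unique[OF assms(1), of c] by blast
  ultimately show ?thesis
    by (simp add: chords_of_type_def in_word_of)
qed

text \<open>
  The only constraint on rearranging a word is the order of the endpoints of each self-chord.
\<close>

lemma zequiv_std:
  assumes v: "gauss_diagram 2 [v1, v2]" and x: "proper xs"
    and s: "set v1 = set (word_of 1 xs)" "set v2 = set (word_of 2 xs)"
    and o1: "\<And>c. Initial c \<in> set v1 \<Longrightarrow> Terminal c \<in> set v1 \<Longrightarrow> \<not> precedes v1 (Terminal c) (Initial c)"
    and o2: "\<And>c. Initial c \<in> set v2 \<Longrightarrow> Terminal c \<in> set v2 \<Longrightarrow> \<not> precedes v2 (Terminal c) (Initial c)"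
  shows "zequiv [v1, v2] z (std xs) z"
  unfolding std_def
proof (rule zequiv_permute[OF v s])
  fix c
  show "Initial c \<in> set v1 \<Longrightarrow> Terminal c \<in> set v1 \<Longrightarrow> precedes v1 (Terminal c) (Initial c) \<longleftrightarrow>
      precedes (word_of 1 xs) (Terminal c) (Initial c)"
    using o1 word_of_order[OF x] s by blast
  show "Initial c \<in> set v2 \<Longrightarrow> Terminal c \<in> set v2 \<Longrightarrow> precedes v2 (Terminal c) (Initial c) \<longleftrightarrow>
      precedes (word_of 2 xs) (Terminal c) (Initial c)"
    using o2 word_of_order[OF x] s by blast
qed (use distinct_word_of[OF x] in auto)

lemma std_perm:
  assumes "proper xs" "mset xs = mset ys"
  shows "zequiv (std xs) z (std ys) z"
proof -
  have y: "proper ys" using assms proper_mset by blast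
  have "set xs = set ys" using assms(2) by (rule mset_eq_setD)
  then have s: "set (word_of i xs) = set (word_of i ys)" for i
    by (auto simp: word_of_def)
  show ?thesis
    unfolding std_def[of xs]
    by (rule zequiv_std[OF _ y s s]) (use gauss_diagram_std[OF assms(1)] word_of_order[OF assms(1)] in \<open>auto simp: std_def\<close>)
qed

text \<open>
  At the beginning of a word, a self-chord of index \<open>0\<close> is isolated without weight, and one of index
  \<open>1\<close> is isolated with weight \<open>- \<epsilon>\<close>.
\<close>

lemma std_drop:
  assumes x: "proper ((c, i, i) # xs)" and z: "z c \<in> {0, 1}"
  shows "zequiv (std ((c, i, i) # xs)) z (std xs) z"
proof -
  have v: "gauss_diagram 2 (std ((c, i, i) # xs))" by (rule gauss_diagram_std[OF x])
  have "i = 1 \<or> i = 2" using x by (auto simp: proper_Cons)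
  then show ?thesis
  proof
    assume "i = 1"
    then show ?thesis
      using zequiv_delete[of "[]" "[]" "Initial c" "Terminal c" "word_of 1 xs" "[word_of 2 xs]" c z] v z
      by (simp add: std_def)
  next
    assume "i = 2"
    then show ?thesis
      using zequiv_delete[of "[word_of 1 xs]" "[]" "Initial c" "Terminal c" "word_of 2 xs" "[]" c z] v z
      by (simp add: std_def)
  qed
qed

lemma filter_word_of: "filter (\<lambda>e. chord_of e \<notin> X) (word_of i xs) = word_of i (filter (\<lambda>e. fst e \<notin> X) xs)"
  by (induction xs) auto

lemma delete_chords_std: "delete_chords X (std xs) = std (filter (\<lambda>e. fst e \<notin> X) xs)"
  by (simp add: delete_chords_def std_def filter_word_of)

text \<open>
  With equal indices, parallel chords of opposite signs have opposite weights.
\<close>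

lemma std_cancel:
  assumes x: "proper ((c, s, t) # (d, s, t) # xs)" and z: "z c = z d" and sg: "sg d = - sg c"
  shows "zequiv (std ((c, s, t) # (d, s, t) # xs)) z (std xs) z"
proof -
  let ?D = "std ((c, s, t) # (d, s, t) # xs)"
  have v: "gauss_diagram 2 ?D" by (rule gauss_diagram_std[OF x])
  have cd: "c \<noteq> d" using sg by auto
  have "filter (\<lambda>e. fst e \<notin> {c, d}) xs = xs"
    using x by (intro filter_True) (auto simp: proper_Cons)
  then have k: "delete_chords {c, d} ?D = std xs" by (simp add: delete_chords_std)
  have st: "s \<in> {1, 2}" "t \<in> {1, 2}" using x by (auto simp: proper_Cons)
  show ?thesis
  proof (cases "s = t")
    case False
    then have "next_in ?D (Initial c) (Initial d)" "next_in ?D (Terminal c) (Terminal d)"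
      using st by (auto simp: std_def next_in_def)
    from zequiv_delete_parallel[OF v sg z this] show ?thesis unfolding k .
  next
    case True
    show ?thesis
    proof -
      obtain Ds1 Ds2 where D: "?D = Ds1 @ ([Initial c] @ Terminal c # Initial d # Terminal d # word_of s xs) # Ds2"
        using True st by (auto simp: std_def intro: that[of "[]" "[word_of 2 xs]"] that[of "[word_of 1 xs]" "[]"])
      let ?E = "Ds1 @ ([Initial c] @ Initial d # Terminal c # Terminal d # word_of s xs) # Ds2"
      have 1: "zequiv ?D z ?E z"
        unfolding D by (rule zequiv_swap) (use v D cd in auto)
      have "next_in ?E (Initial c) (Initial d)" "next_in ?E (Terminal c) (Terminal d)" by (auto simp: next_in_def)
      from zequiv_delete_parallel[OF zequivD(2)[OF 1] sg z this]
      have "zequiv ?E z (delete_chords {c, d} ?E) z" .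
      moreover have "delete_chords {c, d} ?E = delete_chords {c, d} ?D" unfolding D by (simp add: delete_chords_def)
      ultimately show ?thesis using 1 unfolding k by (auto intro: zequiv_trans)
    qed
  qed
qed

text \<open>
  It is \<open>1\<close> for type \<open>(1, 2)\<close>, \<open>-1\<close> for type \<open>(2, 1)\<close>, and \<open>0\<close> for self-chords: the direction in which a
  rotation shifts the index.
\<close>

definition type_shift :: "entry list \<Rightarrow> chord \<Rightarrow> int" where
  "type_shift xs c = (case map_of xs c of None \<Rightarrow> 0 | Some (s, t) \<Rightarrow> int t - int s)"

lemma type_shift_eq: "proper xs \<Longrightarrow> (c, s, t) \<in> set xs \<Longrightarrow> type_shift xs c = int t - int s"
  unfolding type_shift_def proper_def by (simp add: map_of_is_SomeI)

lemma sign_sum_std: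
  assumes "proper xs"
  shows "sign_sum (word_of 1 xs) = - lambda_diagram (std xs)" "sign_sum (word_of 2 xs) = lambda_diagram (std xs)"
  using sign_sum_circle[OF gauss_diagram_std[OF assms]] by (simp_all add: std_def)

text \<open>
  Push the endpoint of \<open>c\<close> on the first circle once around the circle by rotating it to the end of the
  word and sorting it back.
\<close>

lemma std_shift1:
  assumes x: "proper ((c, s, t) # xs)" and st: "s \<noteq> t"
  shows "zequiv (std ((c, s, t) # xs)) z (std ((c, s, t) # xs))
    (\<lambda>d. z d - sg c * (int t - int s) * type_shift ((c, s, t) # xs) d +
      (if d = c then (int t - int s) * lambda_diagram (std ((c, s, t) # xs)) else 0))"
proof -
  let ?xs = "(c, s, t) # xs"
  have st': "s = 1 \<and> t = 2 \<or> s = 2 \<and> t = 1" using x st by (auto simp: proper_Cons)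
  define e where "e = (if s = 1 then Initial c else Terminal c)"
  have w: "word_of 1 ?xs = e # word_of 1 xs" using st' by (auto simp: e_def)
  have c: "c \<notin> fst ` set xs" and xs: "proper xs" using x by (auto simp: proper_Cons)
  note v = gauss_diagram_std[OF x]
  let ?D = "[word_of 1 xs @ [e], word_of 2 ?xs]"
  let ?z = "\<lambda>d. z d +
      (if Initial d \<in> set (word_of 1 ?xs) then endpoint_sign e - (if Initial d = e then sign_sum (word_of 1 ?xs) else 0) else 0) -
      (if Terminal d \<in> set (word_of 1 ?xs) then endpoint_sign e - (if Terminal d = e then sign_sum (word_of 1 ?xs) else 0) else 0)"
  have 1: "zequiv (std ?xs) z ?D ?z"
  proof (rule zequiv_rotate1[OF v std_def _ w])
    have "rotate1 (word_of 1 ?xs) = word_of 1 xs @ [e]" unfolding w by simp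
    then show "?D = [rotate1 (word_of 1 ?xs), word_of 2 ?xs] \<and> word_of 1 ?xs = word_of 1 ?xs \<or>
      ?D = [word_of 1 ?xs, rotate1 (word_of 2 ?xs)] \<and> word_of 1 ?xs = word_of 2 ?xs"
      by (simp only: simp_thms)
  qed
  have ne: "Initial d = e \<longleftrightarrow> d = c \<and> s = 1" "Terminal d = e \<longleftrightarrow> d = c \<and> s = 2" for d
    using st' by (auto simp: e_def)
  have o1: "\<not> precedes (word_of 1 xs @ [e]) (Terminal d) (Initial d)"
    if "Initial d \<in> set (word_of 1 xs @ [e])" "Terminal d \<in> set (word_of 1 xs @ [e])" for d
  proof -
    have "Initial c \<notin> set (word_of 1 xs @ [e]) \<or> Terminal c \<notin> set (word_of 1 xs @ [e])"
      using not_in_word_of[OF c, of 1] st' by (auto simp: e_def)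
    then have "d \<noteq> c" using that by auto
    then have "Initial d \<in> set (word_of 1 xs)" using that(1) ne by auto
    then show ?thesis using word_of_order[OF xs, of 1 d] by (simp add: precedes_append)
  qed
  have 2: "zequiv ?D ?z (std ?xs) ?z"
  proof (rule zequiv_std[OF zequivD(2)[OF 1] x _ refl o1])
    show "set (word_of 1 xs @ [e]) = set (word_of 1 ?xs)" unfolding w by auto
  qed (use word_of_order[OF x, of 2] in blast)+
  have 3: "zequiv (std ?xs) ?z (std ?xs) (\<lambda>d. z d - sg c * (int t - int s) * type_shift ?xs d +
      (if d = c then (int t - int s) * lambda_diagram (std ?xs) else 0))"
  proof (rule zequiv_cong[OF v])
    fix d assume "d \<in> chords (std ?xs)"
    then obtain s' t' where d: "(d, s', t') \<in> set ?xs" using chords_std[OF x] by blast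
    have m: "Initial d \<in> set (word_of 1 ?xs) \<longleftrightarrow> s' = 1" "Terminal d \<in> set (word_of 1 ?xs) \<longleftrightarrow> t' = 1"
      using in_word_of_entry[OF x d] by blast+
    have dc: "s' = s \<and> t' = t" if "d = c"
    proof -
      have "(c, s', t') \<in> set ?xs" using d unfolding that .
      from proper_unique[OF x this list.set_intros(1)] show ?thesis by (simp only: prod.inject)
    qed
    have s't': "s' \<in> {1, 2}" "t' \<in> {1, 2}" using properD[OF x d] by auto
    have ts: "type_shift ?xs d = int t' - int s'" by (rule type_shift_eq[OF x d])
    have tot: "sign_sum (word_of 1 ?xs) = - lambda_diagram (std ?xs)" by (rule sign_sum_std(1)[OF x])
    have es: "endpoint_sign e = - sg c * (int t - int s)" using st' by (auto simp: e_def)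
    show "z d - sg c * (int t - int s) * type_shift ?xs d +
        (if d = c then (int t - int s) * lambda_diagram (std ?xs) else 0) = ?z d"
      unfolding m ts tot ne es using s't' st' dc by (auto simp: algebra_simps)
  qed
  show ?thesis using 1 2 3 by (blast intro: zequiv_trans)
qed

text \<open>
  Shifting by \<open>1\<close> and by \<open>-1\<close> are the two directions of pushing \<open>c\<close> around; the index of \<open>c\<close> itself
  pays for each shift with a multiple of \<open>\<lambda>\<close>.
\<close>

lemma std_shift:
  assumes x: "proper xs" and c: "(c, s, t) \<in> set xs" and st: "s \<noteq> t"
  shows "zequiv (std xs) z (std xs) (\<lambda>d. z d + k * type_shift xs d -
      (if d = c then sg c * k * lambda_diagram (std xs) else 0))"
proof -
  define f where "f = (\<lambda>k z d. z d + k * type_shift xs d -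
      (if d = c then sg c * k * lambda_diagram (std xs) else 0))"
  have f_add: "f a (f b z) = f (a + b) z" for a b z by (auto simp: f_def algebra_simps)
  have f0: "f 0 z = z" for z by (auto simp: f_def)
  let ?ys = "(c, s, t) # remove1 (c, s, t) xs"
  have m: "mset xs = mset ?ys" using c by (simp add: insert_DiffM)
  have y: "proper ?ys" using x proper_mset[OF m] by simp
  have ts: "type_shift ?ys = type_shift xs"
  proof
    fix d
    have "map_of ?ys d = map_of xs d"
      using map_of_inject_set[of ?ys xs] m x y mset_eq_setD[OF m] unfolding proper_def by metis
    then show "type_shift ?ys d = type_shift xs d" by (simp add: type_shift_def)
  qed
  have lam: "lambda_diagram (std ?ys) = lambda_diagram (std xs)"
    by (rule zequiv_lambda[OF std_perm[OF x m]])
  have st': "s = 1 \<and> t = 2 \<or> s = 2 \<and> t = 1" using properD[OF x c] st by auto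
  \<comment> \<open>one push around the circle shifts by \<open>\<kappa>\<close>\<close>
  define \<kappa> where "\<kappa> = - sg c * (int t - int s)"
  have \<kappa>: "\<kappa> = 1 \<or> \<kappa> = -1" "sg c * \<kappa> = - (int t - int s)"
    using st' sg_cases[of c] by (auto simp: \<kappa>_def)
  have step: "zequiv (std xs) z (std xs) (f \<kappa> z)" for z
  proof -
    have "zequiv (std xs) z (std ?ys) z" by (rule std_perm[OF x m])
    also have "zequiv (std ?ys) z (std ?ys) (f \<kappa> z)"
    proof -
      have "f \<kappa> z = (\<lambda>d. z d - sg c * (int t - int s) * type_shift xs d +
          (if d = c then (int t - int s) * lambda_diagram (std xs) else 0))"
        by (rule ext, simp only: f_def \<kappa>(2)) (simp add: \<kappa>_def algebra_simps)
      then show ?thesis using std_shift1[OF y st, of z] unfolding ts lam by (simp only:)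
    qed
    also have "zequiv (std ?ys) (f \<kappa> z) (std xs) (f \<kappa> z)"
      by (rule std_perm[OF y m[symmetric]])
    finally show ?thesis .
  qed
  have step': "zequiv (std xs) z (std xs) (f (- \<kappa>) z)" for z
    using zequiv_sym[OF step[of "f (- \<kappa>) z"]] by (simp add: f_add f0)
  have step1: "zequiv (std xs) z (std xs) (f 1 z)" "zequiv (std xs) z (std xs) (f (- 1) z)" for z
    using step[of z] step'[of z] \<kappa>(1) by auto
  have "zequiv (std xs) z (std xs) (f k z)"
  proof (induction k rule: int_induct[where k = 0])
    case base
    then show ?case by (simp add: f0 zequiv_refl gauss_diagram_std[OF x])
  next
    case (step1 i)
    then show ?case using \<open>\<And>z. zequiv (std xs) z (std xs) (f 1 z)\<close>[of "f i z"]
      by (auto simp: f_add add.commute intro: zequiv_trans)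
  next
    case (step2 i)
    then show ?case using \<open>\<And>z. zequiv (std xs) z (std xs) (f (- 1) z)\<close>[of "f i z"]
      by (auto simp: f_add intro: zequiv_trans)
  qed
  then show ?thesis by (simp add: f_def)
qed

text \<open>
  The shifts caused by pushing \<open>c\<close> around cancel against those caused by pushing \<open>y\<close> around in the other
  direction.
\<close>

lemma std_trade:
  assumes x: "proper xs" and c: "(c, s, t) \<in> set xs" "s \<noteq> t" and y: "(y, s', t') \<in> set xs" "s' \<noteq> t'"
    and cy: "c \<noteq> y"
  shows "\<exists>b. zequiv (std xs) z (std xs)
    (z(c := z c + a * lambda_diagram (std xs), y := z y + b * lambda_diagram (std xs)))"
proof -
  let ?l = "lambda_diagram (std xs)"
  let ?k = "- sg c * a"
  let ?z = "\<lambda>d. z d + ?k * type_shift xs d - (if d = c then sg c * ?k * ?l else 0)"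
  have "zequiv (std xs) z (std xs) ?z" by (rule std_shift[OF x c])
  also have "zequiv (std xs) ?z (std xs) (\<lambda>d. ?z d + (- ?k) * type_shift xs d -
      (if d = y then sg y * (- ?k) * ?l else 0))" by (rule std_shift[OF x y])
  also have "(\<lambda>d. ?z d + (- ?k) * type_shift xs d - (if d = y then sg y * (- ?k) * ?l else 0)) =
      z(c := z c + a * ?l, y := z y + (sg y * ?k) * ?l)"
    using cy by (auto simp: fun_eq_iff)
  finally show ?thesis by blast
qed

text \<open>
  Rotating the initial endpoint of \<open>c\<close> to the end of its word lowers the index of \<open>c\<close> by the sum of the
  signs on the circle. Then \<open>c\<close> can be deleted as in \<open>std_drop\<close>, but the rotation has shifted the
  indices of the nonself-chords.
\<close>

lemma std_drop_wrapped:
  assumes x: "proper ((c, i, i) # xs)"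
    and z: "z c - (if i = 1 then - 1 else 1) * lambda_diagram (std ((c, i, i) # xs)) \<in> {0, 1}"
  shows "\<exists>k. zequiv (std ((c, i, i) # xs)) z (std xs) (\<lambda>d. z d + k * type_shift xs d)"
proof -
  let ?xs = "(c, i, i) # xs"
  have c: "c \<notin> fst ` set xs" and xs: "proper xs" and i: "i \<in> {1, 2}" using x by (auto simp: proper_Cons)
  note v = gauss_diagram_std[OF x]
  let ?w = "word_of i ?xs" and ?u = "word_of i xs"
  have w: "?w = Initial c # Terminal c # ?u" by simp
  obtain Ds1 Ds2 where D: "\<And>w. (if i = 1 then [w, word_of 2 xs] else [word_of 1 xs, w]) = Ds1 @ w # Ds2"
    using that[of "[]" "[word_of 2 xs]"] that[of "[word_of 1 xs]" "[]"] by (cases "i = 1") auto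
  have S: "std ?xs = Ds1 @ (Initial c # Terminal c # ?u) # Ds2" "std xs = Ds1 @ ?u # Ds2"
    unfolding D[symmetric] using i by (auto simp: std_def)
  let ?D = "Ds1 @ ((Terminal c # ?u) @ [Initial c]) # Ds2"
  let ?z = "\<lambda>d. z d +
      (if Initial d \<in> set ?w then - sg c - (if Initial d = Initial c then sign_sum ?w else 0) else 0) -
      (if Terminal d \<in> set ?w then - sg c - (if Terminal d = Initial c then sign_sum ?w else 0) else 0)"
  have 1: "zequiv (std ?xs) z ?D ?z"
  proof -
    have "?D = (if i = 1 then [rotate1 ?w, word_of 2 xs] else [word_of 1 xs, rotate1 ?w])"
      unfolding D w by simp
    then have "?D = [rotate1 (word_of 1 ?xs), word_of 2 ?xs] \<and> ?w = word_of 1 ?xs \<or>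
        ?D = [word_of 1 ?xs, rotate1 (word_of 2 ?xs)] \<and> ?w = word_of 2 ?xs"
      using i by (cases "i = 1") auto
    from zequiv_rotate1[OF v std_def this w, of z] show ?thesis unfolding endpoint_sign.simps .
  qed
  have 2: "zequiv ?D ?z (Ds1 @ ([] @ Terminal c # Initial c # ?u) # Ds2) ?z"
  proof -
    have "zequiv (Ds1 @ ([Terminal c] @ ?u @ Initial c # []) # Ds2) ?z (Ds1 @ ([Terminal c] @ Initial c # ?u @ []) # Ds2) ?z"
    proof (rule zequiv_move_front)
      show "gauss_diagram 2 (Ds1 @ ([Terminal c] @ ?u @ Initial c # []) # Ds2)"
        using zequivD(2)[OF 1] by simp
      show "\<forall>e\<in>set ?u. chord_of e \<noteq> chord_of (Initial c)"
      proof
        fix e assume "e \<in> set ?u"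
        then show "chord_of e \<noteq> chord_of (Initial c)"
          using not_in_word_of[OF c, of i] by (cases e rule: endpoint.exhaust) auto
      qed
    qed
    then show ?thesis by simp
  qed
  have tot: "sign_sum ?w = (if i = 1 then - 1 else 1) * lambda_diagram (std ?xs)"
    using sign_sum_std[OF x] i by auto
  have 3: "zequiv (Ds1 @ ([] @ Terminal c # Initial c # ?u) # Ds2) ?z (Ds1 @ ([] @ ?u) # Ds2) ?z"
  proof (rule zequiv_delete)
    show "gauss_diagram 2 (Ds1 @ ([] @ Terminal c # Initial c # ?u) # Ds2)" by (rule zequivD(2)[OF 2])
    show "{Terminal c, Initial c} = {Initial c, Terminal c}" by auto
    have "?z c = z c - sign_sum ?w" by simp
    then show "?z c \<in> {0, 1}" using z unfolding tot by simp
  qed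
  let ?k = "if i = 1 then - sg c else sg c"
  have 4: "zequiv (std xs) ?z (std xs) (\<lambda>d. z d + ?k * type_shift xs d)"
  proof (rule zequiv_cong[OF gauss_diagram_std[OF xs]])
    fix d assume "d \<in> chords (std xs)"
    then obtain s' t' where d: "(d, s', t') \<in> set xs" using chords_std[OF xs] by blast
    then have dc: "d \<noteq> c" using c by force
    have m: "Initial d \<in> set ?w \<longleftrightarrow> s' = i" "Terminal d \<in> set ?w \<longleftrightarrow> t' = i"
      using in_word_of_entry[OF xs d, of i] dc unfolding w by auto
    show "z d + ?k * type_shift xs d = ?z d"
      unfolding m type_shift_eq[OF xs d] using properD[OF xs d] i dc by (auto simp: algebra_simps)
  qed
  have 3: "zequiv (Ds1 @ ([] @ Terminal c # Initial c # ?u) # Ds2) ?z (std xs) ?z"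
    using 3 unfolding S(2) append_Nil .
  show ?thesis
    by (rule exI[of _ ?k]) (rule zequiv_trans[OF 1 zequiv_trans[OF 2 zequiv_trans[OF 3 4]]])
qed

section \<open>Cancelling chords\<close>

text \<open>
  The data of a chord, apart from its sign, that the invariants can see.
\<close>

definition key :: "int \<Rightarrow> (chord \<Rightarrow> int) \<Rightarrow> entry \<Rightarrow> nat \<times> nat \<times> int" where
  "key l z e = (case e of (c, s, t) \<Rightarrow> (s, t, if s = t then z c else z c mod l))"

text \<open>
  The keys of self-chords that are isolated, or shells, up to exchanges.
\<close>

definition removable :: "int \<Rightarrow> nat \<times> nat \<times> int \<Rightarrow> bool" where
  "removable l k = (case k of (s, t, n) \<Rightarrow>
     s = t \<and> n \<in> {0, 1, (if s = 1 then -1 else 1) * l, (if s = 1 then -1 else 1) * l + 1})"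

definition key_sum :: "int \<Rightarrow> (chord \<Rightarrow> int) \<Rightarrow> entry list \<Rightarrow> nat \<times> nat \<times> int \<Rightarrow> int" where
  "key_sum l z xs k = (\<Sum>e\<leftarrow>xs. if key l z e = k then sg (fst e) else 0)"

lemma key_sum_simps [simp]:
  "key_sum l z [] k = 0"
  "key_sum l z (e # xs) k = (if key l z e = k then sg (fst e) else 0) + key_sum l z xs k"
  "key_sum l z (xs @ ys) k = key_sum l z xs k + key_sum l z ys k"
  by (simp_all add: key_sum_def)

lemma key_sum_cong:
  assumes "\<And>c. c \<in> fst ` set xs \<Longrightarrow> z' c = z c"
  shows "key_sum l z' xs k = key_sum l z xs k"
  using assms by (induction xs) (auto simp: key_def split: prod.splits)

text \<open>
  If all chords with the key of \<open>e\<close> had the sign of \<open>e\<close>, nothing could cancel it.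
\<close>

lemma opposite_entry:
  assumes "key_sum l z (e # xs) (key l z e) = 0"
  shows "\<exists>e'\<in>set xs. key l z e' = key l z e \<and> sg (fst e') = - sg (fst e)"
proof (rule ccontr)
  assume "\<not> ?thesis"
  then have "\<forall>e'\<in>set xs. key l z e' = key l z e \<longrightarrow> sg (fst e') = sg (fst e)"
    using sg_cases by (metis minus_equation_iff)
  then have "0 \<le> sg (fst e) * key_sum l z xs (key l z e)"
    by (induction xs) (auto simp: distrib_left)
  moreover have "sg (fst e) * key_sum l z (e # xs) (key l z e) = 1 + sg (fst e) * key_sum l z xs (key l z e)"
    by (simp add: distrib_left)
  ultimately show False using assms by simp
qed

lemma proper_appendD: "proper (xs @ ys) \<Longrightarrow> proper xs" "proper (xs @ ys) \<Longrightarrow> proper ys"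
  by (auto simp: proper_def)

text \<open>
  Remove the chords of \<open>us\<close> one at a time, or in pairs of opposite signs. The nonself-chord \<open>y\<close>
  absorbs all multiples of \<open>l\<close>: those by which the indices in a pair differ, and those that are needed
  to undo the shifts caused by removing a self-chord.
\<close>

lemma cancel_balanced_entries:
  assumes "proper (us @ (y, s0, t0) # ys)" "s0 \<noteq> t0" "lambda_diagram (std (us @ (y, s0, t0) # ys)) = l"
    "\<And>k. \<not> removable l k \<Longrightarrow> key_sum l z us k = 0"
  shows "\<exists>b. zequiv (std (us @ (y, s0, t0) # ys)) z (std ((y, s0, t0) # ys)) (z(y := z y + b * l))"
  using assms(1,3,4)
proof (induction "length us" arbitrary: us z rule: less_induct)
  case less
  note x = less.prems(1) and lam = less.prems(2) and zero = less.prems(3)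
  let ?Y = "(y, s0, t0) # ys"
  show ?case
  proof (cases us)
    case Nil
    then show ?thesis using zequiv_refl[OF gauss_diagram_std[OF x]] by (intro exI[of _ 0]) simp
  next
    case (Cons e vs)
    obtain c s t where e: "e = (c, s, t)" by (cases e) auto
    have x': "proper ((c, s, t) # vs @ ?Y)" using x by (simp add: Cons e)
    have xv: "proper (vs @ ?Y)" using x' by (simp add: proper_Cons)
    have cy: "c \<noteq> y" "c \<notin> fst ` set vs" using x' by (auto simp: proper_Cons)
    have yv: "y \<notin> fst ` set vs" using xv by (auto simp: proper_def)
    have yin: "(y, s0, t0) \<in> set (vs @ ?Y)" by simp
    show ?thesis
    proof (cases "removable l (key l z e)")
      case True
      then have st: "s = t" by (simp add: removable_def key_def e split: if_splits)
      have z: "z c \<in> {0, 1} \<or> z c - (if s = 1 then -1 else 1) * l \<in> {0, 1}"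
        using True by (auto simp: removable_def key_def e)
      have "\<exists>b. zequiv (std (us @ ?Y)) z (std (vs @ ?Y)) (z(y := z y + b * l))"
      proof (cases "z c \<in> {0, 1}")
        case True
        then show ?thesis
          using std_drop[of c s "vs @ ?Y" z] x' by (intro exI[of _ 0]) (simp add: Cons e st)
      next
        case False
        then have z': "z c - (if s = 1 then - 1 else 1) * lambda_diagram (std ((c, s, s) # vs @ ?Y)) \<in> {0, 1}"
          using z lam by (auto simp: Cons e st)
        have "proper ((c, s, s) # vs @ ?Y)" using x' st by simp
        from std_drop_wrapped[where z = z, OF this z'] obtain k where
          k: "zequiv (std (us @ ?Y)) z (std (vs @ ?Y)) (\<lambda>d. z d + k * type_shift (vs @ ?Y) d)"
          by (auto simp: Cons e st)
        have l: "lambda_diagram (std (vs @ ?Y)) = l" using zequiv_lambda[OF k] lam by simp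
        let ?z = "\<lambda>d. z d + k * type_shift (vs @ ?Y) d"
        have "zequiv (std (vs @ ?Y)) ?z (std (vs @ ?Y)) (\<lambda>d. ?z d + (- k) * type_shift (vs @ ?Y) d -
            (if d = y then sg y * (- k) * l else 0))"
          using std_shift[OF xv yin assms(2), of ?z "- k"] unfolding l .
        also have "(\<lambda>d. ?z d + (- k) * type_shift (vs @ ?Y) d - (if d = y then sg y * (- k) * l else 0)) =
            z(y := z y + (sg y * k) * l)" by (auto simp: fun_eq_iff)
        finally show ?thesis using zequiv_trans[OF k] by blast
      qed
      then obtain b where b: "zequiv (std (us @ ?Y)) z (std (vs @ ?Y)) (z(y := z y + b * l))" by blast
      let ?z = "z(y := z y + b * l)"
      have "\<exists>b'. zequiv (std (vs @ ?Y)) ?z (std ?Y) (?z(y := ?z y + b' * l))"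
      proof (rule less.hyps)
        show "length vs < length us" by (simp add: Cons)
        show "lambda_diagram (std (vs @ ?Y)) = l" using zequiv_lambda[OF b] lam by simp
        fix k assume k: "\<not> removable l k"
        then have "key_sum l z vs k = key_sum l z us k" using True by (auto simp: Cons)
        moreover have "key_sum l ?z vs k = key_sum l z vs k"
          by (rule key_sum_cong) (use yv in auto)
        ultimately show "key_sum l ?z vs k = 0" using zero[OF k] by simp
      qed (rule xv)
      then obtain b' where "zequiv (std (vs @ ?Y)) ?z (std ?Y) (?z(y := ?z y + b' * l))" by blast
      from zequiv_trans[OF b this] show ?thesis
        by (intro exI[of _ "b + b'"]) (simp add: algebra_simps)
    next
      case False
      have "key_sum l z (e # vs) (key l z e) = 0" using zero[OF False] by (simp only: Cons)
      from opposite_entry[OF this] obtain e' where e': "e' \<in> set vs" "key l z e' = key l z e"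
        "sg (fst e') = - sg (fst e)" by blast
      obtain d where ed: "e' = (d, s, t)" and sgd: "sg d = - sg c"
      proof -
        obtain d s' t' where e2: "e' = (d, s', t')" by (rule prod_cases3)
        have "s' = s \<and> t' = t" "sg d = - sg c" using e'(2,3) by (simp_all add: e2 e key_def)
        then show thesis using that e2 by simp
      qed
      obtain us1 us2 where vs: "vs = us1 @ (d, s, t) # us2" using split_list e'(1) ed by metis
      have dn: "d \<noteq> c" "d \<noteq> y" "d \<notin> fst ` set (us1 @ us2)" "d \<notin> fst ` set ?Y"
      proof -
        have "distinct (map fst ((c, s, t) # (us1 @ (d, s, t) # us2) @ ?Y))"
          using x' unfolding proper_def vs by (rule conjunct1)
        then have "distinct (c # map fst us1 @ d # map fst us2 @ y # map fst ys)" by simp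
        then show "d \<noteq> c" "d \<noteq> y" "d \<notin> fst ` set (us1 @ us2)" "d \<notin> fst ` set ?Y" by auto
      qed
      have din: "(d, s, t) \<in> set (us @ ?Y)" "(y, s0, t0) \<in> set (us @ ?Y)" by (auto simp: Cons vs)
      have "\<exists>b. zequiv (std (us @ ?Y)) z (std (us @ ?Y)) (z(d := z c, y := z y + b * l))"
      proof (cases "s = t")
        case True
        then have "z d = z c" using e'(2) by (simp add: key_def e ed)
        then have "z(d := z c, y := z y + 0 * l) = z" by (auto simp: fun_eq_iff)
        then show ?thesis using zequiv_refl[OF gauss_diagram_std[OF x]] by metis
      next
        case False
        then have "z c mod l = z d mod l" using e'(2) by (simp add: key_def e ed)
        then obtain a where a: "z c - z d = l * a" unfolding mod_eq_dvd_iff by (auto elim: dvdE)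
        then have "z d + a * l = z c" by (simp add: algebra_simps)
        then show ?thesis
          using std_trade[OF x din(1) False din(2) assms(2) dn(2), of z a] unfolding lam by simp
      qed
      then obtain b where b: "zequiv (std (us @ ?Y)) z (std (us @ ?Y)) (z(d := z c, y := z y + b * l))"
        by blast
      let ?z = "z(d := z c, y := z y + b * l)"
      have m: "mset (us @ ?Y) = mset ((c, s, t) # (d, s, t) # (us1 @ us2) @ ?Y)"
        by (simp add: Cons e vs)
      have x2: "proper ((c, s, t) # (d, s, t) # (us1 @ us2) @ ?Y)" using x proper_mset[OF m] by simp
      note b
      also have "zequiv (std (us @ ?Y)) ?z (std ((c, s, t) # (d, s, t) # (us1 @ us2) @ ?Y)) ?z"
        by (rule std_perm[OF x m])
      also have "zequiv (std ((c, s, t) # (d, s, t) # (us1 @ us2) @ ?Y)) ?z (std ((us1 @ us2) @ ?Y)) ?z"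
        by (rule std_cancel[OF x2 _ sgd]) (use dn cy in simp)
      finally have c1: "zequiv (std (us @ ?Y)) z (std ((us1 @ us2) @ ?Y)) ?z" .
      have x3: "proper ((us1 @ us2) @ ?Y)" using x2 by (simp add: proper_Cons)
      have "\<exists>b'. zequiv (std ((us1 @ us2) @ ?Y)) ?z (std ?Y) (?z(y := ?z y + b' * l))"
      proof (rule less.hyps[OF _ x3])
        show "length (us1 @ us2) < length us" by (simp add: Cons vs)
        show "lambda_diagram (std ((us1 @ us2) @ ?Y)) = l" using zequiv_lambda[OF c1] lam by simp
        fix k assume k: "\<not> removable l k"
        have "key l z (d, s, t) = key l z (c, s, t)" using e'(2) by (simp add: e ed)
        then have "key_sum l z us k = key_sum l z (us1 @ us2) k"
          using sgd by (simp add: Cons vs e)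
        moreover have "key_sum l ?z (us1 @ us2) k = key_sum l z (us1 @ us2) k"
          by (rule key_sum_cong) (use dn yv vs in auto)
        ultimately show "key_sum l ?z (us1 @ us2) k = 0" using zero[OF k] by simp
      qed
      then obtain b' where c2: "zequiv (std ((us1 @ us2) @ ?Y)) ?z (std ?Y) (?z(y := ?z y + b' * l))"
        by blast
      have xY: "proper ?Y" using x3 proper_appendD by blast
      have c3: "zequiv (std ?Y) (?z(y := ?z y + b' * l)) (std ?Y) (z(y := z y + (b + b') * l))"
      proof (rule zequiv_cong[OF gauss_diagram_std[OF xY]])
        fix f assume "f \<in> chords (std ?Y)"
        then have "f \<in> fst ` set ?Y" using chords_std[OF xY] by force
        then have "f \<noteq> d" using dn(4) by blast
        then show "(z(y := z y + (b + b') * l)) f = (?z(y := ?z y + b' * l)) f"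
          by (simp add: algebra_simps)
      qed
      show ?thesis using zequiv_trans[OF c1 zequiv_trans[OF c2 c3]] by blast
    qed
  qed
qed

text \<open>
  Opposite pairs can be inserted as well as cancelled.
\<close>

lemma std_double:
  assumes n: "\<And>c. c \<in> fst ` set ys \<Longrightarrow> sg (n c) = - sg c \<and> z (n c) = z c"
    and x: "proper (xs @ map (\<lambda>(c, st). (n c, st)) ys @ ys)"
  shows "zequiv (std xs) z (std (xs @ map (\<lambda>(c, st). (n c, st)) ys @ ys)) z"
  using assms
proof (induction ys)
  case Nil
  then show ?case by (simp add: zequiv_refl gauss_diagram_std)
next
  case (Cons e ys)
  obtain c s t where e: "e = (c, s, t)" by (cases e) auto
  let ?N = "map (\<lambda>(c, st). (n c, st))"
  let ?X = "xs @ ?N (e # ys) @ e # ys"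
  have m: "mset ((n c, s, t) # (c, s, t) # xs @ ?N ys @ ys) = mset ?X" by (simp add: e)
  have x: "proper ((n c, s, t) # (c, s, t) # xs @ ?N ys @ ys)"
    using proper_mset[OF m] Cons.prems(2) by simp
  then have x': "proper (xs @ ?N ys @ ys)" by (simp add: proper_Cons)
  have nc: "sg (n c) = - sg c" "z (n c) = z c" using Cons.prems(1)[of c] by (auto simp: e)
  have "zequiv (std xs) z (std (xs @ ?N ys @ ys)) z"
    by (rule Cons.IH) (use Cons.prems(1) x' in auto)
  also have "zequiv (std (xs @ ?N ys @ ys)) z (std ((n c, s, t) # (c, s, t) # xs @ ?N ys @ ys)) z"
    by (rule zequiv_sym[OF std_cancel[OF x]]) (use nc in auto)
  also have "zequiv (std ((n c, s, t) # (c, s, t) # xs @ ?N ys @ ys)) z (std ?X) z"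
    by (rule std_perm[OF x m])
  finally show ?case .
qed

lemma key_sum_eq:
  assumes x: "proper xs"
  shows "key_sum l z xs (s, t, n) =
    (\<Sum>c | (c, s, t) \<in> set xs \<and> (if s = t then z c else z c mod l) = n. sg c)"
proof -
  let ?A = "{c. (c, s, t) \<in> set xs \<and> (if s = t then z c else z c mod l) = n}"
  have "distinct xs" using x by (auto simp: proper_def distinct_map)
  then have "key_sum l z xs (s, t, n) = (\<Sum>e\<in>set xs. if key l z e = (s, t, n) then sg (fst e) else 0)"
    unfolding key_sum_def by (rule sum_list_distinct_conv_sum_set)
  also have "\<dots> = (\<Sum>e\<in>set xs \<inter> {e. key l z e = (s, t, n)}. sg (fst e))"
    by (simp add: sum.inter_restrict)
  also have "set xs \<inter> {e. key l z e = (s, t, n)} = (\<lambda>c. (c, s, t)) ` ?A"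
    by (auto simp: key_def image_iff)
  also have "(\<Sum>e\<in>(\<lambda>c. (c, s, t)) ` ?A. sg (fst e)) = (\<Sum>c\<in>?A. sg c)"
    by (subst sum.reindex) (auto simp: inj_on_def)
  finally show ?thesis .
qed

lemma self_writhe_std:
  assumes x: "proper xs" and i: "i \<in> {1, 2}"
  shows "self_writhe (std xs) (weight_of (std xs) z) i n = key_sum l z xs (i, i, n)"
proof -
  note v = gauss_diagram_std[OF x]
  have "Ind_self (std xs) i c - sg c * weight_of (std xs) z c = z c" if c: "c \<in> chords_of_type (std xs) i i" for c
  proof -
    have "(c, i, i) \<in> set xs" using c types_std[OF x i i] by simp
    then have m: "Initial c \<in> set (word_of i xs)" "Terminal c \<in> set (word_of i xs)"
      using in_word_of_entry[OF x] by blast+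
    then have "\<not> precedes (word_of i xs) (Terminal c) (Initial c)" using word_of_order[OF x] by blast
    moreover have "Initial c \<notin> set (word_of 1 xs)" "Terminal c \<notin> set (word_of 1 xs)" if "i = 2"
      using that in_word_of_entry[OF x \<open>(c, i, i) \<in> set xs\<close>, of 1] by auto
    ultimately have "\<not> precedes (concat (std xs)) (Terminal c) (Initial c)"
      using i m by (auto simp: std_def precedes_append)
    then show ?thesis using Ind_self_eq[OF v i c, of "weight_of (std xs) z"] by simp
  qed
  then have "{c \<in> chords_of_type (std xs) i i. Ind_self (std xs) i c - sg c * weight_of (std xs) z c = n} =
      {c. (c, i, i) \<in> set xs \<and> (if i = i then z c else z c mod l) = n}"
    using types_std[OF x i i] by auto
  then show ?thesis unfolding self_writhe_def key_sum_eq[OF x] by (simp only:)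
qed

lemma residue_writhe_std:
  assumes x: "proper xs" and i: "i \<in> {1, 2}" and j: "j \<in> {1, 2}" and ij: "i \<noteq> j"
    and l: "lambda_diagram (std xs) = l"
  shows "residue_writhe (std xs) (weight_of (std xs) z) i j r = key_sum l z xs (i, j, r mod l)"
  unfolding residue_writhe_def key_sum_eq[OF x] types_std[OF x i j] l
  using ij by (simp add: mod_eq_dvd_iff)

lemma rotated_context: "rotated (Ds1 @ w # Ds2) (Ds1 @ rotate1 w # Ds2)"
proof -
  have "rotate1 w = rotate 1 w" by simp
  then show ?thesis unfolding rotated_def
    using rotated_refl[of Ds1] rotated_refl[of Ds2] unfolding rotated_def
    by (intro list_all2_appendI) (auto intro: exI[of _ 1])
qed

text \<open>
  Self-chords that end before they start.
\<close>

definition inverted :: "gauss \<Rightarrow> chord set" where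
  "inverted D = {c. \<exists>w\<in>set D. Initial c \<in> set w \<and> Terminal c \<in> set w \<and> precedes w (Terminal c) (Initial c)}"

text \<open>
  Bring the terminal endpoint of an inverted chord to the front of its word, and rotate it to the
  end. All other self-chords keep their order.
\<close>

lemma dequiv_no_inverted:
  assumes "gauss_diagram 2 D"
  shows "\<exists>D' m'. dequiv D m D' m' \<and> chords D' = chords D \<and> inverted D' = {}"
  using assms
proof (induction "card (inverted D)" arbitrary: D m rule: less_induct)
  case less
  note v = less.prems
  show ?case
  proof (cases "inverted D = {}")
    case True
    then show ?thesis using dequiv_refl[OF v] by blast
  next
    case False
    then obtain c w where w: "w \<in> set D" "Initial c \<in> set w" "Terminal c \<in> set w"
      "precedes w (Terminal c) (Initial c)" by (auto simp: inverted_def)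
    obtain Ds1 Ds2 where D0: "D = Ds1 @ w # Ds2" using split_list[OF w(1)] by blast
    obtain a b where wab: "w = a @ Terminal c # b" using split_list[OF w(3)] by blast
    have D: "D = Ds1 @ ([] @ a @ Terminal c # b) # Ds2" using D0 wab by simp
    have d: "distinct (concat D)" by (rule distinct_concat_gauss[OF v])
    have na: "Terminal c \<notin> set a" "Terminal c \<notin> set b" using d D by auto
    have ia: "Initial c \<notin> set a" using w(4) na
      by (auto simp: wab precedes_append dest: precedes_in_set)
    let ?z = "lifted_index D m"
    have wz: "weight_of D ?z = m" by (rule ext) (rule weight_of_lifted_index, rule refl)
    let ?D1 = "Ds1 @ (Terminal c # a @ b) # Ds2" and ?D2 = "Ds1 @ ((a @ b) @ [Terminal c]) # Ds2"
    have "\<forall>e\<in>set a. chord_of e \<noteq> chord_of (Terminal c)"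
    proof
      fix e assume "e \<in> set a"
      then show "chord_of e \<noteq> chord_of (Terminal c)"
        using na ia by (cases e rule: endpoint.exhaust) auto
    qed
    then have "zequiv D ?z (Ds1 @ ([] @ Terminal c # a @ b) # Ds2) ?z"
      unfolding D by (rule zequiv_move_front[OF v[unfolded D]])
    then have 1: "dequiv D m ?D1 (weight_of ?D1 ?z)" unfolding zequiv_def wz by simp
    have 2: "dequiv ?D1 (weight_of ?D1 ?z) ?D2 (weight_of ?D1 ?z)"
      using dequiv_rotated[OF dequivD(2)[OF 1] rotated_context] by simp
    have v2: "gauss_diagram 2 ?D2" by (rule dequivD(2)[OF 2])
    have set2: "set (concat ?D2) = set (concat D)" unfolding D by auto
    have ch: "chords ?D2 = chords D" unfolding chords_def set2 ..
    have sub: "inverted ?D2 \<subseteq> inverted D - {c}"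
    proof
      fix f assume "f \<in> inverted ?D2"
      then obtain u where u: "u \<in> set ?D2" "Initial f \<in> set u" "Terminal f \<in> set u"
        "precedes u (Terminal f) (Initial f)" unfolding inverted_def by blast
      show "f \<in> inverted D - {c}"
      proof (cases "u = (a @ b) @ [Terminal c]")
        case True
        have "f \<noteq> c"
        proof
          assume "f = c"
          then have "precedes ((a @ b) @ [Terminal c]) (Terminal c) (Initial c)" "Initial c \<in> set (a @ b)"
            using u True by auto
          then have "precedes (a @ b) (Terminal c) (Initial c)"
            by (simp only: precedes_append[of "a @ b"] if_True)
          then have "Terminal c \<in> set (a @ b)" by (rule precedes_in_set)
          then show False using na by auto
        qed
        then have "Initial f \<in> set w" "Terminal f \<in> set w" "precedes w (Terminal f) (Initial f)"
          using u True by (auto simp: wab precedes_append split: if_splits)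
        then show ?thesis using \<open>f \<noteq> c\<close> w(1) by (auto simp: inverted_def)
      next
        case False
        then have "u \<in> set Ds1 \<union> set Ds2" using u(1) by auto
        then have "u \<in> set D" "Terminal c \<notin> set u" using d unfolding D by auto
        then show ?thesis using u by (auto simp: inverted_def)
      qed
    qed
    have "c \<in> inverted D" using w by (auto simp: inverted_def)
    moreover have fin: "finite (inverted D)"
    proof (rule finite_subset[OF _ finite_chords[of D]])
      show "inverted D \<subseteq> chords D"
      proof
        fix f assume "f \<in> inverted D"
        then have "Initial f \<in> set (concat D)" unfolding inverted_def by auto
        then show "f \<in> chords D" by (rule chords_iff(1)[OF v, THEN iffD2])
      qed
    qed
    ultimately have "inverted ?D2 \<subset> inverted D" using sub by blast
    from psubset_card_mono[OF fin this] have "card (inverted ?D2) < card (inverted D)" .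
    from less.hyps[OF this v2, of "weight_of ?D1 ?z"] obtain D' m' where
      D': "dequiv ?D2 (weight_of ?D1 ?z) D' m'" "chords D' = chords ?D2" "inverted D' = {}" by blast
    have "dequiv D m D' m'" by (rule dequiv_trans[OF 1 dequiv_trans[OF 2 D'(1)]])
    moreover have "chords D' = chords D" using D'(2) ch by (rule trans)
    ultimately show ?thesis using D'(3) by blast
  qed
qed

text \<open>
  Once no self-chord is inverted, the diagram is a rearrangement of the standard diagram with the same
  chords.
\<close>

lemma dequiv_std:
  assumes v: "gauss_diagram 2 D"
  shows "\<exists>xs z. proper xs \<and> fst ` set xs = chords D \<and> dequiv D m (std xs) (weight_of (std xs) z)"
proof -
  obtain D' m' where D': "dequiv D m D' m'" "chords D' = chords D" "inverted D' = {}"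
    using dequiv_no_inverted[OF v] by blast
  have v': "gauss_diagram 2 D'" by (rule dequivD(2)[OF D'(1)])
  obtain v1 v2 where vv: "D' = [v1, v2]" and dv: "distinct v1" "distinct v2" "set v1 \<inter> set v2 = {}"
    and ci: "\<And>c. Initial c \<in> set v1 \<union> set v2 \<longleftrightarrow> Terminal c \<in> set v1 \<union> set v2"
    using v' by (rule gauss2E) blast
  obtain cs where cs: "set cs = chords D'" "distinct cs" using finite_distinct_list[OF finite_chords] by blast
  define f where "f = (\<lambda>e. if e \<in> set v1 then 1 else 2 :: nat)"
  define xs where "xs = map (\<lambda>c. (c, f (Initial c), f (Terminal c))) cs"
  have proper: "proper xs" using cs(2) by (auto simp: proper_def xs_def f_def comp_def)
  have mem: "e \<in> set v1 \<or> e \<in> set v2 \<longleftrightarrow> chord_of e \<in> set cs" for e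
    using in_concat_iff_chord[OF v', of e] by (simp add: vv cs)
  have sw: "set v1 = set (word_of 1 xs)" "set v2 = set (word_of 2 xs)"
  proof -
    have a: "Initial c \<in> set (word_of i xs) \<longleftrightarrow> c \<in> set cs \<and> f (Initial c) = i"
      "Terminal c \<in> set (word_of i xs) \<longleftrightarrow> c \<in> set cs \<and> f (Terminal c) = i" for c i
      unfolding in_word_of xs_def by auto
    have b: "e \<in> set (word_of i xs) \<longleftrightarrow> chord_of e \<in> set cs \<and> f e = i" for e i
      by (cases e) (simp_all add: a)
    show "set v1 = set (word_of 1 xs)"
      unfolding set_eq_iff b using mem by (auto simp: f_def)
    show "set v2 = set (word_of 2 xs)"
      unfolding set_eq_iff b using mem dv(3) by (auto simp: f_def)
  qed
  \<comment> \<open>every weight is determined by the indices that it produces\<close>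
  let ?z = "lifted_index D' m'"
  have wz: "weight_of D' ?z = m'" by (rule ext) (rule weight_of_lifted_index, rule refl)
  have "zequiv [v1, v2] ?z (std xs) ?z"
    by (rule zequiv_std[OF v'[unfolded vv] proper sw]) (use D'(3) in \<open>auto simp: inverted_def vv\<close>)
  then have "dequiv D' m' (std xs) (weight_of (std xs) ?z)"
    unfolding zequiv_def vv[symmetric] wz .
  then have "dequiv D m (std xs) (weight_of (std xs) ?z)" using D'(1) dequiv_trans by blast
  moreover have "fst ` set xs = chords D" using cs D'(2) by (force simp: xs_def)
  ultimately show ?thesis using proper by blast
qed

section \<open>Completeness of the invariants\<close>

lemma chords_rename: "chords (rename f D) = f ` chords D"
proof -
  have "concat (rename f D) = map (map_endpoint f) (concat D)" by (simp add: rename_def map_concat)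
  moreover have "chord_of (map_endpoint f e) = f (chord_of e)" for e by (cases e) auto
  ultimately show ?thesis unfolding chords_def by (simp only: set_map image_image)
qed

lemma label_bound:
  assumes "finite A"
  obtains N where "\<And>c. c \<in> A \<Longrightarrow> label c < N"
proof -
  have "finite (label ` A)" using assms by simp
  then obtain N where "\<forall>n\<in>label ` A. n < N" using finite_nat_set_iff_bounded by blast
  then show thesis using that by blast
qed

lemma nonself_entry:
  assumes x: "proper xs" and l: "lambda_diagram (std xs) \<noteq> 0"
  obtains c s t where "(c, s, t) \<in> set xs" "s \<noteq> t"
proof -
  have "chords_of_type (std xs) 1 2 \<noteq> {} \<or> chords_of_type (std xs) 2 1 \<noteq> {}"
    using l by (auto simp: lambda_diagram_def Lk_def)
  then have "\<exists>c. (c, 1, 2) \<in> set xs \<or> (c, 2, 1) \<in> set xs"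
    using types_std[OF x, of 1 2] types_std[OF x, of 2 1] by auto
  then show thesis using that[of _ 1 2] that[of _ 2 1] by auto
qed

lemma residue_writhe_shift:
  assumes x: "proper xs" and i: "i \<in> {1, 2}" and j: "j \<in> {1, 2}" and l: "lambda_diagram (std xs) = l"
    and z: "\<And>c. (c, i, j) \<in> set xs \<Longrightarrow> l dvd z' c - z c - k"
  shows "residue_writhe (std xs) (weight_of (std xs) z') i j r =
    residue_writhe (std xs) (weight_of (std xs) z) i j (r - k)"
proof -
  have "l dvd z' c - r \<longleftrightarrow> l dvd z c - (r - k)" if "(c, i, j) \<in> set xs" for c
  proof -
    have "z' c - r = (z' c - z c - k) + (z c - (r - k))" by simp
    then show ?thesis using z[OF that] by (metis dvd_add_right_iff)
  qed
  then have "{c \<in> chords_of_type (std xs) i j. l dvd z' c - r} =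
      {c \<in> chords_of_type (std xs) i j. l dvd z c - (r - k)}"
    using types_std[OF x i j] by auto
  then show ?thesis by (simp add: residue_writhe_def l)
qed

lemma key_sum_negate:
  assumes "\<And>c. c \<in> fst ` set ys \<Longrightarrow> sg (n c) = - sg c \<and> z (n c) = z c"
  shows "key_sum l z (map (\<lambda>(c, st). (n c, st)) ys) k = - key_sum l z ys k"
  using assms by (induction ys) (auto simp: key_def)

text \<open>
  The chords \<open>xs\<close> cancel against mirror images of \<open>xs'\<close>. The shift between the two sequences of residues
  is removed beforehand by \<open>std_shift\<close>, at the expense of the index of one nonself-chord.
\<close>

lemma S_agree_imp_zequiv:
  assumes x: "proper xs" and x': "proper xs'" and dj: "fst ` set xs \<inter> fst ` set xs' = {}"
    and ag: "S_agree (std xs) (weight_of (std xs) z) (std xs') (weight_of (std xs') z')"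
    and l2: "2 \<le> lambda_diagram (std xs)"
  shows "zequiv (std xs) z (std xs') z'"
proof -
  define l where "l = lambda_diagram (std xs)"
  have lam: "lambda_diagram (std xs) = l" "lambda_diagram (std xs') = l" and l0: "2 \<le> l"
    using ag l2 by (auto simp: S_agree_def l_def)
  have J1: "self_writhe (std xs') (weight_of (std xs') z') 1 n = self_writhe (std xs) (weight_of (std xs) z) 1 n"
    if "n \<notin> {0, 1, - l, - l + 1}" for n
    using ag l2 that unfolding S_agree_def lam by blast
  have J2: "self_writhe (std xs') (weight_of (std xs') z') 2 n = self_writhe (std xs) (weight_of (std xs) z) 2 n"
    if "n \<notin> {0, 1, l, l + 1}" for n
    using ag l2 that unfolding S_agree_def lam by blast
  have "shift_agree (std xs) (weight_of (std xs) z) (std xs') (weight_of (std xs') z')"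
    using ag l2 unfolding S_agree_def by blast
  then obtain k where k:
    "\<And>r. residue_writhe (std xs') (weight_of (std xs') z') 1 2 r = residue_writhe (std xs) (weight_of (std xs) z) 1 2 (r - k)"
    "\<And>r. residue_writhe (std xs') (weight_of (std xs') z') 2 1 r = residue_writhe (std xs) (weight_of (std xs) z) 2 1 (r + k)"
    unfolding shift_agree_def by blast
  obtain y0 s0 t0 where y0: "(y0, s0, t0) \<in> set xs" "s0 \<noteq> t0"
    by (rule nonself_entry[OF x]) (use l0 lam in auto)
  define z1 where "z1 = (\<lambda>d. z d + k * type_shift xs d - (if d = y0 then sg y0 * k * l else 0))"
  have e1: "zequiv (std xs) z (std xs) z1"
    using std_shift[OF x y0, of z k] unfolding lam z1_def .
  have z1_self: "z1 c = z c" if "(c, i, i) \<in> set xs" for c i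
  proof -
    have "c \<noteq> y0" using proper_unique[OF x that] y0 by auto
    then show ?thesis using type_shift_eq[OF x that] by (simp add: z1_def)
  qed
  have z1_nonself: "l dvd z1 c - z c - k * (int j - int i)" if "(c, i, j) \<in> set xs" for c i j
    using type_shift_eq[OF x that] by (simp add: z1_def)
  have keys: "key_sum l z1 xs K = key_sum l z' xs' K" if K: "\<not> removable l K" for K
  proof -
    obtain i j n where Kij: "K = (i, j, n)" by (cases K) auto
    show ?thesis
    proof (cases "i \<in> {1, 2} \<and> j \<in> {1, 2}")
      case False
      then have "(c, i, j) \<notin> set xs \<and> (c, i, j) \<notin> set xs'" for c
        using properD[OF x, of c i j] properD[OF x', of c i j] by blast
      then show ?thesis by (simp add: Kij key_sum_eq[OF x] key_sum_eq[OF x'])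
    next
      case True
      then have i: "i \<in> {1, 2}" and j: "j \<in> {1, 2}" by auto
      show ?thesis
      proof (cases "i = j")
        case True
        have "key_sum l z1 xs K = key_sum l z xs K"
          unfolding Kij True key_sum_eq[OF x] using z1_self by (intro sum.cong) auto
        also have "\<dots> = self_writhe (std xs) (weight_of (std xs) z) i n"
          using self_writhe_std[OF x i, of z n l] True by (simp add: Kij)
        also have "\<dots> = self_writhe (std xs') (weight_of (std xs') z') i n"
          using K i J1[of n] J2[of n] by (auto simp: Kij True removable_def)
        also have "\<dots> = key_sum l z' xs' K"
          using self_writhe_std[OF x' i, of z' n l] True by (simp add: Kij)
        finally show ?thesis .
      next
        case ne: False
        show ?thesis
        proof (cases "n mod l = n")
          case False
          then have "z c mod l \<noteq> n" for z :: "chord \<Rightarrow> int" and c by auto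
          then show ?thesis using ne by (simp add: Kij key_sum_eq[OF x] key_sum_eq[OF x'])
        next
          case True
          have "key_sum l z1 xs K = residue_writhe (std xs) (weight_of (std xs) z1) i j n"
            unfolding residue_writhe_std[OF x i j ne lam(1)] True Kij ..
          also have "\<dots> = residue_writhe (std xs) (weight_of (std xs) z) i j (n - k * (int j - int i))"
            by (rule residue_writhe_shift[OF x i j lam(1) z1_nonself])
          also have "\<dots> = residue_writhe (std xs') (weight_of (std xs') z') i j n"
            using i j ne k[of n] by auto
          also have "\<dots> = key_sum l z' xs' K"
            unfolding residue_writhe_std[OF x' i j ne lam(2)] True Kij ..
          finally show ?thesis .
        qed
      qed
    qed
  qed
  obtain M where M: "\<And>c. c \<in> fst ` set xs \<union> fst ` set xs' \<Longrightarrow> label c < M"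
    using label_bound[of "fst ` set xs \<union> fst ` set xs'"] by auto
  \<comment> \<open>the names of the mirror images\<close>
  define nf where "nf = (\<lambda>c. Chord (label c + M) (\<not> positive c))"
  \<comment> \<open>the last case recovers from a mirror image the chord that it mirrors\<close>
  define \<zeta> where "\<zeta> = (\<lambda>c. if c \<in> fst ` set xs then z1 c else if c \<in> fst ` set xs' then z' c
    else z' (Chord (label c - M) (\<not> positive c)))"
  have nf_new: "nf c \<notin> fst ` set xs \<union> fst ` set xs'" for c
    using M[of "nf c"] by (auto simp: nf_def)
  have nf_inj: "nf c = nf d \<longleftrightarrow> c = d" for c d by (auto simp: nf_def chord.expand)
  have \<zeta>1: "\<zeta> c = z1 c" if "c \<in> fst ` set xs" for c using that by (simp add: \<zeta>_def)
  have \<zeta>2: "\<zeta> c = z' c" if "c \<in> fst ` set xs'" for c using that dj by (auto simp: \<zeta>_def)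
  have \<zeta>3: "\<zeta> (nf c) = z' c" for c using nf_new[of c] by (simp add: \<zeta>_def) (simp add: nf_def)
  have nf: "sg (nf c) = - sg c \<and> \<zeta> (nf c) = \<zeta> c" if "c \<in> fst ` set xs'" for c
    using \<zeta>2[OF that] \<zeta>3[of c] by (simp add: nf_def chord_sign_def)
  let ?ns = "map (\<lambda>(c, st). (nf c, st)) xs'"
  have fns: "map fst ?ns = map nf (map fst xs')" by (auto simp: comp_def split_def)
  have okX: "proper (xs @ ?ns @ xs')"
  proof -
    have "distinct (map nf (map fst xs'))"
      using x' by (simp only: distinct_map[of nf]) (auto simp: proper_def inj_on_def nf_inj)
    moreover have "set (map nf (map fst xs')) \<inter> (fst ` set xs \<union> fst ` set xs') = {}"
      using nf_new by auto
    ultimately have "distinct (map fst xs @ map fst ?ns @ map fst xs')"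
      using x x' dj unfolding fns proper_def by auto
    then show ?thesis using x x' by (auto simp: proper_def)
  qed
  obtain y s t where y: "(y, s, t) \<in> set xs'" "s \<noteq> t"
    by (rule nonself_entry[OF x']) (use l0 lam in auto)
  define ys where "ys = remove1 (y, s, t) xs'"
  have my: "mset xs' = mset ((y, s, t) # ys)" using y(1) by (simp add: ys_def insert_DiffM)
  have okY: "proper ((xs @ ?ns) @ (y, s, t) # ys)" using okX proper_mset[of "xs @ ?ns @ xs'" "(xs @ ?ns) @ (y, s, t) # ys"] my by simp
  have e2: "zequiv (std xs) z1 (std xs) \<zeta>"
    by (rule zequiv_cong[OF gauss_diagram_std[OF x]])
      (use chords_std[OF x] \<zeta>1 in \<open>force\<close>)
  have e3: "zequiv (std xs) \<zeta> (std (xs @ ?ns @ xs')) \<zeta>" by (rule std_double[OF nf okX])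
  have e4: "zequiv (std (xs @ ?ns @ xs')) \<zeta> (std ((xs @ ?ns) @ (y, s, t) # ys)) \<zeta>"
    by (rule std_perm[OF okX]) (use my in simp)
  have lamX: "lambda_diagram (std ((xs @ ?ns) @ (y, s, t) # ys)) = l"
    using zequiv_lambda[OF e4] zequiv_lambda[OF e3] lam by simp
  have zero: "key_sum l \<zeta> (xs @ ?ns) K = 0" if "\<not> removable l K" for K
  proof -
    have "key_sum l \<zeta> xs K = key_sum l z1 xs K" by (rule key_sum_cong) (rule \<zeta>1)
    moreover have "key_sum l \<zeta> xs' K = key_sum l z' xs' K" by (rule key_sum_cong) (rule \<zeta>2)
    moreover have "key_sum l \<zeta> ?ns K = - key_sum l \<zeta> xs' K" by (rule key_sum_negate[OF nf])
    ultimately show ?thesis using keys[OF that] by simp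
  qed
  obtain b where e5: "zequiv (std ((xs @ ?ns) @ (y, s, t) # ys)) \<zeta> (std ((y, s, t) # ys)) (\<zeta>(y := \<zeta> y + b * l))"
    using cancel_balanced_entries[OF okY y(2) lamX zero] by blast
  have okY': "proper ((y, s, t) # ys)" using proper_mset[OF my] x' by simp
  have e6: "zequiv (std ((y, s, t) # ys)) (\<zeta>(y := \<zeta> y + b * l)) (std xs') (\<zeta>(y := \<zeta> y + b * l))"
    by (rule std_perm[OF okY' my[symmetric]])
  let ?z = "z'(y := z' y + b * l)"
  have e7: "zequiv (std xs') (\<zeta>(y := \<zeta> y + b * l)) (std xs') ?z"
  proof (rule zequiv_cong[OF gauss_diagram_std[OF x']])
    fix c assume "c \<in> chords (std xs')"
    then have "c \<in> fst ` set xs'" using chords_std[OF x'] by force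
    moreover have "y \<in> fst ` set xs'" using y(1) by force
    ultimately show "?z c = (\<zeta>(y := \<zeta> y + b * l)) c" using \<zeta>2 by simp
  qed
  have e: "zequiv (std xs) z (std xs') ?z"
    using e1 e2 e3 e4 e5 e6 e7 by (meson zequiv_trans)
  \<comment> \<open>changing the index of \<open>y\<close> by \<open>b l\<close> changes the number of shells by \<open>\<plusminus>b l\<close>\<close>
  have "b = 0"
  proof -
    let ?D = "std xs'" and ?w = "weight_of (std xs')"
    note v = gauss_diagram_std[OF x']
    have "S_agree (std xs) (weight_of (std xs) z) ?D (?w ?z)"
      using e by (simp add: zequiv_def dequiv_def)
    then have "S_agree ?D (?w z') ?D (?w ?z)" using ag S_agree_sym S_agree_trans by blast
    then have sc: "shell_count ?D (?w ?z) = shell_count ?D (?w z')"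
      using lam l0 by (simp add: S_agree_def)
    have "self_writhe ?D (?w ?z) i n = self_writhe ?D (?w z') i n" if i: "i \<in> {1, 2}" for i n
    proof -
      have "c \<noteq> y" if "(c, i, i) \<in> set xs'" for c using proper_unique[OF x' that] y by auto
      then have "key_sum l ?z xs' (i, i, n) = key_sum l z' xs' (i, i, n)"
        unfolding key_sum_eq[OF x'] by (intro sum.cong) auto
      then show ?thesis using self_writhe_std[OF x' i, of ?z n l] self_writhe_std[OF x' i, of z' n l] by simp
    qed
    then have "total_weight ?D (?w ?z) = total_weight ?D (?w z')" using sc by (simp add: shell_count_def)
    moreover have "?w ?z c = ?w z' c - (if c = y then sg y * b * l else 0)" for c
      by (simp add: weight_of_def algebra_simps)
    moreover have "y \<in> chords ?D" using chords_std[OF x'] y by blast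
    ultimately have "sg y * b * l = 0"
      by (simp add: total_weight_def sum_subtractf)
    then show "b = 0" using l0 by simp
  qed
  then show ?thesis using e by simp
qed

text \<open>
  The names of the chords of the second diagram are changed first, since the chords of both diagrams
  have to coexist in one diagram.
\<close>

theorem S_agree_imp_RS_equiv:
  assumes v: "gauss_diagram 2 G" and v': "gauss_diagram 2 G'"
    and ag: "S_agree G (\<lambda>_. 0) G' (\<lambda>_. 0)" and l2: "2 \<le> lambda_diagram G"
  shows "RS_equiv G G'"
proof -
  obtain N where N: "\<And>c. c \<in> chords G \<Longrightarrow> label c < N" using label_bound[OF finite_chords] by blast
  define f where "f = (\<lambda>c. Chord (label c + N) (positive c))"
  have f: "inj f" by (auto simp: inj_def f_def chord.expand)
  have v'': "gauss_diagram 2 (rename f G')" by (rule gauss_diagram_rename[OF v' f])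
  have sd: "same_diagram G' (rename f G')"
    unfolding same_diagram_iff using rotated_refl inj_on_subset[OF f]
    by (intro exI[of _ f]) (auto simp: f_def)
  have ag': "S_agree G (\<lambda>_. 0) (rename f G') (\<lambda>_. 0)"
    using S_agree_trans[OF ag R_agree_imp_S_agree[OF R_agree_same_diagram[OF v' v'' sd]]] .
  obtain xs z where xs: "proper xs" "fst ` set xs = chords G" "dequiv G (\<lambda>_. 0) (std xs) (weight_of (std xs) z)"
    using dequiv_std[OF v] by blast
  obtain xs' z' where xs': "proper xs'" "fst ` set xs' = chords (rename f G')"
    "dequiv (rename f G') (\<lambda>_. 0) (std xs') (weight_of (std xs') z')"
    using dequiv_std[OF v''] by blast
  have dj: "fst ` set xs \<inter> fst ` set xs' = {}"
    unfolding xs(2) xs'(2) chords_rename using N by (force simp: f_def)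
  have S: "S_agree (std xs) (weight_of (std xs) z) (std xs') (weight_of (std xs') z')"
    using xs(3) xs'(3) ag' unfolding dequiv_def by (blast intro: S_agree_trans S_agree_sym)
  have "2 \<le> lambda_diagram (std xs)" using xs(3) l2 by (simp add: dequiv_def S_agree_def)
  from S_agree_imp_zequiv[OF xs(1) xs'(1) dj S this]
  have "dequiv (std xs) (weight_of (std xs) z) (std xs') (weight_of (std xs') z')"
    unfolding zequiv_def .
  then have "dequiv G (\<lambda>_. 0) (rename f G') (\<lambda>_. 0)"
    using xs(3) xs'(3) by (blast intro: dequiv_trans dequiv_sym)
  then have "RS_equiv (realize G (\<lambda>_. 0)) (realize (rename f G') (\<lambda>_. 0))" by (simp add: dequiv_def)
  then show ?thesis
    using RS_equiv_realize_zero[OF v] RS_equiv_realize_zero[OF v''] RS_equiv_same_diagram[OF v' v'' sd]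
    by (meson RS_equiv_trans RS_equiv_sym)
qed

section \<open>Classification of links\<close>

lemma nonself_chords_nonempty:
  assumes "lambda_diagram D \<noteq> 0"
  shows "nonself_chords D \<noteq> {}"
  using assms by (auto simp: lambda_diagram_def Lk_def nonself_chords_def)

lemma self_writhe_no_weight: "self_writhe D (\<lambda>_. 0) i n = J_diagram D i n"
  by (simp add: self_writhe_def J_diagram_def)

lemma virtual_link_representative:
  assumes "L \<in> virtual_links 2"
  obtains G where "G \<in> L" "\<forall>D\<in>L. gauss_diagram 2 D \<and> R_agree G (\<lambda>_. 0) D (\<lambda>_. 0)"
proof -
  obtain G where G: "gauss_diagram 2 G" "L = R_equiv 2 `` {G}"
    using assms unfolding virtual_links_def by (auto elim: quotientE)
  show thesis
  proof (rule that)
    show "G \<in> L" using G by (simp add: R_equiv_def)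
    show "\<forall>D\<in>L. gauss_diagram 2 D \<and> R_agree G (\<lambda>_. 0) D (\<lambda>_. 0)"
      using R_agree_equivclp by (auto simp: G(2) R_equiv_def)
  qed
qed

text \<open>
  The invariants of a link are values of diagrams without weights, and these agree on the whole
  class.
\<close>

lemma link_invariants:
  assumes G: "G \<in> L" and L: "\<forall>D\<in>L. gauss_diagram 2 D \<and> R_agree G (\<lambda>_. 0) D (\<lambda>_. 0)"
  shows "lambda L = lambda_diagram G"
    "2 \<le> lambda_diagram G \<Longrightarrow> n \<notin> {0, - lambda_diagram G} \<Longrightarrow> J L 1 n = self_writhe G (\<lambda>_. 0) 1 n"
    "2 \<le> lambda_diagram G \<Longrightarrow> n \<notin> {0, lambda_diagram G} \<Longrightarrow> J L 2 n = self_writhe G (\<lambda>_. 0) 2 n"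
    "2 \<le> lambda_diagram G \<Longrightarrow> \<gamma> \<in> nonself_chords G \<Longrightarrow> linking_class L = F_diagram G \<gamma>"
proof -
  let ?l = "lambda_diagram G"
  have R: "R_agree G (\<lambda>_. 0) D (\<lambda>_. 0)" "gauss_diagram 2 D" if "D \<in> L" for D using bspec[OF L that] by auto
  have lam: "lambda_diagram D = ?l" if "D \<in> L" for D using R(1)[OF that] by (simp add: R_agree_def)
  show "lambda L = ?l" unfolding lambda_def
  proof (rule the_equality)
    show "\<forall>D\<in>L. ?l = lambda_diagram D" using lam by metis
  qed (use G in blast)
  show "J L 1 n = self_writhe G (\<lambda>_. 0) 1 n" if "2 \<le> ?l" "n \<notin> {0, - ?l}"
    unfolding J_def
  proof (rule the_equality)
    show "\<forall>D\<in>L. self_writhe G (\<lambda>_. 0) 1 n = J_diagram D 1 n"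
      using R(1) that unfolding R_agree_def self_writhe_no_weight[symmetric] by metis
  qed (use G self_writhe_no_weight in metis)
  show "J L 2 n = self_writhe G (\<lambda>_. 0) 2 n" if "2 \<le> ?l" "n \<notin> {0, ?l}"
    unfolding J_def
  proof (rule the_equality)
    show "\<forall>D\<in>L. self_writhe G (\<lambda>_. 0) 2 n = J_diagram D 2 n"
      using R(1) that unfolding R_agree_def self_writhe_no_weight[symmetric] by metis
  qed (use G self_writhe_no_weight in metis)
  show "linking_class L = F_diagram G \<gamma>" if "2 \<le> ?l" "\<gamma> \<in> nonself_chords G"
    unfolding linking_class_def
  proof (rule the_equality)
    show "\<forall>D\<in>L. \<forall>\<gamma>0\<in>nonself_chords D. F_diagram G \<gamma> = F_diagram D \<gamma>0"
    proof (intro ballI)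
      fix D \<gamma>0 assume D: "D \<in> L" "\<gamma>0 \<in> nonself_chords D"
      have "shift_agree G (\<lambda>_. 0) D (\<lambda>_. 0)" using R(1)[OF D(1)] that by (simp add: R_agree_def)
      then show "F_diagram G \<gamma> = F_diagram D \<gamma>0"
        using F_diagram_eq_iff[OF R(2)[OF G] R(2)[OF D(1)] that(2) D(2) lam[OF D(1)]] that(1) by simp
    qed
  qed (use G that in blast)
qed

theorem theorem1p4:
  fixes L L' :: "gauss set" and l :: int
  assumes "L \<in> virtual_links 2" and "L' \<in> virtual_links 2"
    and "lambda L = l" and "lambda L' = l" and "l \<ge> 2"
  shows "S_equivalent 2 L L' \<longleftrightarrow>
    (\<forall>n. n \<notin> {0, 1, -l, -l + 1} \<longrightarrow> J L 1 n = J L' 1 n) \<and>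
    (\<forall>n. n \<notin> {0, 1, l, l + 1} \<longrightarrow> J L 2 n = J L' 2 n) \<and>
    linking_class L = linking_class L' \<and>
    J L 1 1 + J L 1 (-l + 1) + J L 2 1 + J L 2 (l + 1) =
      J L' 1 1 + J L' 1 (-l + 1) + J L' 2 1 + J L' 2 (l + 1)"
proof -
  obtain G where G: "G \<in> L"
    and LG: "\<forall>D\<in>L. gauss_diagram 2 D \<and> R_agree G (\<lambda>_. 0) D (\<lambda>_. 0)"
    using virtual_link_representative[OF assms(1)] by blast
  obtain G' where G': "G' \<in> L'"
    and LG': "\<forall>D\<in>L'. gauss_diagram 2 D \<and> R_agree G' (\<lambda>_. 0) D (\<lambda>_. 0)"
    using virtual_link_representative[OF assms(2)] by blast
  note inv = link_invariants[OF G LG] and inv' = link_invariants[OF G' LG']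
  have v: "gauss_diagram 2 G" "gauss_diagram 2 G'" using bspec[OF LG G] bspec[OF LG' G'] by auto
  have lam: "lambda_diagram G = l" "lambda_diagram G' = l" using inv(1) inv'(1) assms(3,4) by auto
  note l = \<open>l \<ge> 2\<close>
  obtain \<gamma> where \<gamma>: "\<gamma> \<in> nonself_chords G" using nonself_chords_nonempty[of G] lam l by auto
  obtain \<gamma>' where \<gamma>': "\<gamma>' \<in> nonself_chords G'" using nonself_chords_nonempty[of G'] lam l by auto
  have J: "J L 1 n = self_writhe G (\<lambda>_. 0) 1 n" "J L' 1 n = self_writhe G' (\<lambda>_. 0) 1 n"
    if "n \<notin> {0, - l}" for n using inv(2)[of n] inv'(2)[of n] lam l that by simp_all
  have K: "J L 2 n = self_writhe G (\<lambda>_. 0) 2 n" "J L' 2 n = self_writhe G' (\<lambda>_. 0) 2 n"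
    if "n \<notin> {0, l}" for n using inv(3)[of n] inv'(3)[of n] lam l that by simp_all
  have F: "linking_class L = linking_class L' \<longleftrightarrow> shift_agree G (\<lambda>_. 0) G' (\<lambda>_. 0)"
    using inv(4)[OF _ \<gamma>] inv'(4)[OF _ \<gamma>'] F_diagram_eq_iff[OF v \<gamma> \<gamma>'] lam l by simp
  have T: "shell_count G (\<lambda>_. 0) = J L 1 1 + J L 1 (-l + 1) + J L 2 1 + J L 2 (l + 1)"
    "shell_count G' (\<lambda>_. 0) = J L' 1 1 + J L' 1 (-l + 1) + J L' 2 1 + J L' 2 (l + 1)"
    using l J[of 1] J[of "-l + 1"] K[of 1] K[of "l + 1"]
    by (simp_all add: shell_count_def total_weight_def lam)
  have "S_equivalent 2 L L' \<longleftrightarrow> S_agree G (\<lambda>_. 0) G' (\<lambda>_. 0)"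
  proof
    assume "S_equivalent 2 L L'"
    then obtain D D' where D: "D \<in> L" "D' \<in> L'" "RS_equiv D D'" unfolding S_equivalent_def by blast
    have "S_agree G (\<lambda>_. 0) D (\<lambda>_. 0)" using bspec[OF LG D(1)] R_agree_imp_S_agree by blast
    also have "S_agree D (\<lambda>_. 0) D' (\<lambda>_. 0)" by (rule S_agree_equivclp[OF D(3)])
    also have "S_agree D' (\<lambda>_. 0) G' (\<lambda>_. 0)"
      using bspec[OF LG' D(2)] R_agree_imp_S_agree S_agree_sym by blast
    finally show "S_agree G (\<lambda>_. 0) G' (\<lambda>_. 0)" .
  next
    assume "S_agree G (\<lambda>_. 0) G' (\<lambda>_. 0)"
    then have "RS_equiv G G'" using S_agree_imp_RS_equiv[OF v] lam l by simp
    then show "S_equivalent 2 L L'" using G G' unfolding S_equivalent_def by blast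
  qed
  also have "\<dots> \<longleftrightarrow>
    (\<forall>n. n \<notin> {0, 1, -l, -l + 1} \<longrightarrow> J L 1 n = J L' 1 n) \<and>
    (\<forall>n. n \<notin> {0, 1, l, l + 1} \<longrightarrow> J L 2 n = J L' 2 n) \<and>
    linking_class L = linking_class L' \<and>
    J L 1 1 + J L 1 (-l + 1) + J L 2 1 + J L 2 (l + 1) =
      J L' 1 1 + J L' 1 (-l + 1) + J L' 2 1 + J L' 2 (l + 1)"
    unfolding S_agree_def lam F T using l J K by auto
  finally show ?thesis .
qed

end
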